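(* Let $N\ge 2$, $T>0$, let $\Omega=\mathbb{T}^N$ be the flat torus obtained from $[-1,1]^N$ by identifying opposite faces, and let $\mathbf{u}_0\in L^2(\Omega;\mathbb{R}^N)$. Let $\mathbf{u},\mathbf{v}\in C([0,T),L^2(\Omega;\mathbb{R}^N))$ be two weak solutions of the incompressible Euler system $$\partial_t\mathbf{u}+\operatorname{div}_x(\mathbf{u}\otimes\mathbf{u})+\nabla_x p=0,\qquad \operatorname{div}_x\mathbf{u}=0\qquad\text{in }[0,T)\times\Omega,$$ both with the same initial data $\mathbf{u}_0$. Assume that $$\mathbf{u},\mathbf{v}\in L^3([0,T);B^{\alpha}_{p,\infty}(\Omega))\quad\text{for some }\alpha\in(0,1)\text{ with }\alpha>\tfrac13\text{ and some }p\ge 3.$$ Suppose that there is a non-negative function $\mathcal{C}\in L^1([0,T))$ such that $$\int_{\Omega}\left[-\big(\zeta\cdot\mathbf{v}(\tau,x)\big)\,(\zeta\cdot\nabla_x)\phi(x)+\mathcal{C}(\tau)|\zeta|^2\phi(x)\right]dx\ge 0$$ for all $\zeta\in\mathbb{R}^N$, all $\tau\in[0,T)$, and every $\phi\in C_c^\infty(\Omega)$ with $\phi\ge 0$. Then $\mathbf{u}\equiv\mathbf{v}$ in $[0,T)\times\Omega$.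
   Context: Weak solution: $\mathbf{u}\in C([0,T),L^2(\Omega;\mathbb{R}^N))$ is a weak solution of the incompressible Euler system with initial data $\mathbf{u}_0$ if $\mathbf{u}(0,\cdot)=\mathbf{u}_0$ and, for all $0\le\tau_1<\tau_2<T$: (i) $\displaystyle\int_{\tau_1}^{\tau_2}\!\int_\Omega\left[\mathbf{u}\cdot\partial_t\psi+\mathbf{u}\otimes\mathbf{u}:\nabla_x\psi\right]dx\,dt=\int_\Omega\mathbf{u}\cdot\psi(\tau_2,x)\,dx-\int_\Omega\mathbf{u}\cdot\psi(\tau_1,x)\,dx$ for every $\psi\in C_c^1([0,T)\times\Omega;\mathbb{R}^N)$ with $\operatorname{div}_x\psi=0$; (ii) $\displaystyle\int_{\tau_1}^{\tau_2}\!\int_\Omega\mathbf{u}\cdot\nabla_x\phi\,dx\,dt=0$ for every $\phi\in C_c^1([0,T)\times\Omega)$. Here $\mathbf{u}\otimes\mathbf{u}:\nabla_x\psi=\sum_{i,j}u_iu_j\partial_{x_j}\psi_i$. The pressure $p$ does not enter the weak formulation (the $p$ in the Euler system is unrelated to the integrability exponent $p$). Besov space: for $p\ge1$ and $\alpha\in(0,1)$, $$B^{\alpha}_{p,\infty}(\Omega)=\Big\{h\in L^p(\Omega):\ |h|_{B^\alpha_{p,\infty}}:=\sup_{\overline{\Omega_1}\subset\Omega}\ \sup_{\xi\in\mathbb{R}^N\setminus\{0\},\ \xi+\Omega_1\subset\Omega}\frac{\|h(\cdot+\xi)-h(\cdot)\|_{L^p(\Omega_1)}}{|\xi|^\alpha}<\infty\Big\},$$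 normed by $\|h\|_{L^p}+|h|_{B^\alpha_{p,\infty}}$; on the torus all translations $\xi$ are allowed and one may take $\Omega_1=\Omega$. For vector-valued functions the condition is imposed componentwise. *)

theory Defs
  imports "HOL-Analysis.Analysis"
begin

text \<open>
  Functions on the flat torus \<open>[-1,1]\<^sup>N\<close> with opposite faces identified are represented as
  functions on \<open>real ^ 'n\<close>, \<open>N = CARD('n)\<close>, that have period \<open>2\<close> in every coordinate.
  Elements of Lebesgue and Besov spaces are represented by such functions, and two of them are
  identified if they agree almost everywhere.
\<close>

definition torus_periodic :: "(real ^ 'n \<Rightarrow> 'b) \<Rightarrow> bool" where
  "torus_periodic h \<longleftrightarrow> (\<forall>x i. h (x + 2 *\<^sub>R axis i 1) = h x)"

definition torus_cell :: "(real ^ 'n) set" where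
  "torus_cell = cbox (vec (-1)) (vec 1)"

definition torus_Lp :: "real \<Rightarrow> (real ^ 'n \<Rightarrow> 'b::euclidean_space) \<Rightarrow> bool" where
  "torus_Lp p h \<longleftrightarrow> torus_periodic h \<and> h \<in> borel_measurable lebesgue \<and>
     set_integrable lebesgue torus_cell (\<lambda>x. norm (h x) powr p)"

definition torus_Lp_norm :: "real \<Rightarrow> (real ^ 'n \<Rightarrow> 'b::euclidean_space) \<Rightarrow> real" where
  "torus_Lp_norm p h = (LINT x:torus_cell|lebesgue. norm (h x) powr p) powr (1 / p)"

definition continuous_torus_L2 :: "real \<Rightarrow> (real \<Rightarrow> real ^ 'n \<Rightarrow> 'b::euclidean_space) \<Rightarrow> bool" where
  "continuous_torus_L2 T u \<longleftrightarrow>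
     (\<forall>t\<in>{0..<T}. torus_Lp 2 (u t) \<and>
        ((\<lambda>s. torus_Lp_norm 2 (\<lambda>x. u s x - u t x)) \<longlongrightarrow> 0) (at t within {0..<T}))"


subsection \<open>Besov spaces on the torus\<close>

definition besov_quotient :: "real \<Rightarrow> real \<Rightarrow> (real ^ 'n \<Rightarrow> real) \<Rightarrow> real ^ 'n \<Rightarrow> real" where
  "besov_quotient \<alpha> p h \<xi> = torus_Lp_norm p (\<lambda>x. h (x + \<xi>) - h x) / norm \<xi> powr \<alpha>"

definition besov :: "real \<Rightarrow> real \<Rightarrow> (real ^ 'n \<Rightarrow> real) \<Rightarrow> bool" where
  "besov \<alpha> p h \<longleftrightarrow> torus_Lp p h \<and> bdd_above (besov_quotient \<alpha> p h ` (UNIV - {0}))"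

text \<open>Only meaningful for \<open>h\<close> with \<open>besov \<alpha> p h\<close>, as the supremum is taken in the reals.\<close>

definition besov_norm :: "real \<Rightarrow> real \<Rightarrow> (real ^ 'n \<Rightarrow> real) \<Rightarrow> real" where
  "besov_norm \<alpha> p h = torus_Lp_norm p h + (SUP \<xi>\<in>UNIV - {0}. besov_quotient \<alpha> p h \<xi>)"

definition vec_besov :: "real \<Rightarrow> real \<Rightarrow> (real ^ 'n \<Rightarrow> real ^ 'm) \<Rightarrow> bool" where
  "vec_besov \<alpha> p h \<longleftrightarrow> (\<forall>i. besov \<alpha> p (\<lambda>x. h x $ i))"

definition vec_besov_norm :: "real \<Rightarrow> real \<Rightarrow> (real ^ 'n \<Rightarrow> real ^ 'm) \<Rightarrow> real" where
  "vec_besov_norm \<alpha> p h = (\<Sum>i\<in>UNIV. besov_norm \<alpha> p (\<lambda>x. h x $ i))"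

definition simple_besov :: "real \<Rightarrow> real \<Rightarrow> real \<Rightarrow> (real \<Rightarrow> real ^ 'n \<Rightarrow> real ^ 'm) \<Rightarrow> bool" where
  "simple_besov T \<alpha> p s \<longleftrightarrow> finite (s ` {0..<T}) \<and> (\<forall>t\<in>{0..<T}. vec_besov \<alpha> p (s t)) \<and>
     (\<forall>h. {t \<in> {0..<T}. s t = h} \<in> sets lebesgue)"

text \<open>
  The Bochner space \<open>L\<^sup>q([0,T); B)\<close>, \<open>B\<close> being the Besov space above: strongly measurable maps
  whose norm is in \<open>L\<^sup>q\<close>. The library's Bochner integral does not apply directly, because its
  values lie in a second countable type.
\<close>

definition Lq_besov :: "real \<Rightarrow> real \<Rightarrow> real \<Rightarrow> real \<Rightarrow> (real \<Rightarrow> real ^ 'n \<Rightarrow> real ^ 'm) \<Rightarrow> bool" where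
  "Lq_besov q T \<alpha> p u \<longleftrightarrow>
     (AE t in lebesgue. t \<in> {0..<T} \<longrightarrow> vec_besov \<alpha> p (u t)) \<and>
     (\<exists>s. (\<forall>k::nat. simple_besov T \<alpha> p (s k)) \<and>
        (AE t in lebesgue. t \<in> {0..<T} \<longrightarrow>
           (\<lambda>k. vec_besov_norm \<alpha> p (\<lambda>x. s k t x - u t x)) \<longlonglongrightarrow> 0)) \<and>
     set_integrable lebesgue {0..<T} (\<lambda>t. vec_besov_norm \<alpha> p (u t) powr q)"


subsection \<open>Test functions\<close>

definition partial_x :: "'n \<Rightarrow> (real ^ 'n \<Rightarrow> 'b::real_normed_vector) \<Rightarrow> real ^ 'n \<Rightarrow> 'b" where
  "partial_x j f x = frechet_derivative f (at x) (axis j 1)"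

definition partial_t ::
    "real \<Rightarrow> (real \<Rightarrow> real ^ 'n \<Rightarrow> 'b::real_normed_vector) \<Rightarrow> real \<Rightarrow> real ^ 'n \<Rightarrow> 'b" where
  "partial_t T \<psi> t x = vector_derivative (\<lambda>s. \<psi> s x) (at t within {0..<T})"

definition C1_on :: "'a::real_normed_vector set \<Rightarrow> ('a \<Rightarrow> 'b::real_normed_vector) \<Rightarrow> bool" where
  "C1_on S f \<longleftrightarrow> (\<exists>f'. (\<forall>z\<in>S. (f has_derivative blinfun_apply (f' z)) (at z within S)) \<and>
     continuous_on S f')"

text \<open>
  Test functions of class \<open>C\<^sub>c\<^sup>1([0,T) \<times> \<Omega>)\<close>; as \<open>\<Omega>\<close> is compact, having compact support means
  vanishing for \<open>t\<close> near \<open>T\<close>. The derivatives are one-sided in time at \<open>t = 0\<close>.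
\<close>

definition C1_test :: "real \<Rightarrow> (real \<Rightarrow> real ^ 'n \<Rightarrow> 'b::real_normed_vector) \<Rightarrow> bool" where
  "C1_test T \<psi> \<longleftrightarrow> C1_on ({0..<T} \<times> UNIV) (\<lambda>(t, x). \<psi> t x) \<and>
     (\<forall>t\<in>{0..<T}. torus_periodic (\<psi> t)) \<and>
     (\<exists>T'\<in>{0..<T}. \<forall>t\<in>{T'<..<T}. \<forall>x. \<psi> t x = 0)"

definition div_free :: "real \<Rightarrow> (real \<Rightarrow> real ^ 'n \<Rightarrow> real ^ 'n) \<Rightarrow> bool" where
  "div_free T \<psi> \<longleftrightarrow> (\<forall>t\<in>{0..<T}. \<forall>x. (\<Sum>i\<in>UNIV. partial_x i (\<psi> t) x $ i) = 0)"

primrec Ck :: "nat \<Rightarrow> (real ^ 'n \<Rightarrow> real) \<Rightarrow> bool" where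
  "Ck 0 \<phi> \<longleftrightarrow> continuous_on UNIV \<phi>"
| "Ck (Suc k) \<phi> \<longleftrightarrow> \<phi> differentiable_on UNIV \<and> (\<forall>i. Ck k (partial_x i \<phi>))"

definition torus_smooth :: "(real ^ 'n \<Rightarrow> real) \<Rightarrow> bool" where
  "torus_smooth \<phi> \<longleftrightarrow> torus_periodic \<phi> \<and> (\<forall>k. Ck k \<phi>)"


subsection \<open>Weak solutions of the incompressible Euler system\<close>

definition euler_momentum :: "real \<Rightarrow> (real \<Rightarrow> real ^ 'n \<Rightarrow> real ^ 'n) \<Rightarrow> bool" where
  "euler_momentum T u \<longleftrightarrow>
     (\<forall>\<tau>\<^sub>1 \<tau>\<^sub>2 \<psi>. 0 \<le> \<tau>\<^sub>1 \<longrightarrow> \<tau>\<^sub>1 < \<tau>\<^sub>2 \<longrightarrow> \<tau>\<^sub>2 < T \<longrightarrow> C1_test T \<psi> \<longrightarrow> div_free T \<psi> \<longrightarrow>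
        (LINT t:{\<tau>\<^sub>1..\<tau>\<^sub>2}|lebesgue. LINT x:torus_cell|lebesgue.
            u t x \<bullet> partial_t T \<psi> t x
            + (\<Sum>i\<in>UNIV. \<Sum>j\<in>UNIV. u t x $ i * u t x $ j * partial_x j (\<psi> t) x $ i))
        = (LINT x:torus_cell|lebesgue. u \<tau>\<^sub>2 x \<bullet> \<psi> \<tau>\<^sub>2 x)
          - (LINT x:torus_cell|lebesgue. u \<tau>\<^sub>1 x \<bullet> \<psi> \<tau>\<^sub>1 x))"

definition euler_incompressible :: "real \<Rightarrow> (real \<Rightarrow> real ^ 'n \<Rightarrow> real ^ 'n) \<Rightarrow> bool" where
  "euler_incompressible T u \<longleftrightarrow>
     (\<forall>\<tau>\<^sub>1 \<tau>\<^sub>2 (\<phi> :: real \<Rightarrow> real ^ 'n \<Rightarrow> real). 0 \<le> \<tau>\<^sub>1 \<longrightarrow> \<tau>\<^sub>1 < \<tau>\<^sub>2 \<longrightarrow> \<tau>\<^sub>2 < T \<longrightarrow> C1_test T \<phi> \<longrightarrow>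
        (LINT t:{\<tau>\<^sub>1..\<tau>\<^sub>2}|lebesgue. LINT x:torus_cell|lebesgue.
            (\<Sum>j\<in>UNIV. u t x $ j * partial_x j (\<phi> t) x)) = 0)"

definition euler_weak_solution ::
    "real \<Rightarrow> (real ^ 'n \<Rightarrow> real ^ 'n) \<Rightarrow> (real \<Rightarrow> real ^ 'n \<Rightarrow> real ^ 'n) \<Rightarrow> bool" where
  "euler_weak_solution T u0 u \<longleftrightarrow> continuous_torus_L2 T u \<and>
     (AE x in lebesgue. u 0 x = u0 x) \<and> euler_momentum T u \<and> euler_incompressible T u"

end

theory Submission
  imports Defs
begin

text \<open>
  Let \<open>w = u - v\<close>, and let \<open>K\<^sub>n\<close> be the de la Vallee-Poussin kernels, which are even non-negative
  trigonometric polynomials of mean one. The mollified energy \<open>F\<^sub>n(t) = \<integral>\<integral> K\<^sub>n(x - y) w(t,x) \<cdot> w(t,y)\<close> can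
  be differentiated in time with the weak formulation, as \<open>K\<^sub>n * w\<close> is a solenoidal test function. A
  commutator identity of Constantin-E-Titi type splits its derivative into a form that is cubic in the
  increments of \<open>u\<close>, \<open>v\<close> and \<open>w\<close>, and a quadratic form in \<open>w\<close> that the one-sided Lipschitz condition bounds
  by \<open>2 C(t) \<integral> |w|\<^sup>2\<close>. The cubic form is at most \<open>\<integral> |\<nabla> K\<^sub>n(z)| |z|\<^bsup>3\<alpha>\<^esup> dz\<close> times the cube of the Besov
  norms, and this moment tends to zero because \<open>3 \<alpha> > 1\<close>. In the limit \<open>W(t) = \<integral> |w(t)|\<^sup>2\<close> satisfies
  \<open>W(t) \<le> 2 \<integral>\<^sub>0\<^sup>t C W\<close>, so Gronwall's lemma gives \<open>W = 0\<close>.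
\<close>

subsection \<open>The measure space of the torus\<close>

text \<open>The obstacle is regularity in time: u and v are merely continuous into L^2, so the
  mollified difference cannot serve as a time-dependent test function. It is frozen at one time s;
  the weak formulation then moves the other argument of the form, and symmetry of the kernel
  recombines the two halves. Trigonometric kernels keep all this finite: \<open>K (x - y)\<close> is
  a finite sum of products a(x) b(y), so that convolutions are trigonometric polynomials, bilinear
  forms depend on finitely many moments, and their order of integration is exchanged by algebra. The
  kernel is proportional to the product of cos^(2n)(pi x_i / 2), whose moments come from integrating
  exact derivatives. Its peak has width n^(-1/2), and the gradient moment of order 3\<alpha> is at
  most of order n^(-(3\<alpha> - 1)/2); this is where the threshold 1/3 enters. The one-sided
  condition controls a form with v alone at the second point, whereas the flux carries v inside the
  product at the first. The trilinear identity trades one for the other at the price of cubic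
  increments.\<close>

definition torus_measure :: "(real ^ 'n) measure" ("\<T>") where
  "\<T> = density lborel (indicator torus_cell)"

lemma torus_cell_borel [measurable]: "torus_cell \<in> sets borel"
  by (simp add: torus_cell_def)

lemma sets_torus_measure [simp, measurable_cong]: "sets \<T> = sets borel"
  by (simp add: torus_measure_def)

lemma space_torus_measure [simp]: "space \<T> = UNIV"
  by (simp add: torus_measure_def)

lemma nn_integral_torus_measure:
  assumes [measurable]: "f \<in> borel_measurable borel"
  shows "(\<integral>\<^sup>+x. f x \<partial>\<T>) = (\<integral>\<^sup>+x. indicator torus_cell x * f x \<partial>lborel)"
  unfolding torus_measure_def by (subst nn_integral_density) auto

lemma finite_torus_measure: "finite_measure (\<T> :: (real ^ 'n) measure)"
proof
  have "emeasure (\<T> :: (real ^ 'n) measure) UNIV = emeasure lborel (torus_cell :: (real ^ 'n) set)"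
    by (simp add: torus_measure_def emeasure_density)
  also have "\<dots> < \<infinity>"
    unfolding torus_cell_def by (rule emeasure_lborel_cbox_finite)
  finally show "emeasure (\<T> :: (real ^ 'n) measure) (space \<T>) \<noteq> \<infinity>"
    by simp
qed

interpretation torus: finite_measure "\<T> :: (real ^ 'n) measure"
  by (rule finite_torus_measure)

interpretation torus2: pair_sigma_finite "\<T> :: (real ^ 'n) measure" "\<T> :: (real ^ 'n) measure" ..

lemma AE_torus_measure:
  fixes P :: "real ^ 'n \<Rightarrow> bool"
  assumes "AE x in lebesgue. P x"
  shows "AE x in \<T>. P x"
  using assms unfolding torus_measure_def
  by (subst AE_density) (auto simp: AE_completion_iff elim: eventually_mono)

lemma integrable_torus_measure:
  fixes g :: "real ^ 'n \<Rightarrow> real"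
  assumes [measurable]: "g \<in> borel_measurable borel"
  shows "integrable \<T> g \<longleftrightarrow> set_integrable lebesgue torus_cell g"
proof -
  have "integrable \<T> g \<longleftrightarrow> integrable (density lborel (\<lambda>x. ennreal (indicator torus_cell x))) g"
    by (simp add: torus_measure_def ennreal_indicator)
  also have "\<dots> \<longleftrightarrow> integrable lborel (\<lambda>x. indicator torus_cell x *\<^sub>R g x)"
    by (rule integrable_density) auto
  also have "\<dots> \<longleftrightarrow> set_integrable lebesgue torus_cell g"
    unfolding set_integrable_def by (rule integrable_completion[symmetric]) auto
  finally show ?thesis .
qed

lemma integral_torus_measure:
  fixes g :: "real ^ 'n \<Rightarrow> real"
  assumes [measurable]: "g \<in> borel_measurable borel"
  shows "integral\<^sup>L \<T> g = (LINT x:torus_cell|lebesgue. g x)"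
proof -
  have "integral\<^sup>L \<T> g = integral\<^sup>L (density lborel (\<lambda>x. ennreal (indicator torus_cell x))) g"
    by (simp add: torus_measure_def ennreal_indicator)
  also have "\<dots> = integral\<^sup>L lborel (\<lambda>x. indicator torus_cell x *\<^sub>R g x)"
    by (rule integral_density) auto
  also have "\<dots> = (LINT x:torus_cell|lebesgue. g x)"
    unfolding set_lebesgue_integral_def by (rule integral_completion[symmetric]) auto
  finally show ?thesis .
qed

text \<open>Completeness of Lebesgue measure: preimages under f and g differ only inside a null set,
  all of whose subsets are measurable.\<close>

lemma borel_measurable_lebesgue_cong_AE:
  fixes f g :: "real ^ 'n \<Rightarrow> 'b::topological_space"
  assumes g: "g \<in> borel_measurable lebesgue" and eq: "AE x in lebesgue. f x = g x"
  shows "f \<in> borel_measurable lebesgue"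
proof (rule measurableI)
  fix A :: "'b set" assume A: "A \<in> sets borel"
  obtain N where N: "{x. f x \<noteq> g x} \<subseteq> N" "N \<in> null_sets lebesgue"
    using eq by (auto elim!: AE_E simp: null_sets_def)
  have "f -` A \<inter> N \<in> sets lebesgue"
    using N(2) by (rule completion.complete[rotated]) auto
  moreover have "g -` A - N \<in> sets lebesgue"
    using measurable_sets[OF g A] N(2) by auto

  moreover have "(g -` A - N) \<union> (f -` A \<inter> N) = f -` A" using N(1) by auto
  ultimately show "f -` A \<inter> space lebesgue \<in> sets lebesgue"
    using sets.Un[of "g -` A - N" lebesgue "f -` A \<inter> N"] by simp
qed auto

lemma indicator_torus_cell_measurable [measurable]:
  "(indicator torus_cell :: real ^ 'n \<Rightarrow> real) \<in> borel_measurable lebesgue"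
  by (rule borel_measurable_indicator) (simp add: torus_cell_def)

text \<open>The bridge between the definitions, whose integrands are only Lebesgue measurable, and
  the proof, which works with Borel representatives and a Borel measure.\<close>

lemma integral_torus_measure_AE:
  fixes f g :: "real ^ 'n \<Rightarrow> real"
  assumes [measurable]: "g \<in> borel_measurable borel"
    and eq: "AE x in lebesgue. f x = g x"
  shows "(LINT x:torus_cell|lebesgue. f x) = integral\<^sup>L \<T> g"
proof -
  have m: "g \<in> borel_measurable lebesgue" by (rule measurable_completion) auto
  have f: "f \<in> borel_measurable lebesgue"
    using m eq by (rule borel_measurable_lebesgue_cong_AE)
  have "(LINT x:torus_cell|lebesgue. f x) = (LINT x:torus_cell|lebesgue. g x)"
    unfolding set_lebesgue_integral_def
    by (rule integral_cong_AE) (use eq m f in \<open>auto elim: eventually_mono\<close>)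
  then show ?thesis by (simp add: integral_torus_measure)
qed

lemma integrable_torus_measure_AE:
  fixes f g :: "real ^ 'n \<Rightarrow> real"
  assumes [measurable]: "g \<in> borel_measurable borel"
    and eq: "AE x in lebesgue. f x = g x" and int: "set_integrable lebesgue torus_cell f"
  shows "integrable \<T> g"
proof -
  have m: "g \<in> borel_measurable lebesgue" by (rule measurable_completion) auto
  have "set_integrable lebesgue torus_cell g"
    unfolding set_integrable_def
    by (rule integrable_cong_AE_imp[OF int[unfolded set_integrable_def]])
      (use eq m in \<open>auto elim: eventually_mono\<close>)
  then show ?thesis by (simp add: integrable_torus_measure)
qed

lemma borel_measurable_vec_lambda:
  fixes f :: "'a \<Rightarrow> 'm::finite \<Rightarrow> real"
  assumes "\<And>i. (\<lambda>x. f x i) \<in> borel_measurable M"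
  shows "(\<lambda>x. \<chi> i. f x i) \<in> borel_measurable M"
  using assms by (subst borel_measurable_euclidean_space) (auto simp: Basis_vec_def inner_axis)

text \<open>Each component has a Borel version, and the finitely many exceptional null sets unite to
  one.\<close>

lemma borel_measurable_lebesgue_AE:
  fixes f :: "real ^ 'n \<Rightarrow> real ^ 'm"
  assumes f: "f \<in> borel_measurable lebesgue"
  shows "\<exists>g\<in>borel_measurable borel. AE x in lebesgue. f x = g x"
proof -
  have "\<exists>g\<in>borel_measurable lborel. AE x in lborel. f x $ i = g x" for i
    by (rule completion_ex_borel_measurable_real)
      (use borel_measurable_continuous_onI[of "\<lambda>x. x $ i"] f in \<open>auto intro!: measurable_compose[OF f]\<close>)
  then have "\<forall>i. \<exists>g. g \<in> borel_measurable lborel \<and> (AE x in lborel. f x $ i = g x)" by blast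
  then obtain g where g: "\<And>i. g i \<in> borel_measurable lborel" "\<And>i. AE x in lborel. f x $ i = g i x"
    by metis
  show ?thesis
  proof
    show "(\<lambda>x. \<chi> i. g i x) \<in> borel_measurable borel"
      using g(1) by (intro borel_measurable_vec_lambda) auto
    have "AE x in lborel. \<forall>i. f x $ i = g i x" using g(2) by (simp add: AE_all_countable)
    then show "AE x in lebesgue. f x = (\<chi> i. g i x)"
      by (intro AE_completion) (auto simp: vec_eq_iff elim: eventually_mono)
  qed
qed

subsection \<open>Periodicity and translation invariance\<close>

definition torus_lattice :: "int ^ 'n \<Rightarrow> real ^ 'n" where
  "torus_lattice k = (\<chi> i. 2 * real_of_int (k $ i))"

text \<open>The half-open cell is an exact fundamental domain: its lattice translates partition
  space, while closed cells overlap in their faces. The two cells differ by a null set.\<close>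

definition torus_cell' :: "(real ^ 'n) set" where
  "torus_cell' = {x. \<forall>i. -1 \<le> x $ i \<and> x $ i < 1}"

lemma torus_cell'_borel [measurable]: "torus_cell' \<in> sets borel"
  unfolding torus_cell'_def by measurable

lemma torus_periodic_axis:
  assumes "torus_periodic h"
  shows "h (x + (2 * real_of_int k) *\<^sub>R axis i 1) = h x"
proof (induction k rule: int_induct[where k = 0])
  case (step1 k)
  have "h (x + (2 * real_of_int (k + 1)) *\<^sub>R axis i 1)
      = h ((x + (2 * real_of_int k) *\<^sub>R axis i 1) + 2 *\<^sub>R axis i 1)"
    by (simp add: algebra_simps)
  also have "\<dots> = h (x + (2 * real_of_int k) *\<^sub>R axis i 1)"
    using assms unfolding torus_periodic_def by blast
  finally show ?case using step1 by simp
next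
  case (step2 k)
  have "h (x + (2 * real_of_int (k - 1)) *\<^sub>R axis i 1)
      = h ((x + (2 * real_of_int (k - 1)) *\<^sub>R axis i 1) + 2 *\<^sub>R axis i 1)"
    using assms unfolding torus_periodic_def by metis
  also have "\<dots> = h (x + (2 * real_of_int k) *\<^sub>R axis i 1)"
    by (simp add: algebra_simps)
  finally show ?case using step2 by simp
qed simp

lemma torus_periodic_lattice:
  assumes "torus_periodic h"
  shows "h (x + torus_lattice k) = h x"
proof -
  have "h (x + (\<Sum>i\<in>I. (2 * real_of_int (k $ i)) *\<^sub>R axis i 1)) = h x" if "finite I" for I
    using that
  proof (induction I)
    case (insert j I)
    then show ?case
      using torus_periodic_axis[OF assms, of "x + (\<Sum>i\<in>I. (2 * real_of_int (k $ i)) *\<^sub>R axis i 1)" "k $ j" j]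
      by (simp add: algebra_simps)
  qed simp
  from this[of UNIV] show ?thesis
    by (simp add: torus_lattice_def basis_expansion[of "\<chi> i. 2 * real_of_int (k $ i)", simplified] scalar_mult_eq_scaleR[symmetric])
qed

text \<open>The unique lattice index whose translation carries x into the half-open cell; the floor
  counts the periods by which each coordinate is off.\<close>

definition torus_red :: "real ^ 'n \<Rightarrow> int ^ 'n" where
  "torus_red x = (\<chi> i. - \<lfloor>(x $ i + 1) / 2\<rfloor>)"

lemma torus_cell'_lattice_iff: "x + torus_lattice k \<in> torus_cell' \<longleftrightarrow> k = torus_red x"
proof -
  have "(- 1 \<le> x $ i + 2 * real_of_int (k $ i) \<and> x $ i + 2 * real_of_int (k $ i) < 1) \<longleftrightarrow>
     k $ i = - \<lfloor>(x $ i + 1) / 2\<rfloor>" for i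
  proof -
    have "k $ i = - \<lfloor>(x $ i + 1) / 2\<rfloor> \<longleftrightarrow> \<lfloor>(x $ i + 1) / 2\<rfloor> = - k $ i" by auto
    also have "\<dots> \<longleftrightarrow> (- 1 \<le> x $ i + 2 * real_of_int (k $ i) \<and> x $ i + 2 * real_of_int (k $ i) < 1)"
      unfolding floor_eq_iff by (auto simp: field_simps)
    finally show ?thesis by simp
  qed
  then show ?thesis
    by (simp add: torus_cell'_def torus_lattice_def torus_red_def vec_eq_iff)
qed

lemma AE_torus_cell':
  "AE x::real ^ 'n in lborel. x \<in> torus_cell \<longleftrightarrow> x \<in> torus_cell'"
proof -
  have "negligible (torus_cell - box (vec (- 1)) (vec 1) :: (real ^ 'n) set)"
    unfolding torus_cell_def by (rule negligible_frontier_interval)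
  then have "AE x::real ^ 'n in lebesgue. x \<notin> torus_cell - box (vec (- 1)) (vec 1)"
    by (intro AE_not_in) (simp add: negligible_iff_null_sets)
  then have "AE x::real ^ 'n in lborel. x \<notin> torus_cell - box (vec (- 1)) (vec 1)"
    by (simp add: AE_completion_iff)
  then show ?thesis
  proof (rule eventually_mono)
    fix x :: "real ^ 'n"
    assume "x \<notin> torus_cell - box (vec (- 1)) (vec 1)"
    then show "x \<in> torus_cell \<longleftrightarrow> x \<in> torus_cell'"
      by (auto simp: torus_cell_def torus_cell'_def mem_box_cart dual_order.strict_implies_order)
  qed
qed

lemma nn_integral_lborel_translation:
  fixes f :: "real ^ 'n \<Rightarrow> ennreal"
  assumes [measurable]: "f \<in> borel_measurable borel"
  shows "(\<integral>\<^sup>+x. f (x + a) \<partial>lborel) = (\<integral>\<^sup>+x. f x \<partial>lborel)"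
proof -
  have "(\<integral>\<^sup>+x. f x \<partial>lborel) = (\<integral>\<^sup>+x. f x \<partial>(distr lborel borel ((+) a)))"
    by (simp add: lborel_distr_plus)
  also have "\<dots> = (\<integral>\<^sup>+x. f (a + x) \<partial>lborel)"
    by (rule nn_integral_distr) auto
  finally show ?thesis by (simp add: add.commute)
qed

lemma nn_integral_torus_cell':
  fixes f :: "real ^ 'n \<Rightarrow> ennreal"
  assumes [measurable]: "f \<in> borel_measurable borel"
  shows "(\<integral>\<^sup>+x. f x \<partial>\<T>) = (\<integral>\<^sup>+x. indicator torus_cell' x * f x \<partial>lborel)"
  unfolding nn_integral_torus_measure[OF assms]
  by (rule nn_integral_cong_AE, rule eventually_mono[OF AE_torus_cell']) (simp add: indicator_def)

lemma nn_integral_torus_lattice_indicator: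
  "(\<integral>\<^sup>+k. indicator torus_cell' (x + torus_lattice k) \<partial>count_space UNIV) = 1"
proof -
  have "(\<integral>\<^sup>+k. indicator torus_cell' (x + torus_lattice k) \<partial>count_space UNIV)
      = (\<integral>\<^sup>+k. indicator {torus_red x} k \<partial>count_space UNIV)"
    by (rule nn_integral_cong) (simp add: indicator_def torus_cell'_lattice_iff)
  then show ?thesis by simp
qed

text \<open>The translated cell is cut along the tiling of space by the lattice translates of \<open>torus_cell'\<close>.\<close>

lemma nn_integral_torus_translation:
  fixes f :: "real ^ 'n \<Rightarrow> ennreal"
  assumes [measurable]: "f \<in> borel_measurable borel" and per: "torus_periodic f"
  shows "(\<integral>\<^sup>+x. f (x + a) \<partial>\<T>) = (\<integral>\<^sup>+x. f x \<partial>\<T>)"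
proof -
  let ?H = "indicator torus_cell' :: real ^ 'n \<Rightarrow> ennreal"
  have "(\<integral>\<^sup>+x. f (x + a) \<partial>\<T>) = (\<integral>\<^sup>+x. ?H x * f (x + a) \<partial>lborel)"
    by (rule nn_integral_torus_cell') auto
  also have "\<dots> = (\<integral>\<^sup>+x. ?H (x - a) * f x \<partial>lborel)"
    using nn_integral_lborel_translation[of "\<lambda>x. ?H (x - a) * f x" a] by simp
  \<comment> \<open>A factor 1 is inserted: exactly one lattice translate of x lies in the half-open
    cell.\<close>
  also have "\<dots> = (\<integral>\<^sup>+x. \<integral>\<^sup>+k. ?H (x - a) * f x * ?H (x + torus_lattice k) \<partial>count_space UNIV \<partial>lborel)"
    by (simp add: nn_integral_cmult nn_integral_torus_lattice_indicator)
  also have "\<dots> = (\<integral>\<^sup>+k. \<integral>\<^sup>+x. ?H (x - a) * f x * ?H (x + torus_lattice k) \<partial>lborel \<partial>count_space UNIV)"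
    by (rule nn_integral_count_space_nn_integral) auto
  \<comment> \<open>Replacing x by \<open>x + torus_lattice (- k)\<close> carries the k-th piece of
    the translated cell back into \<open>torus_cell'\<close>; f does not change, being
    periodic.\<close>
  also have "\<dots> = (\<integral>\<^sup>+k. \<integral>\<^sup>+x. ?H x * f x * ?H (x - a + torus_lattice (- k)) \<partial>lborel \<partial>count_space UNIV)"
  proof (rule nn_integral_cong)
    fix k :: "int ^ 'n"
    have l: "torus_lattice (- k) = - torus_lattice k" by (simp add: torus_lattice_def vec_eq_iff)
    have "f (x + torus_lattice (- k)) = f x" for x by (rule torus_periodic_lattice[OF per])
    then show "(\<integral>\<^sup>+x. ?H (x - a) * f x * ?H (x + torus_lattice k) \<partial>lborel)
        = (\<integral>\<^sup>+x. ?H x * f x * ?H (x - a + torus_lattice (- k)) \<partial>lborel)"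
      using nn_integral_lborel_translation[of "\<lambda>x. ?H (x - a) * f x * ?H (x + torus_lattice k)" "torus_lattice (- k)"]
      by (simp add: l algebra_simps)
  qed
  also have "\<dots> = (\<integral>\<^sup>+x. \<integral>\<^sup>+k. ?H x * f x * ?H (x - a + torus_lattice (- k)) \<partial>count_space UNIV \<partial>lborel)"
    by (rule nn_integral_count_space_nn_integral[symmetric]) auto
  also have "\<dots> = (\<integral>\<^sup>+x. ?H x * f x \<partial>lborel)"
  proof (rule nn_integral_cong)
    fix x :: "real ^ 'n"
    have "(\<integral>\<^sup>+k. ?H (x - a + torus_lattice (- k)) \<partial>count_space UNIV)
       = (\<integral>\<^sup>+k. ?H (x - a + torus_lattice k) \<partial>count_space UNIV)"
      by (rule nn_integral_bij_count_space[of uminus UNIV UNIV "\<lambda>k. ?H (x - a + torus_lattice k)"])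
         (auto simp: bij_betw_def inj_on_def surj_def intro: exI[of _ "- y" for y])
    then show "(\<integral>\<^sup>+k. ?H x * f x * ?H (x - a + torus_lattice (- k)) \<partial>count_space UNIV) = ?H x * f x"
      by (simp add: nn_integral_cmult nn_integral_torus_lattice_indicator)
  qed
  also have "\<dots> = (\<integral>\<^sup>+x. f x \<partial>\<T>)"
    by (rule nn_integral_torus_cell'[symmetric]) auto
  finally show ?thesis .
qed

text \<open>Positive and negative parts reduce to the non-negative case. If f is not integrable,
  neither is its translate, and both integrals have the default value 0.\<close>

lemma
  fixes f :: "real ^ 'n \<Rightarrow> real"
  assumes [measurable]: "f \<in> borel_measurable borel" and per: "torus_periodic f"
  shows integrable_torus_translation: "integrable \<T> (\<lambda>x. f (x + a)) \<longleftrightarrow> integrable \<T> f"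
    and integral_torus_translation: "(\<integral>x. f (x + a) \<partial>\<T>) = (\<integral>x. f x \<partial>\<T>)"
proof -
  have p: "torus_periodic (\<lambda>x. ennreal (g (f x)))" for g
    using per by (simp add: torus_periodic_def)
  have *: "(\<integral>\<^sup>+x. ennreal (g (f (x + a))) \<partial>\<T>) = (\<integral>\<^sup>+x. ennreal (g (f x)) \<partial>\<T>)"
    if [measurable]: "g \<in> borel_measurable borel" for g
    by (rule nn_integral_torus_translation[OF _ p]) auto
  show eq: "integrable \<T> (\<lambda>x. f (x + a)) \<longleftrightarrow> integrable \<T> f"
    using *[of norm] by (simp add: integrable_iff_bounded)
  show "(\<integral>x. f (x + a) \<partial>\<T>) = (\<integral>x. f x \<partial>\<T>)"
  proof (cases "integrable \<T> f")
    case True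
    then show ?thesis using eq *[of "\<lambda>x. x"] *[of "uminus"] by (simp add: real_lebesgue_integral_def)
  next
    case False
    then show ?thesis using eq by (simp add: not_integrable_integral_eq)
  qed
qed

lemma nn_integral_lborel_reflection:
  fixes f :: "real ^ 'n \<Rightarrow> ennreal"
  assumes [measurable]: "f \<in> borel_measurable borel"
  shows "(\<integral>\<^sup>+x. f (- x) \<partial>lborel) = (\<integral>\<^sup>+x. f x \<partial>lborel)"
proof -
  have "(\<integral>\<^sup>+x. f x \<partial>lborel) = (\<integral>\<^sup>+x. f x \<partial>(distr lborel borel uminus))"
    using lborel_affine[of "-1" "0 :: real ^ 'n"] by (simp add: density_1)
  also have "\<dots> = (\<integral>\<^sup>+x. f (- x) \<partial>lborel)"
    by (rule nn_integral_distr) auto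
  finally show ?thesis by simp
qed

lemma nn_integral_torus_reflection:
  fixes f :: "real ^ 'n \<Rightarrow> ennreal"
  assumes [measurable]: "f \<in> borel_measurable borel"
  shows "(\<integral>\<^sup>+x. f (- x) \<partial>\<T>) = (\<integral>\<^sup>+x. f x \<partial>\<T>)"
proof -
  have "- x \<in> torus_cell \<longleftrightarrow> x \<in> torus_cell" for x :: "real ^ 'n"
    unfolding torus_cell_def mem_box_cart by (auto simp: minus_le_iff)
  then show ?thesis
    using nn_integral_lborel_reflection[of "\<lambda>x. indicator torus_cell x * f x"]
    by (simp add: nn_integral_torus_measure indicator_def)
qed

lemma nn_integral_torus_shift_reflection:
  fixes f :: "real ^ 'n \<Rightarrow> ennreal"
  assumes [measurable]: "f \<in> borel_measurable borel" and per: "torus_periodic f"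
  shows "(\<integral>\<^sup>+x. f x \<partial>\<T>) = (\<integral>\<^sup>+x. f (a - x) \<partial>\<T>)"
proof -
  have "(\<integral>\<^sup>+x. f x \<partial>\<T>) = (\<integral>\<^sup>+x. f (x + a) \<partial>\<T>)"
    by (rule nn_integral_torus_translation[symmetric]) (use assms in auto)
  also have "\<dots> = (\<integral>\<^sup>+x. f (- x + a) \<partial>\<T>)"
    by (rule nn_integral_torus_reflection[symmetric]) auto
  finally show ?thesis by simp
qed

lemma integral_torus_shift_reflection:
  fixes f :: "real ^ 'n \<Rightarrow> real"
  assumes [measurable]: "f \<in> borel_measurable borel" and per: "torus_periodic f"
  shows "(\<integral>x. f (a - x) \<partial>\<T>) = (\<integral>x. f x \<partial>\<T>)"
proof -
  have p: "torus_periodic (\<lambda>x. ennreal (g (f x)))" for g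
    using per by (simp add: torus_periodic_def)
  have *: "(\<integral>\<^sup>+x. ennreal (g (f (a - x))) \<partial>\<T>) = (\<integral>\<^sup>+x. ennreal (g (f x)) \<partial>\<T>)"
    if [measurable]: "g \<in> borel_measurable borel" for g
    by (rule nn_integral_torus_shift_reflection[OF _ p, symmetric]) auto
  have eq: "integrable \<T> (\<lambda>x. f (a - x)) \<longleftrightarrow> integrable \<T> f"
    using *[of norm] by (simp add: integrable_iff_bounded)
  show ?thesis
  proof (cases "integrable \<T> f")
    case True
    then show ?thesis using eq *[of "\<lambda>x. x"] *[of "uminus"] by (simp add: real_lebesgue_integral_def)
  next
    case False
    then show ?thesis using eq by (simp add: not_integrable_integral_eq)
  qed
qed

text \<open>The exceptional set is the union of countably many lattice translates of its part in one
  cell, each of them null.\<close>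

lemma AE_torus_periodic:
  fixes P :: "real ^ 'n \<Rightarrow> bool"
  assumes per: "torus_periodic P" and ae: "AE x in \<T>. P x"
  shows "AE x in lebesgue. P x"
proof -
  have "AE x in lborel. x \<in> torus_cell \<longrightarrow> P x"
    using ae unfolding torus_measure_def by (subst (asm) AE_density) (auto elim: eventually_mono)
  with AE_torus_cell' have "AE x in lborel. x \<in> torus_cell' \<longrightarrow> P x"
    by eventually_elim auto
  then have ae: "AE x in (distr lborel borel ((+) (torus_lattice k))). x \<in> torus_cell' \<longrightarrow> P x" for k
    unfolding lborel_distr_plus .
  have "AE x in lborel. torus_lattice k + x \<in> torus_cell' \<longrightarrow> P (torus_lattice k + x)" for k :: "int ^ 'n"
    by (rule AE_distrD[OF _ ae]) auto
  then have "AE x in lborel. \<forall>k. torus_lattice k + x \<in> torus_cell' \<longrightarrow> P (torus_lattice k + x)"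
    by (simp add: AE_all_countable)
  then have "AE x in lborel. P x"
  proof (rule eventually_mono)
    fix x :: "real ^ 'n"
    assume "\<forall>k. torus_lattice k + x \<in> torus_cell' \<longrightarrow> P (torus_lattice k + x)"
    then have "P (x + torus_lattice (torus_red x))"
      using torus_cell'_lattice_iff[of x "torus_red x"] by (simp add: add.commute)
    then show "P x" using torus_periodic_lattice[OF per] by simp
  qed
  then show ?thesis by (rule AE_completion)
qed

text \<open>A Borel version g need not be periodic. Reading it only at the reduced point,
  \<open>h x = g (x + torus_lattice (torus_red x))\<close>, enforces periodicity; the reduction map
  is Borel because the floor is, and h agrees with g almost everywhere on the cell.\<close>

lemma torus_borel_representative:
  fixes f :: "real ^ 'n \<Rightarrow> real ^ 'm"
  assumes f: "f \<in> borel_measurable lebesgue" and per: "torus_periodic f"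
  shows "\<exists>g. g \<in> borel_measurable borel \<and> torus_periodic g \<and> (AE x in lebesgue. f x = g x)"
proof -
  obtain g where [measurable]: "g \<in> borel_measurable borel" and g: "AE x in lebesgue. f x = g x"
    using borel_measurable_lebesgue_AE[OF f] by blast
  define h where "h x = g (x + torus_lattice (torus_red x))" for x
  have [measurable]: "(\<lambda>x::real ^ 'n. x + torus_lattice (torus_red x)) \<in> borel_measurable borel"
  proof -
    have "(\<lambda>x::real ^ 'n. \<chi> i. x $ i + 2 * real_of_int (- \<lfloor>(x $ i + 1) / 2\<rfloor>)) \<in> borel_measurable borel"
      by (rule borel_measurable_vec_lambda) measurable
    then show ?thesis by (simp add: torus_lattice_def torus_red_def plus_vec_def)
  qed
  have red: "torus_red (x + 2 *\<^sub>R axis i 1) = torus_red x - axis i 1" for x :: "real ^ 'n" and i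
  proof -
    have "\<lfloor>(x $ j + 2 * axis i 1 $ j + 1) / 2\<rfloor> = \<lfloor>(x $ j + 1) / 2\<rfloor> + axis i 1 $ j" for j
    proof (cases "j = i")
      case True
      have "(3 + x $ i) / 2 = (x $ i + 1) / 2 + 1" by (simp add: field_simps)
      then have "\<lfloor>(3 + x $ i) / 2\<rfloor> = \<lfloor>(x $ i + 1) / 2\<rfloor> + 1" by linarith
      then show ?thesis using True by (simp add: axis_def)
    qed (simp add: axis_def)
    then show ?thesis by (simp add: torus_red_def vec_eq_iff)
  qed
  have "h (x + 2 *\<^sub>R axis i 1) = h x" for x i
  proof -
    have "torus_lattice (torus_red x - axis i 1) = torus_lattice (torus_red x) - 2 *\<^sub>R axis i 1"
      by (auto simp: torus_lattice_def vec_eq_iff axis_def)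
    then show ?thesis unfolding h_def red by simp
  qed
  then have hp: "torus_periodic h" by (simp add: torus_periodic_def)
  have "AE x in lebesgue. f x = h x"
  proof (rule AE_torus_periodic)
    show "torus_periodic (\<lambda>x. f x = h x)"
      using per hp by (simp add: torus_periodic_def)
    have "AE x in lborel. f x = g x" using g by (simp add: AE_completion_iff)
    with AE_torus_cell' have "AE x in lborel. x \<in> torus_cell \<longrightarrow> f x = h x"
    proof eventually_elim
      case (elim x)
      show ?case
      proof
        assume "x \<in> torus_cell"
        then have "x + torus_lattice 0 \<in> torus_cell'"
          using elim by (auto simp: torus_lattice_def zero_vec_def[symmetric])
        then have "torus_red x = 0" by (simp only: torus_cell'_lattice_iff)
        then show "f x = h x" using elim by (simp add: h_def torus_lattice_def zero_vec_def[symmetric])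
      qed
    qed
    then show "AE x in \<T>. f x = h x"
      unfolding torus_measure_def by (subst AE_density) (auto elim!: eventually_mono)
  qed
  moreover have "h \<in> borel_measurable borel" unfolding h_def by measurable
  ultimately show ?thesis using hp by blast
qed

subsection \<open>Trigonometric polynomials\<close>

text \<open>Generated as an algebra rather than given by Fourier sums, so that periodicity,
  boundedness, separability and closure under differentiation all follow by rule induction.\<close>

inductive trig_poly :: "(real ^ 'n \<Rightarrow> real) \<Rightarrow> bool" where
  trig_poly_const: "trig_poly (\<lambda>_. c)"
| trig_poly_cos: "trig_poly (\<lambda>x. cos (pi * x $ i))"
| trig_poly_sin: "trig_poly (\<lambda>x. sin (pi * x $ i))"
| trig_poly_add: "trig_poly f \<Longrightarrow> trig_poly g \<Longrightarrow> trig_poly (\<lambda>x. f x + g x)"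
| trig_poly_mult: "trig_poly f \<Longrightarrow> trig_poly g \<Longrightarrow> trig_poly (\<lambda>x. f x * g x)"

lemma trig_poly_cmult: "trig_poly f \<Longrightarrow> trig_poly (\<lambda>x. c * f x)"
  by (intro trig_poly_mult trig_poly_const)

lemma trig_poly_uminus: "trig_poly f \<Longrightarrow> trig_poly (\<lambda>x. - f x)"
  using trig_poly_cmult[of f "-1"] by simp

lemma trig_poly_sum: "(\<And>i. i \<in> I \<Longrightarrow> trig_poly (f i)) \<Longrightarrow> trig_poly (\<lambda>x. \<Sum>i\<in>I. f i x)"
  by (induction I rule: infinite_finite_induct) (auto intro: trig_poly_const trig_poly_add)

lemma trig_poly_prod: "(\<And>i. i \<in> I \<Longrightarrow> trig_poly (f i)) \<Longrightarrow> trig_poly (\<lambda>x. \<Prod>i\<in>I. f i x)"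
  by (induction I rule: infinite_finite_induct) (auto intro: trig_poly_const trig_poly_mult)

lemma trig_poly_power: "trig_poly f \<Longrightarrow> trig_poly (\<lambda>x. f x ^ k)"
  by (induction k) (auto intro: trig_poly_const trig_poly_mult)

lemma trig_poly_periodic: "trig_poly f \<Longrightarrow> torus_periodic f"
proof (induction rule: trig_poly.induct)
  case (trig_poly_cos i)
  show ?case by (auto simp: torus_periodic_def axis_def ring_distribs mult.commute[of pi 2])
next
  case (trig_poly_sin i)
  show ?case by (auto simp: torus_periodic_def axis_def ring_distribs mult.commute[of pi 2])
qed (auto simp: torus_periodic_def)

lemma trig_poly_translation: "trig_poly f \<Longrightarrow> trig_poly (\<lambda>x. f (x + a))"
proof (induction rule: trig_poly.induct)
  case (trig_poly_cos i)
  have "trig_poly (\<lambda>x. cos (pi * x $ i) * cos (pi * a $ i) + - (sin (pi * x $ i) * sin (pi * a $ i)))"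
    by (intro trig_poly.intros trig_poly_uminus)
  then show ?case by (simp add: cos_add ring_distribs)
next
  case (trig_poly_sin i)
  have "trig_poly (\<lambda>x. sin (pi * x $ i) * cos (pi * a $ i) + cos (pi * x $ i) * sin (pi * a $ i))"
    by (intro trig_poly.intros)
  then show ?case by (simp add: sin_add ring_distribs)
qed (auto intro: trig_poly.intros)

lemma trig_poly_reflection: "trig_poly f \<Longrightarrow> trig_poly (\<lambda>x. f (- x))"
proof (induction rule: trig_poly.induct)
  case (trig_poly_sin i)
  show ?case using trig_poly_uminus[OF trig_poly.trig_poly_sin] by simp
qed (auto intro: trig_poly.intros)

lemma trig_poly_shift_reflection: "trig_poly f \<Longrightarrow> trig_poly (\<lambda>x. f (a - x))"
  using trig_poly_reflection[OF trig_poly_translation[of f a]] by simp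

lemma trig_poly_bounded: "trig_poly f \<Longrightarrow> \<exists>B. \<forall>x. \<bar>f x\<bar> \<le> B"
proof (induction rule: trig_poly.induct)
  case (trig_poly_add f g)
  then obtain A B where "\<And>x. \<bar>f x\<bar> \<le> A" "\<And>x. \<bar>g x\<bar> \<le> B" by blast
  then have "\<bar>f x + g x\<bar> \<le> A + B" for x by (meson abs_triangle_ineq add_mono order_trans)
  then show ?case by blast
next
  case (trig_poly_mult f g)
  then obtain A B where AB: "\<And>x. \<bar>f x\<bar> \<le> A" "\<And>x. \<bar>g x\<bar> \<le> B" by blast
  have "\<bar>f x * g x\<bar> \<le> A * B" for x
    using AB[of x] mult_mono[OF AB[of x]] by (simp add: abs_mult)
  then show ?case by blast
qed (auto intro: exI[of _ 1] abs_cos_le_one abs_sin_le_one)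

text \<open>\<open>partial_x\<close> is defined through \<open>frechet_derivative\<close>. The
  induction therefore produces some coefficients that are again trigonometric polynomials;
  uniqueness of the derivative identifies them with \<open>partial_x\<close> afterwards.\<close>

lemma trig_poly_ex_derivative:
  fixes f :: "real ^ 'n \<Rightarrow> real"
  assumes "trig_poly f"
  shows "\<exists>f'. (\<forall>j. trig_poly (f' j)) \<and>
     (\<forall>x. (f has_derivative (\<lambda>h. \<Sum>j\<in>UNIV. f' j x * h $ j)) (at x))"
  using assms
proof (induction rule: trig_poly.induct)
  case (trig_poly_const c)
  show ?case
    by (rule exI[of _ "\<lambda>_ _. 0"]) (auto intro: trig_poly.intros)
next
  case (trig_poly_cos i)
  have "((\<lambda>x::real^'n. cos (pi * x $ i)) has_derivative (\<lambda>h. - (sin (pi * x $ i) * (pi * h $ i)))) (at x)" for x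
    by (auto intro!: derivative_eq_intros bounded_linear.has_derivative[OF bounded_linear_vec_nth])
  moreover have "(\<Sum>j\<in>UNIV. (if j = i then - (pi * sin (pi * x $ i)) else 0) * h $ j) = - (sin (pi * x $ i) * (pi * h $ i))"
    for x h :: "real^'n"
    by (simp add: if_distrib[of "\<lambda>z. z * _"] cong: if_cong)
  moreover have "trig_poly (\<lambda>x::real^'n. if j = i then - (pi * sin (pi * x $ i)) else 0)" for j
    by (cases "j = i") (auto intro!: trig_poly_uminus trig_poly_cmult intro: trig_poly.intros)
  ultimately show ?case
    by (intro exI[of _ "\<lambda>j x. if j = i then - (pi * sin (pi * x $ i)) else 0"]) simp
next
  case (trig_poly_sin i)
  have "((\<lambda>x::real^'n. sin (pi * x $ i)) has_derivative (\<lambda>h. cos (pi * x $ i) * (pi * h $ i))) (at x)" for x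
    by (auto intro!: derivative_eq_intros bounded_linear.has_derivative[OF bounded_linear_vec_nth])
  moreover have "(\<Sum>j\<in>UNIV. (if j = i then pi * cos (pi * x $ i) else 0) * h $ j) = cos (pi * x $ i) * (pi * h $ i)"
    for x h :: "real^'n"
    by (simp add: if_distrib[of "\<lambda>z. z * _"] cong: if_cong)
  moreover have "trig_poly (\<lambda>x::real^'n. if j = i then pi * cos (pi * x $ i) else 0)" for j
    by (cases "j = i") (auto intro: trig_poly.intros)
  ultimately show ?case
    by (intro exI[of _ "\<lambda>j x. if j = i then pi * cos (pi * x $ i) else 0"]) simp
next
  case (trig_poly_add f g)
  then obtain f' g' where f': "\<And>j. trig_poly (f' j)" "\<And>x. (f has_derivative (\<lambda>h. \<Sum>j\<in>UNIV. f' j x * h $ j)) (at x)"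
    and g': "\<And>j. trig_poly (g' j)" "\<And>x. (g has_derivative (\<lambda>h. \<Sum>j\<in>UNIV. g' j x * h $ j)) (at x)"
    by blast
  have "((\<lambda>x. f x + g x) has_derivative (\<lambda>h. \<Sum>j\<in>UNIV. (f' j x + g' j x) * h $ j)) (at x)" for x
    using has_derivative_add[OF f'(2) g'(2)] by (simp add: ring_distribs sum.distrib)
  then show ?case using f'(1) g'(1)
    by (intro exI[of _ "\<lambda>j x. f' j x + g' j x"]) (auto intro: trig_poly.intros)
next
  case (trig_poly_mult f g)
  then obtain f' g' where f': "\<And>j. trig_poly (f' j)" "\<And>x. (f has_derivative (\<lambda>h. \<Sum>j\<in>UNIV. f' j x * h $ j)) (at x)"
    and g': "\<And>j. trig_poly (g' j)" "\<And>x. (g has_derivative (\<lambda>h. \<Sum>j\<in>UNIV. g' j x * h $ j)) (at x)"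
    by blast
  have "((\<lambda>x. f x * g x) has_derivative (\<lambda>h. \<Sum>j\<in>UNIV. (f x * g' j x + f' j x * g x) * h $ j)) (at x)" for x
    using has_derivative_mult[OF f'(2) g'(2)]
    by (simp add: ring_distribs sum.distrib sum_distrib_left sum_distrib_right mult_ac)
  then show ?case using f'(1) g'(1) trig_poly_mult
    by (intro exI[of _ "\<lambda>j x. f x * g' j x + f' j x * g x"]) (auto intro!: trig_poly.intros(4,5) trig_poly_mult(1,2))
qed

lemma
  fixes f :: "real ^ 'n \<Rightarrow> real"
  assumes "trig_poly f"
  shows trig_poly_partial_x: "trig_poly (partial_x j f)"
    and trig_poly_has_derivative: "(f has_derivative (\<lambda>h. \<Sum>j\<in>UNIV. partial_x j f x * h $ j)) (at x)"
proof -
  obtain f' where f': "\<And>j. trig_poly (f' j)" "\<And>x. (f has_derivative (\<lambda>h. \<Sum>j\<in>UNIV. f' j x * h $ j)) (at x)"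
    using trig_poly_ex_derivative[OF assms] by blast
  have "partial_x j f x = f' j x" for j x
  proof -
    have "frechet_derivative f (at x) = (\<lambda>h. \<Sum>j\<in>UNIV. f' j x * h $ j)"
      by (rule frechet_derivative_at[OF f'(2), symmetric])
    then have "partial_x j f x = (\<Sum>i\<in>UNIV. f' i x * axis j 1 $ i)" by (simp add: partial_x_def)
    also have "\<dots> = (\<Sum>i\<in>UNIV. if i = j then f' i x else 0)"
      by (rule sum.cong) (auto simp: axis_def)
    finally show ?thesis by simp
  qed
  then have eq: "partial_x j f = f' j" for j by blast
  show "trig_poly (partial_x j f)" "(f has_derivative (\<lambda>h. \<Sum>j\<in>UNIV. partial_x j f x * h $ j)) (at x)"
    using f' by (simp_all add: eq)
qed

lemma partial_x_unique:
  assumes "(f has_derivative (\<lambda>h. \<Sum>j\<in>UNIV. h $ j *\<^sub>R f' j)) (at x)"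
  shows "partial_x j f x = f' j"
proof -
  have "frechet_derivative f (at x) = (\<lambda>h. \<Sum>j\<in>UNIV. h $ j *\<^sub>R f' j)"
    by (rule frechet_derivative_at[OF assms, symmetric])
  then have "partial_x j f x = (\<Sum>i\<in>UNIV. axis j 1 $ i *\<^sub>R f' i)" by (simp add: partial_x_def)
  also have "\<dots> = (\<Sum>i\<in>UNIV. if i = j then f' i else 0)"
    by (rule sum.cong) (auto simp: axis_def)
  finally show ?thesis by simp
qed

lemma trig_poly_continuous: "trig_poly f \<Longrightarrow> continuous_on A f"
  using trig_poly_has_derivative
  by (blast intro: has_derivative_continuous continuous_at_imp_continuous_on)

lemma trig_poly_borel: "trig_poly f \<Longrightarrow> f \<in> borel_measurable borel"
  by (intro borel_measurable_continuous_onI trig_poly_continuous)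

lemma trig_poly_Ck: "trig_poly f \<Longrightarrow> Ck k f"
proof (induction k arbitrary: f)
  case (Suc k)
  have "f differentiable_on UNIV"
    using trig_poly_has_derivative[OF Suc.prems] by (auto simp: differentiable_on_def differentiable_def)
  then show ?case
    unfolding Ck.simps using Suc.IH[OF trig_poly_partial_x[OF Suc.prems]] by blast
qed (simp add: trig_poly_continuous)

lemma trig_poly_smooth: "trig_poly f \<Longrightarrow> torus_smooth f"
  by (simp add: torus_smooth_def trig_poly_Ck trig_poly_periodic)

lemma partial_x_trig_poly_shift:
  assumes "trig_poly f"
  shows "partial_x j (\<lambda>x. f (x - y)) x = partial_x j f (x - y)"
    and "partial_x j (\<lambda>x. f (y - x)) x = - partial_x j f (y - x)"
proof -
  have "((\<lambda>x. f (x - y)) has_derivative (\<lambda>h. \<Sum>j\<in>UNIV. h $ j *\<^sub>R partial_x j f (x - y))) (at x)"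
  proof -
    have "((\<lambda>x. x - y) has_derivative (\<lambda>h. h)) (at x)" by (auto intro!: derivative_eq_intros)
    from has_derivative_compose[OF this trig_poly_has_derivative[OF assms]]
    show ?thesis by (simp add: mult.commute)
  qed
  then show "partial_x j (\<lambda>x. f (x - y)) x = partial_x j f (x - y)"
    by (rule partial_x_unique)
  have "((\<lambda>x. f (y - x)) has_derivative (\<lambda>h. \<Sum>j\<in>UNIV. h $ j *\<^sub>R - partial_x j f (y - x))) (at x)"
  proof -
    have "((\<lambda>x. y - x) has_derivative (\<lambda>h. - h)) (at x)" by (auto intro!: derivative_eq_intros)
    from has_derivative_compose[OF this trig_poly_has_derivative[OF assms]]
    show ?thesis by (simp add: mult.commute)
  qed
  then show "partial_x j (\<lambda>x. f (y - x)) x = - partial_x j f (y - x)"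
    by (rule partial_x_unique)
qed

lemma sum_list_map_product:
  fixes f g :: "_ \<Rightarrow> real"
  shows "(\<Sum>(p, q)\<leftarrow>List.product ps qs. f p * g q) = (\<Sum>p\<leftarrow>ps. f p) * (\<Sum>q\<leftarrow>qs. g q)"
  by (induction ps) (auto simp: ring_distribs o_def sum_list_const_mult)

text \<open>The addition theorems separate sine and cosine of a difference, and for a product the
  two lists of terms are multiplied pairwise. This makes convolution with a trigonometric polynomial
  an operator of finite rank.\<close>

lemma trig_poly_separable_list:
  "trig_poly f \<Longrightarrow> \<exists>L. (\<forall>(a, b)\<in>set L. trig_poly a \<and> trig_poly b) \<and>
     (\<forall>x y. f (x - y) = (\<Sum>(a, b)\<leftarrow>L. a x * b y))"
proof (induction rule: trig_poly.induct)
  case (trig_poly_const c)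
  show ?case by (rule exI[of _ "[(\<lambda>_. c, \<lambda>_. 1)]"]) (auto intro: trig_poly.intros)
next
  case (trig_poly_cos i)
  show ?case
    by (rule exI[of _ "[(\<lambda>x. cos (pi * x $ i), \<lambda>x. cos (pi * x $ i)), (\<lambda>x. sin (pi * x $ i), \<lambda>x. sin (pi * x $ i))]"])
      (auto intro: trig_poly.intros simp: right_diff_distrib cos_diff)
next
  case (trig_poly_sin i)
  show ?case
    by (rule exI[of _ "[(\<lambda>x. sin (pi * x $ i), \<lambda>x. cos (pi * x $ i)), (\<lambda>x. cos (pi * x $ i), \<lambda>x. - sin (pi * x $ i))]"])
      (auto intro: trig_poly.intros trig_poly_uminus simp: right_diff_distrib sin_diff)
next
  case (trig_poly_add f g)
  then obtain L M where L: "\<forall>(a, b)\<in>set L. trig_poly a \<and> trig_poly b" "\<And>x y. f (x - y) = (\<Sum>(a, b)\<leftarrow>L. a x * b y)"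
    and M: "\<forall>(a, b)\<in>set M. trig_poly a \<and> trig_poly b" "\<And>x y. g (x - y) = (\<Sum>(a, b)\<leftarrow>M. a x * b y)"
    by blast
  then show ?case by (intro exI[of _ "L @ M"]) auto
next
  case (trig_poly_mult f g)
  then obtain L M where L: "\<forall>(a, b)\<in>set L. trig_poly a \<and> trig_poly b" "\<And>x y. f (x - y) = (\<Sum>(a, b)\<leftarrow>L. a x * b y)"
    and M: "\<forall>(a, b)\<in>set M. trig_poly a \<and> trig_poly b" "\<And>x y. g (x - y) = (\<Sum>(a, b)\<leftarrow>M. a x * b y)"
    by blast
  let ?N = "map (\<lambda>((a, b), (c, d)). (\<lambda>x. a x * c x, \<lambda>y. b y * d y)) (List.product L M)"
  have "f (x - y) * g (x - y) = (\<Sum>(a, b)\<leftarrow>?N. a x * b y)" for x y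
  proof -
    have "(\<Sum>(a, b)\<leftarrow>?N. a x * b y)
        = (\<Sum>(p, q)\<leftarrow>List.product L M. (case p of (a, b) \<Rightarrow> a x * b y) * (case q of (a, b) \<Rightarrow> a x * b y))"
      by (intro arg_cong[where f = sum_list]) (auto simp: mult_ac)
    then show ?thesis by (simp only: sum_list_map_product L(2) M(2))
  qed
  moreover have "\<forall>(a, b)\<in>set ?N. trig_poly a \<and> trig_poly b"
    using L(1) M(1) by (auto intro!: trig_poly.trig_poly_mult split: prod.splits)
  ultimately show ?case by blast
qed

lemma trig_poly_separable:
  assumes "trig_poly f"
  obtains M :: nat and a b where "\<And>m. m < M \<Longrightarrow> trig_poly (a m)" "\<And>m. m < M \<Longrightarrow> trig_poly (b m)"
    "\<And>x y. f (x - y) = (\<Sum>m<M. a m x * b m y)"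
proof -
  obtain L where L: "\<And>p. p \<in> set L \<Longrightarrow> trig_poly (fst p) \<and> trig_poly (snd p)"
      "\<And>x y. f (x - y) = (\<Sum>p\<leftarrow>L. fst p x * snd p y)"
    using trig_poly_separable_list[OF assms] unfolding case_prod_beta by blast
  show ?thesis
  proof (rule that[of "length L" "\<lambda>m. fst (L ! m)" "\<lambda>m. snd (L ! m)"])
    show "f (x - y) = (\<Sum>m<length L. fst (L ! m) x * snd (L ! m) y)" for x y
      unfolding L(2) by (subst sum_list_sum_nth) (simp add: atLeast0LessThan)
  qed (use L(1) in auto)
qed

subsection \<open>The de la Vallee-Poussin kernel\<close>

lemma torus_integrable_bounded:
  fixes f :: "real ^ 'n \<Rightarrow> real"
  assumes "f \<in> borel_measurable borel" and "\<And>x. \<bar>f x\<bar> \<le> B"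
  shows "integrable \<T> f"
  by (rule torus.integrable_const_bound[where B = B]) (use assms in auto)

lemma trig_poly_integrable:
  assumes "trig_poly f"
  shows "integrable \<T> f"
  using trig_poly_bounded[OF assms] trig_poly_borel[OF assms] torus_integrable_bounded by blast

lemma partial_x_sum_trig_poly:
  fixes f :: "'k \<Rightarrow> real ^ 'n \<Rightarrow> real"
  assumes "\<And>m. m \<in> I \<Longrightarrow> trig_poly (f m)"
  shows "partial_x j (\<lambda>y. \<Sum>m\<in>I. c m * f m y) y = (\<Sum>m\<in>I. c m * partial_x j (f m) y)"
proof (rule partial_x_unique)
  have "((\<lambda>y. \<Sum>m\<in>I. c m * f m y) has_derivative (\<lambda>h. \<Sum>m\<in>I. c m * (\<Sum>j\<in>UNIV. partial_x j (f m) y * h $ j))) (at y)"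
    using assms by (intro has_derivative_sum has_derivative_mult_right trig_poly_has_derivative)
  then show "((\<lambda>y. \<Sum>m\<in>I. c m * f m y) has_derivative (\<lambda>h. \<Sum>j\<in>UNIV. h $ j *\<^sub>R (\<Sum>m\<in>I. c m * partial_x j (f m) y))) (at y)"
    by (simp add: sum_distrib_left sum.swap[of _ UNIV I] mult_ac)
qed

text \<open>The integral of \<open>f (x - y)\<close> over \<open>x\<close> does not depend on \<open>y\<close>, and separability of \<open>f\<close> allows
  to differentiate it in \<open>y\<close> termwise.\<close>

lemma integral_partial_x_trig_poly:
  fixes f :: "real ^ 'n \<Rightarrow> real"
  assumes f: "trig_poly f"
  shows "(\<integral>x. partial_x j f x \<partial>\<T>) = 0"
proof -
  obtain M :: nat and a b where a: "\<And>m. m < M \<Longrightarrow> trig_poly (a m)" and b: "\<And>m. m < M \<Longrightarrow> trig_poly (b m)"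
    and ab: "\<And>x y. f (x - y) = (\<Sum>m<M. a m x * b m y)"
    using trig_poly_separable[OF f] by blast
  define c where "c m = (\<integral>x. a m x \<partial>\<T>)" for m
  have "(\<Sum>m<M. c m * b m y) = (\<integral>x. f x \<partial>\<T>)" for y
  proof -
    have "(\<Sum>m<M. c m * b m y) = (\<integral>x. (\<Sum>m<M. a m x * b m y) \<partial>\<T>)"
      by (subst Bochner_Integration.integral_sum) (auto simp: c_def intro!: integrable_mult_left trig_poly_integrable a)
    also have "\<dots> = (\<integral>x. f (x + - y) \<partial>\<T>)" by (simp add: ab[symmetric])
    also have "\<dots> = (\<integral>x. f x \<partial>\<T>)"
      by (rule integral_torus_translation) (intro trig_poly_borel trig_poly_periodic f)+
    finally show ?thesis .
  qed
  then have "(\<Sum>m<M. c m * partial_x j (b m) 0) = partial_x j (\<lambda>y. \<integral>x. f x \<partial>\<T>) (0 :: real ^ 'n)"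
    using partial_x_sum_trig_poly[of "{..<M}" b j c 0] b by simp
  also have "\<dots> = 0" by (rule partial_x_unique) simp
  finally have 0: "(\<Sum>m<M. c m * partial_x j (b m) 0) = 0" .
  \<comment> \<open>The derivative of f at x is minus the derivative of \<open>f (x - y)\<close>
    with respect to y at y = 0, and in separated form only the factors \<open>b m\<close> depend on
    y.\<close>
  have "partial_x j f x = - (\<Sum>m<M. a m x * partial_x j (b m) 0)" for x
    using partial_x_sum_trig_poly[of "{..<M}" b j "\<lambda>m. a m x" 0] b partial_x_trig_poly_shift(2)[OF f, of j x 0]
    by (simp add: ab)
  then have "(\<integral>x. partial_x j f x \<partial>\<T>) = - (\<integral>x. (\<Sum>m<M. a m x * partial_x j (b m) 0) \<partial>\<T>)"
    by simp
  also have "\<dots> = - (\<Sum>m<M. c m * partial_x j (b m) 0)"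
    by (subst Bochner_Integration.integral_sum) (auto simp: c_def intro!: integrable_mult_left trig_poly_integrable a)
  finally show ?thesis using 0 by simp
qed

text \<open>\<open>cosq\<close> and \<open>sinq\<close> are cos^2(pi x_i / 2) and sin^2(pi x_i / 2),
  written with the full angle so that they are visibly of period 2.\<close>

definition cosq :: "real ^ 'n \<Rightarrow> 'n \<Rightarrow> real" where "cosq x i = (1 + cos (pi * x $ i)) / 2"
definition sinq :: "real ^ 'n \<Rightarrow> 'n \<Rightarrow> real" where "sinq x i = (1 - cos (pi * x $ i)) / 2"
text \<open>The exponents may differ between coordinates because a partial derivative lowers only
  one of them. The weight peaks at the origin.\<close>

definition cos_weight :: "('n \<Rightarrow> nat) \<Rightarrow> real ^ 'n \<Rightarrow> real" where
  "cos_weight m x = (\<Prod>i\<in>UNIV. cosq x i ^ m i)"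

lemma cosq_sinq: "cosq x i = 1 - sinq x i"
  by (simp add: cosq_def sinq_def field_simps)

lemma sinq_nonneg: "0 \<le> sinq x i" and cosq_nonneg: "0 \<le> cosq x i"
proof -
  have "0 \<le> 1 - cos (pi * x $ i)" "0 \<le> 1 + cos (pi * x $ i)"
    using cos_le_one[of "pi * x $ i"] cos_ge_minus_one[of "pi * x $ i"] by linarith+
  then show "0 \<le> sinq x i" "0 \<le> cosq x i" unfolding sinq_def cosq_def by auto
qed

lemma trig_poly_cosq: "trig_poly (\<lambda>x. cosq x i)"
  using trig_poly_cmult[OF trig_poly_add[OF trig_poly_const[of 1] trig_poly_cos[of i]], of "1/2"]
  by (simp add: cosq_def[abs_def])

lemma trig_poly_sinq: "trig_poly (\<lambda>x. sinq x i)"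
  using trig_poly_add[OF trig_poly_const[of 1] trig_poly_uminus[OF trig_poly_cosq[of i]]]
  by (simp add: cosq_sinq)

lemma trig_poly_cos_weight: "trig_poly (cos_weight m)"
  unfolding cos_weight_def[abs_def] by (intro trig_poly_prod trig_poly_power trig_poly_cosq)

lemma cos_weight_nonneg: "0 \<le> cos_weight m x"
  by (simp add: cos_weight_def prod_nonneg cosq_nonneg)

lemma cos_weight_remove: "cos_weight m x = cosq x i ^ m i * (\<Prod>k\<in>UNIV - {i}. cosq x k ^ m k)"
  unfolding cos_weight_def by (rule prod.remove) auto

lemma cos_weight_upd: "cos_weight (m(i := k)) x = cosq x i ^ k * (\<Prod>k\<in>UNIV - {i}. cosq x k ^ m k)"
  by (subst cos_weight_remove[where i = i]) (auto intro!: prod.cong)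

lemma cos_weight_Suc: "cos_weight (m(i := Suc (m i))) x = cosq x i * cos_weight m x"
  by (simp add: cos_weight_upd cos_weight_remove[of m x i])

text \<open>Makes the derivative rules of one variable available for
  \<open>partial_x\<close>.\<close>

lemma partial_x_eq_axis_derivative:
  fixes f :: "real ^ 'n \<Rightarrow> real"
  assumes f: "trig_poly f" and d: "((\<lambda>s. f (x + s *\<^sub>R axis j 1)) has_real_derivative D) (at 0)"
  shows "partial_x j f x = D"
proof -
  have "((\<lambda>s::real. x + s *\<^sub>R axis j 1) has_derivative (\<lambda>s. s *\<^sub>R axis j 1)) (at 0)"
    by (auto intro!: derivative_eq_intros)
  moreover have "(f has_derivative (\<lambda>h. \<Sum>i\<in>UNIV. partial_x i f x * h $ i)) (at (x + 0 *\<^sub>R axis j 1))"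
    using trig_poly_has_derivative[OF f, of x] by simp
  ultimately have "((\<lambda>s. f (x + s *\<^sub>R axis j 1)) has_derivative (\<lambda>s. \<Sum>i\<in>UNIV. partial_x i f x * (s *\<^sub>R axis j 1) $ i)) (at 0)"
    by (rule has_derivative_compose)
  also have "(\<lambda>s. \<Sum>i\<in>UNIV. partial_x i f x * (s *\<^sub>R axis j 1) $ i) = (*) (partial_x j f x)"
    by (rule ext) (simp add: axis_def if_distrib[of "\<lambda>z. _ * z"] cong: if_cong)
  finally have "((\<lambda>s. f (x + s *\<^sub>R axis j 1)) has_real_derivative partial_x j f x) (at 0)"
    by (simp add: has_field_derivative_def)
  then show ?thesis using d by (rule DERIV_unique)
qed

text \<open>The square of the double-angle formula sin(2y) = 2 sin y cos y with y = pi x_i /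
  2.\<close>

lemma sin_sq_cosq_sinq: "sin (pi * x $ i) * sin (pi * x $ i) = 4 * cosq x i * sinq x i"
proof -
  have "sin (pi * x $ i) * sin (pi * x $ i) = 1 - cos (pi * x $ i) * cos (pi * x $ i)"
    using sin_cos_squared_add[of "pi * x $ i"] unfolding power2_eq_square by linarith
  then show ?thesis unfolding cosq_def sinq_def by (simp only:) (simp add: field_simps)
qed

lemma cosq_axis: "cosq (x + s *\<^sub>R axis i 1) k = (if k = i then (1 + cos (pi * (x $ i + s))) / 2 else cosq x k)"
  by (simp add: cosq_def axis_def)

text \<open>The subtraction \<open>m i - 1\<close> is truncated; for \<open>m i = 0\<close> the
  prefactor vanishes, so the formula stays correct.\<close>

lemma partial_x_cos_weight:
  "partial_x i (cos_weight m) x = - (pi / 2 * m i * sin (pi * x $ i) * cos_weight (m(i := m i - 1)) x)"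
proof (rule partial_x_eq_axis_derivative[OF trig_poly_cos_weight])
  define R where "R = (\<Prod>k\<in>UNIV - {i}. cosq x k ^ m k)"
  have "cos_weight m (x + s *\<^sub>R axis i 1) = ((1 + cos (pi * (x $ i + s))) / 2) ^ m i * R" for s
    unfolding cos_weight_remove[where i = i] R_def cosq_axis by (auto intro!: prod.cong)
  moreover have "((\<lambda>s. ((1 + cos (pi * (x $ i + s))) / 2) ^ m i * R) has_real_derivative
      - (pi / 2 * m i * sin (pi * x $ i) * (cosq x i ^ (m i - 1) * R))) (at 0)"
    by (auto intro!: derivative_eq_intros simp: cosq_def)
  ultimately show "((\<lambda>s. cos_weight m (x + s *\<^sub>R axis i 1)) has_real_derivative
      - (pi / 2 * m i * sin (pi * x $ i) * cos_weight (m(i := m i - 1)) x)) (at 0)"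
    by (simp add: cos_weight_upd R_def)
qed

text \<open>The factor \<open>cosq x i\<close> contained in the squared sine restores the exponent
  that differentiation has lowered; for k = 0 both sides vanish.\<close>

lemma sin_cosq_power:
  "real k * sin (pi * x $ i) * sin (pi * x $ i) * cosq x i ^ (k - 1) = real k * (4 * sinq x i * cosq x i ^ k)"
  using sin_sq_cosq_sinq[of x i] by (cases k) (auto simp: algebra_simps)

text \<open>Both moments come from \<open>integral_partial_x_trig_poly\<close>, applied to the products of
  \<open>sin (pi * x $ i)\<close> with \<open>cos_weight m x\<close> and with \<open>sinq x i * cos_weight m x\<close>.\<close>

lemma
  shows integral_cos_weight_sinq:
    "(\<integral>x. cos_weight m x * sinq x i \<partial>\<T>) = (\<integral>x. cos_weight m x \<partial>\<T>) / (2 * m i + 2)"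
  and integral_cos_weight_sinq_sq:
    "(\<integral>x. cos_weight m x * (sinq x i)\<^sup>2 \<partial>\<T>)
      = 3 * (\<integral>x. cos_weight m x * sinq x i \<partial>\<T>) / (2 * m i + 4)"
proof -
  have tp: "trig_poly (\<lambda>x. sin (pi * x $ i) * cos_weight m x)"
    "trig_poly (\<lambda>x. sin (pi * x $ i) * (sinq x i * cos_weight m x))"
    by (intro trig_poly.intros trig_poly_cos_weight trig_poly_sinq)+
  have int: "integrable \<T> (cos_weight m)" "integrable \<T> (\<lambda>x. cos_weight m x * sinq x i)"
    "integrable \<T> (\<lambda>x. cos_weight m x * (sinq x i)\<^sup>2)"
    by (intro trig_poly_integrable trig_poly_mult trig_poly_power trig_poly_cos_weight trig_poly_sinq)+
  define R where "R x = (\<Prod>k\<in>UNIV - {i}. cosq x k ^ m k)" for x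
  have W: "cos_weight m x = cosq x i ^ m i * R x" for x
    unfolding cos_weight_remove[where i = i] R_def ..
  have R: "R (x + s *\<^sub>R axis i 1) = R x" for x s
    unfolding R_def by (auto intro!: prod.cong simp: cosq_axis)
  have sinq_axis: "sinq (x + s *\<^sub>R axis i 1) i = (1 - cos (pi * (x $ i + s))) / 2" for x s
    by (simp add: sinq_def axis_def)
  have 1: "partial_x i (\<lambda>x. sin (pi * x $ i) * cos_weight m x) x
      = pi * (cos_weight m x - (2 * m i + 2) * (cos_weight m x * sinq x i))" for x
  proof (rule partial_x_eq_axis_derivative[OF tp(1)])
    have "((\<lambda>s. sin (pi * (x $ i + s)) * (((1 + cos (pi * (x $ i + s))) / 2) ^ m i * R x)) has_real_derivative
        pi * cos (pi * x $ i) * (cosq x i ^ m i * R x)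
        - pi / 2 * (real (m i) * sin (pi * x $ i) * sin (pi * x $ i) * cosq x i ^ (m i - 1)) * R x) (at 0)"
      by (auto intro!: derivative_eq_intros simp: cosq_def algebra_simps)
    \<comment> \<open>Of the coefficient \<open>2 * m i + 2\<close>, this cosine contributes 2 and
      the derivative of the power \<open>2 * m i\<close>.\<close>
    moreover have "cos (pi * x $ i) = 1 - 2 * sinq x i" by (simp add: sinq_def field_simps)
    ultimately show "((\<lambda>s. sin (pi * (x + s *\<^sub>R axis i 1) $ i) * cos_weight m (x + s *\<^sub>R axis i 1)) has_real_derivative
        pi * (cos_weight m x - (2 * m i + 2) * (cos_weight m x * sinq x i))) (at 0)"
      unfolding W R cosq_axis sin_cosq_power by (simp add: axis_def algebra_simps)
  qed
  have 2: "partial_x i (\<lambda>x. sin (pi * x $ i) * (sinq x i * cos_weight m x)) x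
      = pi * (3 * (cos_weight m x * sinq x i) - (2 * m i + 4) * (cos_weight m x * (sinq x i)\<^sup>2))" for x
  proof (rule partial_x_eq_axis_derivative[OF tp(2)])
    have "((\<lambda>s. sin (pi * (x $ i + s)) * ((1 - cos (pi * (x $ i + s))) / 2 * (((1 + cos (pi * (x $ i + s))) / 2) ^ m i * R x))) has_real_derivative
        pi * cos (pi * x $ i) * sinq x i * (cosq x i ^ m i * R x)
        + pi / 2 * (sin (pi * x $ i) * sin (pi * x $ i)) * (cosq x i ^ m i * R x)
        - pi / 2 * (real (m i) * sin (pi * x $ i) * sin (pi * x $ i) * cosq x i ^ (m i - 1)) * sinq x i * R x) (at 0)"
      by (auto intro!: derivative_eq_intros simp: cosq_def sinq_def algebra_simps add_divide_distrib diff_divide_distrib)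
    moreover have "cos (pi * x $ i) = 1 - 2 * sinq x i" by (simp add: sinq_def field_simps)
    ultimately show "((\<lambda>s. sin (pi * (x + s *\<^sub>R axis i 1) $ i) * (sinq (x + s *\<^sub>R axis i 1) i * cos_weight m (x + s *\<^sub>R axis i 1))) has_real_derivative
        pi * (3 * (cos_weight m x * sinq x i) - (2 * m i + 4) * (cos_weight m x * (sinq x i)\<^sup>2))) (at 0)"
      unfolding W R cosq_axis sinq_axis sin_cosq_power sin_sq_cosq_sinq
      by (simp add: axis_def cosq_sinq[of x i] algebra_simps power2_eq_square)
  qed
  have "pi * ((\<integral>x. cos_weight m x \<partial>\<T>) - (2 * m i + 2) * (\<integral>x. cos_weight m x * sinq x i \<partial>\<T>)) = 0"
    using integral_partial_x_trig_poly[OF tp(1), of i, unfolded ext[of "partial_x _ _", OF 1]] int by simp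
  then have "(\<integral>x. cos_weight m x \<partial>\<T>) = (2 * m i + 2) * (\<integral>x. cos_weight m x * sinq x i \<partial>\<T>)"
    using pi_neq_zero by simp
  then show "(\<integral>x. cos_weight m x * sinq x i \<partial>\<T>) = (\<integral>x. cos_weight m x \<partial>\<T>) / (2 * m i + 2)"
    by (simp add: field_simps)
  show "(\<integral>x. cos_weight m x * (sinq x i)\<^sup>2 \<partial>\<T>)
      = 3 * (\<integral>x. cos_weight m x * sinq x i \<partial>\<T>) / (2 * m i + 4)"
  proof -
    have "pi * (3 * (\<integral>x. cos_weight m x * sinq x i \<partial>\<T>)
        - (2 * m i + 4) * (\<integral>x. cos_weight m x * (sinq x i)\<^sup>2 \<partial>\<T>)) = 0"
      using integral_partial_x_trig_poly[OF tp(2), of i, unfolded ext[of "partial_x _ _", OF 2]] int by simp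
    then have "3 * (\<integral>x. cos_weight m x * sinq x i \<partial>\<T>)
        = (2 * m i + 4) * (\<integral>x. cos_weight m x * (sinq x i)\<^sup>2 \<partial>\<T>)"
      using pi_neq_zero by simp
    then show ?thesis by (simp add: field_simps)
  qed
qed

text \<open>The Wallis recursion: a further factor \<open>cosq = 1 - sinq\<close> removes the first
  moment of \<open>sinq\<close> from the mass.\<close>

lemma integral_cos_weight_Suc:
  "(\<integral>x. cos_weight (m(i := Suc (m i))) x \<partial>\<T>)
    = (1 - 1 / (2 * m i + 2)) * (\<integral>x. cos_weight m x \<partial>\<T>)"
proof -
  have "integrable \<T> (cos_weight m)" "integrable \<T> (\<lambda>x. cos_weight m x * sinq x i)"
    by (intro trig_poly_integrable trig_poly_mult trig_poly_cos_weight trig_poly_sinq)+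
  then have "(\<integral>x. cos_weight m x - cos_weight m x * sinq x i \<partial>\<T>)
     = (1 - 1 / (2 * m i + 2)) * (\<integral>x. cos_weight m x \<partial>\<T>)"
    by (simp add: integral_cos_weight_sinq algebra_simps)
  then show ?thesis by (simp add: cos_weight_Suc cosq_sinq algebra_simps)
qed

lemma measure_torus_pos: "0 < measure (\<T> :: (real ^ 'n) measure) UNIV"
proof -
  have "emeasure (\<T> :: (real ^ 'n) measure) UNIV = emeasure lborel (torus_cell :: (real ^ 'n) set)"
    by (simp add: torus_measure_def emeasure_density)
  also have "\<dots> = ennreal (\<Prod>b\<in>Basis. (vec 1 - vec (- 1) :: real ^ 'n) \<bullet> b)"
    unfolding torus_cell_def
    by (subst emeasure_lborel_cbox_eq) (auto simp: Basis_vec_def inner_axis)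
  finally have eq: "emeasure (\<T> :: (real ^ 'n) measure) UNIV
      = ennreal (\<Prod>b\<in>Basis. (vec 1 - vec (- 1) :: real ^ 'n) \<bullet> b)" .
  have pos: "(\<Prod>b\<in>Basis. (vec 1 - vec (- 1) :: real ^ 'n) \<bullet> b) > 0"
    by (rule prod_pos) (auto simp: Basis_vec_def inner_axis)
  show ?thesis unfolding measure_def eq using pos by (simp only: enn2real_ennreal less_imp_le)
qed

text \<open>Induction on the total exponent: the recursion multiplies the mass by
  \<open>1 - 1 / (2 * m i + 2)\<close>, which is at least 1/2, starting from the volume of the
  torus.\<close>

lemma integral_cos_weight_pos: "0 < (\<integral>x. cos_weight m x \<partial>(\<T> :: (real ^ 'n) measure))"
proof (induction "\<Sum>i\<in>UNIV. m i" arbitrary: m)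
  case 0
  then have "cos_weight m = (\<lambda>x. 1)" by (auto simp: cos_weight_def)
  then show ?case using measure_torus_pos by simp
next
  case (Suc k)
  then obtain i where i: "m i > 0" by (metis (no_types, lifting) bot_nat_0.not_eq_extremum nat.simps(3) sum.neutral)
  define m' where "m' = m(i := m i - 1)"
  have m: "m = m'(i := Suc (m' i))" using i by (auto simp: m'_def)
  have "(\<Sum>i\<in>UNIV. m i) = Suc (\<Sum>i\<in>UNIV. m' i)"
    using i by (simp add: m'_def sum.remove[of UNIV i])
  then have "0 < (\<integral>x. cos_weight m' x \<partial>(\<T> :: (real ^ 'n) measure))" using Suc by simp
  then show ?case unfolding m integral_cos_weight_Suc by (intro mult_pos_pos) (auto simp: field_simps)
qed

text \<open>A crude Jordan inequality, sin y \<ge> y / 4 for y = pi |x_i| / 2 in [0, pi/2], together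
  with y \<ge> |x_i|; the constant is 16 = 4^2.\<close>

lemma sq_le_sinq:
  assumes "\<bar>x $ i\<bar> \<le> 1"
  shows "(x $ i)\<^sup>2 \<le> 16 * sinq x i"
proof -
  define y where "y = pi * \<bar>x $ i\<bar> / 2"
  have y: "0 \<le> y" "y \<le> pi / 2" using assms by (simp_all add: y_def)
  \<comment> \<open>Up to pi/3 the derivative cos is at least 1/2; beyond, already sin y \<ge> 1/2,
    and y < 2.\<close>
  have sin: "y / 4 \<le> sin y"
  proof (cases "y \<le> pi / 3")
    case True
    show ?thesis
    proof (cases "y = 0")
      case False
      then have "0 < y" using y by simp
      then obtain z where z: "0 < z" "z < y" "sin y - sin 0 = (y - 0) * cos z"
        using MVT2[of 0 y sin cos] DERIV_sin by auto
      have "cos (pi / 3) \<le> cos z" using z True by (intro cos_monotone_0_pi_le) auto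
      then have "y * (1 / 2) \<le> y * cos z" using y by (intro mult_left_mono) (simp_all add: cos_60)
      then show ?thesis using z y by simp
    qed simp
  next
    case False
    have "sin (pi / 6) \<le> sin y" using False y pi_gt_zero by (intro sin_monotone_2pi_le) auto
    then show ?thesis using y pi_half_less_two by (simp add: sin_30)
  qed
  have "\<bar>x $ i\<bar> / 4 \<le> y / 4" using pi_ge_two by (simp add: y_def mult_right_mono[of 2 pi, simplified])
  then have "(\<bar>x $ i\<bar> / 4)\<^sup>2 \<le> (sin y)\<^sup>2" using sin by (intro power_mono) auto
  also have "(sin y)\<^sup>2 = sinq x i"
  proof -
    have "cos (pi * x $ i) = cos (2 * y)" unfolding y_def by (cases "x $ i \<ge> 0") auto
    then show ?thesis by (simp add: sinq_def cos_double_sin)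
  qed
  finally show ?thesis by (simp add: power2_eq_square)
qed

lemma norm_sq_le_sinq:
  assumes "x \<in> torus_cell"
  shows "(norm x)\<^sup>2 \<le> 16 * (\<Sum>i\<in>UNIV. sinq x i)"
proof -
  have "\<bar>x $ i\<bar> \<le> 1" for i using assms by (auto simp: torus_cell_def mem_box_cart abs_le_iff minus_le_iff)
  then have "(\<Sum>i\<in>UNIV. (x $ i)\<^sup>2) \<le> (\<Sum>i\<in>UNIV. 16 * sinq x i)"
    by (intro sum_mono sq_le_sinq)
  then show ?thesis
    unfolding power2_norm_eq_inner by (simp add: inner_vec_def power2_eq_square sum_distrib_left)
qed

text \<open>Reduces a moment of fractional order to mass and second moment: the first term dominates
  for r \<le> \<delta>, the second for r > \<delta>, as the power \<gamma> - 2 is not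
  positive.\<close>

lemma powr_le_interpolation:
  fixes r \<delta> \<gamma> :: real
  assumes "0 \<le> r" "0 < \<delta>" "0 \<le> \<gamma>" "\<gamma> \<le> 2"
  shows "r powr \<gamma> \<le> \<delta> powr \<gamma> + \<delta> powr (\<gamma> - 2) * r\<^sup>2"
proof (cases "r \<le> \<delta>")
  case True
  then have "r powr \<gamma> \<le> \<delta> powr \<gamma>" using assms by (intro powr_mono2) auto
  then show ?thesis by (simp add: add_increasing2)
next
  case False
  have "r powr \<gamma> = r powr (\<gamma> - 2) * r powr 2" unfolding powr_add[symmetric] by simp
  also have "\<dots> \<le> \<delta> powr (\<gamma> - 2) * r powr 2"
    using False assms by (intro mult_right_mono powr_mono2') auto
  also have "r powr 2 = r\<^sup>2" using assms False by simp
  finally show ?thesis by (simp add: add_increasing)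
qed

lemma AE_torus_measure_cell: "AE x in \<T>. x \<in> torus_cell"
  unfolding torus_measure_def by (subst AE_density) (auto simp: indicator_def)

text \<open>Interpolation with \<delta> = n^(-1/2) leaves the first two moments of
  \<open>sinq\<close>, which are at most I / (2n) and 3I / (4n^2). The constants are 8 = 16/2 and
  192 = 256 * 3/4; the square of the sum over coordinates costs a further factor CARD('n). The
  hypothesis \<open>n \<le> m i + 1\<close> also admits weights with one exponent lowered to n - 1,
  as they occur in the gradient.\<close>

lemma
  fixes m :: "'n::finite \<Rightarrow> nat" and n :: real
  assumes n: "0 < n" and m: "\<And>i. n \<le> m i + 1" and \<gamma>: "0 < \<gamma>" "\<gamma> < 2"
  defines "I \<equiv> \<integral>x. cos_weight m x \<partial>\<T>"
  shows cos_weight_moment: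
      "(\<integral>x. cos_weight m x * norm x powr \<gamma> \<partial>\<T>) \<le> (1 + 8 * real CARD('n)) * n powr (- \<gamma> / 2) * I"
        (is ?th1)
    and cos_weight_moment':
      "(\<integral>x. cos_weight m x * norm x powr (\<gamma> + 2) \<partial>\<T>)
        \<le> (8 * real CARD('n) + 192 * (real CARD('n))\<^sup>2) * n powr (- \<gamma> / 2 - 1) * I" (is ?th2)
proof -
  let ?W = "cos_weight m :: real ^ 'n \<Rightarrow> real" and ?N = "real CARD('n)"
  \<comment> \<open>\<open>n powr (- 1 / 2)\<close> is the width of the peak of \<open>cos_weight m\<close>.\<close>
  define \<delta> where "\<delta> = n powr (- 1 / 2)"
  have \<delta>: "0 < \<delta>" "\<delta> powr \<gamma> = n powr (- \<gamma> / 2)" "\<delta> powr (\<gamma> - 2) = n * n powr (- \<gamma> / 2)"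
  proof -
    have "(- 1 / 2) * (\<gamma> - 2) = 1 + - \<gamma> / 2" by (simp add: field_simps)
    then have "\<delta> powr (\<gamma> - 2) = n powr (1 + - \<gamma> / 2)" by (simp only: \<delta>_def powr_powr)
    then show "\<delta> powr (\<gamma> - 2) = n * n powr (- \<gamma> / 2)" using n by (simp only: powr_add) simp
  qed (use n in \<open>simp_all add: \<delta>_def powr_powr\<close>)
  have I: "0 \<le> I" unfolding I_def by (rule less_imp_le[OF integral_cos_weight_pos])
  have s1: "(\<integral>x. ?W x * sinq x i \<partial>\<T>) \<le> I / (2 * n)" for i
    unfolding integral_cos_weight_sinq I_def[symmetric] using n m[of i] I by (intro divide_left_mono) auto
  have s2: "(\<integral>x. ?W x * (sinq x i)\<^sup>2 \<partial>\<T>) \<le> 3 * (I / (2 * n)) / (2 * n)" for i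
    unfolding integral_cos_weight_sinq_sq using n m[of i] I s1[of i] by (intro frac_le) auto
  have int: "integrable \<T> ?W" "\<And>i. integrable \<T> (\<lambda>x. ?W x * sinq x i)"
    "\<And>i. integrable \<T> (\<lambda>x. ?W x * (sinq x i)\<^sup>2)"
    by (intro trig_poly_integrable trig_poly_mult trig_poly_power trig_poly_cos_weight trig_poly_sinq)+
  have cell: "AE x in \<T>. norm x powr \<gamma> \<le> \<delta> powr \<gamma> + \<delta> powr (\<gamma> - 2) * (16 * (\<Sum>i\<in>UNIV. sinq (x :: real ^ 'n) i))"
    using AE_torus_measure_cell
  proof eventually_elim
    case (elim x)
    have "norm x powr \<gamma> \<le> \<delta> powr \<gamma> + \<delta> powr (\<gamma> - 2) * (norm x)\<^sup>2"
      using \<gamma> \<delta> by (intro powr_le_interpolation) auto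
    also have "\<dots> \<le> \<delta> powr \<gamma> + \<delta> powr (\<gamma> - 2) * (16 * (\<Sum>i\<in>UNIV. sinq x i))"
      using norm_sq_le_sinq[OF elim] by (intro add_left_mono mult_left_mono) auto
    finally show ?case .
  qed
  have "(\<integral>x. ?W x * norm x powr \<gamma> \<partial>\<T>)
      \<le> (\<integral>x. \<delta> powr \<gamma> * ?W x + 16 * \<delta> powr (\<gamma> - 2) * (\<Sum>i\<in>UNIV. ?W x * sinq x i) \<partial>\<T>)"
  proof (rule integral_mono_AE')
    show "integrable \<T> (\<lambda>x. \<delta> powr \<gamma> * ?W x + 16 * \<delta> powr (\<gamma> - 2) * (\<Sum>i\<in>UNIV. ?W x * sinq x i))"
      using int by auto
    show "AE x in \<T>. ?W x * norm x powr \<gamma>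
        \<le> \<delta> powr \<gamma> * ?W x + 16 * \<delta> powr (\<gamma> - 2) * (\<Sum>i\<in>UNIV. ?W x * sinq x i)"
      using cell
    proof eventually_elim
      case (elim x)
      from mult_left_mono[OF elim cos_weight_nonneg[of m x]] show ?case
        by (simp add: sum_distrib_left[symmetric] algebra_simps)
    qed
  qed (auto intro!: add_nonneg_nonneg mult_nonneg_nonneg sum_nonneg simp: cos_weight_nonneg sinq_nonneg)
  also have "\<dots> = \<delta> powr \<gamma> * I + 16 * \<delta> powr (\<gamma> - 2) * (\<Sum>i\<in>UNIV. \<integral>x. ?W x * sinq x i \<partial>\<T>)"
    using int by (simp add: I_def)
  also have "\<dots> \<le> \<delta> powr \<gamma> * I + 16 * \<delta> powr (\<gamma> - 2) * (\<Sum>i\<in>(UNIV :: 'n set). I / (2 * n))"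
    using s1 by (intro add_left_mono mult_left_mono sum_mono) auto
  also have "\<dots> = (1 + 8 * ?N) * n powr (- \<gamma> / 2) * I"
    using n by (simp add: \<delta> field_simps)
  finally show ?th1 .
  have "(\<integral>x. ?W x * norm x powr (\<gamma> + 2) \<partial>\<T>)
      \<le> (\<integral>x. 16 * \<delta> powr \<gamma> * (\<Sum>i\<in>UNIV. ?W x * sinq x i)
            + 256 * \<delta> powr (\<gamma> - 2) * ?N * (\<Sum>i\<in>UNIV. ?W x * (sinq x i)\<^sup>2) \<partial>\<T>)"
  proof (rule integral_mono_AE')
    show "integrable \<T> (\<lambda>x. 16 * \<delta> powr \<gamma> * (\<Sum>i\<in>UNIV. ?W x * sinq x i)
            + 256 * \<delta> powr (\<gamma> - 2) * ?N * (\<Sum>i\<in>UNIV. ?W x * (sinq x i)\<^sup>2))"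
      using int by auto
    show "AE x in \<T>. ?W x * norm x powr (\<gamma> + 2)
        \<le> 16 * \<delta> powr \<gamma> * (\<Sum>i\<in>UNIV. ?W x * sinq x i)
            + 256 * \<delta> powr (\<gamma> - 2) * ?N * (\<Sum>i\<in>UNIV. ?W x * (sinq x i)\<^sup>2)"
      using cell AE_torus_measure_cell
    proof eventually_elim
      case (elim x)
      let ?S = "\<Sum>i\<in>UNIV. sinq x i"
      have S: "0 \<le> ?S" by (intro sum_nonneg sinq_nonneg)
      have "norm x powr (\<gamma> + 2) = norm x powr \<gamma> * (norm x)\<^sup>2" by (simp add: powr_add)
      also have "\<dots> \<le> (\<delta> powr \<gamma> + \<delta> powr (\<gamma> - 2) * (16 * ?S)) * (16 * ?S)"
        using elim norm_sq_le_sinq[OF elim(2)] S by (intro mult_mono) auto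
      also have "\<dots> = 16 * \<delta> powr \<gamma> * ?S + 256 * \<delta> powr (\<gamma> - 2) * ?S\<^sup>2"
        by (simp add: algebra_simps power2_eq_square)
      also have "\<dots> \<le> 16 * \<delta> powr \<gamma> * ?S + 256 * \<delta> powr (\<gamma> - 2) * (?N * (\<Sum>i\<in>UNIV. (sinq x i)\<^sup>2))"
        using sum_squared_le_sum_of_squares[of "\<lambda>i. sinq x i" UNIV]
        by (intro add_left_mono mult_left_mono) (auto simp: mult.commute)
      finally have "norm x powr (\<gamma> + 2)
        \<le> 16 * \<delta> powr \<gamma> * ?S + 256 * \<delta> powr (\<gamma> - 2) * (?N * (\<Sum>i\<in>UNIV. (sinq x i)\<^sup>2))" .
      from mult_left_mono[OF this cos_weight_nonneg[of m x]] show ?case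
        by (simp add: sum_distrib_left[symmetric] algebra_simps)
    qed
  qed (auto intro!: add_nonneg_nonneg mult_nonneg_nonneg sum_nonneg simp: cos_weight_nonneg sinq_nonneg)
  also have "\<dots> = 16 * \<delta> powr \<gamma> * (\<Sum>i\<in>UNIV. \<integral>x. ?W x * sinq x i \<partial>\<T>)
       + 256 * \<delta> powr (\<gamma> - 2) * ?N * (\<Sum>i\<in>UNIV. \<integral>x. ?W x * (sinq x i)\<^sup>2 \<partial>\<T>)"
    using int by simp
  also have "\<dots> \<le> 16 * \<delta> powr \<gamma> * (\<Sum>i\<in>(UNIV :: 'n set). I / (2 * n))
       + 256 * \<delta> powr (\<gamma> - 2) * ?N * (\<Sum>i\<in>(UNIV :: 'n set). 3 * (I / (2 * n)) / (2 * n))"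
    using s1 s2 by (intro add_mono mult_left_mono sum_mono) auto
  also have "\<dots> = (8 * ?N + 192 * ?N\<^sup>2) * (n powr (- \<gamma> / 2) / n) * I"
    using n by (simp add: \<delta> field_simps power2_eq_square)
  also have "n powr (- \<gamma> / 2) / n = n powr (- \<gamma> / 2 - 1)"
    using n by (simp add: powr_diff)
  finally show ?th2 by simp
qed

text \<open>The product over all coordinates of the classical kernels proportional to cos^(2n)(pi
  x_i / 2), normalised to integral one.\<close>

definition vp_kernel :: "nat \<Rightarrow> real ^ 'n \<Rightarrow> real" where
  "vp_kernel n x = (1 / (\<integral>x. cos_weight (\<lambda>_::'n. n) x \<partial>\<T>)) * cos_weight (\<lambda>_. n) x"

lemma trig_poly_vp_kernel: "trig_poly (vp_kernel n)"
  unfolding vp_kernel_def[abs_def] by (intro trig_poly_cmult trig_poly_cos_weight)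

lemma vp_kernel_nonneg: "0 \<le> vp_kernel n (x :: real ^ 'n)"
  unfolding vp_kernel_def using integral_cos_weight_pos[of "\<lambda>_ :: 'n. n"] cos_weight_nonneg[of "\<lambda>_. n" x] by simp

lemma vp_kernel_even: "vp_kernel n (- x) = vp_kernel n x"
  by (simp add: vp_kernel_def cos_weight_def cosq_def)

lemma integral_vp_kernel: "(\<integral>x. vp_kernel n x \<partial>(\<T> :: (real ^ 'n) measure)) = 1"
proof -
  have "integrable \<T> (cos_weight (\<lambda>_ :: 'n. n))"
    by (intro trig_poly_integrable trig_poly_cos_weight)
  then show ?thesis
    unfolding vp_kernel_def using integral_cos_weight_pos[of "\<lambda>_ :: 'n. n"] by simp
qed

lemma partial_x_vp_kernel_odd: "partial_x j (vp_kernel n) (- x) = - partial_x j (vp_kernel n) x"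
  using partial_x_trig_poly_shift(2)[OF trig_poly_vp_kernel[of n], of j 0 x] by (simp add: vp_kernel_even)

lemma tendsto_powr_neg_sequentially:
  assumes "0 < a"
  shows "(\<lambda>n. c * real n powr (- a)) \<longlonglongrightarrow> 0"
proof -
  have "(\<lambda>n. real n powr (- a)) \<longlonglongrightarrow> 0"
    by (rule tendsto_neg_powr) (use assms in \<open>auto simp: filterlim_real_sequentially\<close>)
  from tendsto_mult_left[OF this, of c] show ?thesis by simp
qed

lemma vp_kernel_moment:
  assumes "0 < \<gamma>" "\<gamma> < 2"
  shows "(\<lambda>n. \<integral>x. vp_kernel n x * norm (x :: real ^ 'n) powr \<gamma> \<partial>\<T>) \<longlonglongrightarrow> 0"
proof (rule tendsto_sandwich[OF _ _ tendsto_const tendsto_powr_neg_sequentially[of "\<gamma> / 2" "1 + 8 * real CARD('n)"]])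
  show "\<forall>\<^sub>F n in sequentially. 0 \<le> (\<integral>x. vp_kernel n x * norm (x :: real ^ 'n) powr \<gamma> \<partial>\<T>)"
    by (intro always_eventually allI integral_nonneg_AE) (auto simp: vp_kernel_nonneg)
  show "\<forall>\<^sub>F n in sequentially. (\<integral>x. vp_kernel n x * norm (x :: real ^ 'n) powr \<gamma> \<partial>\<T>)
      \<le> (1 + 8 * real CARD('n)) * real n powr (- (\<gamma> / 2))"
    using eventually_gt_at_top[of 0]
  proof eventually_elim
    case (elim n)
    define I where "I = (\<integral>x. cos_weight (\<lambda>_::'n. n) x \<partial>\<T>)"
    have "0 < I" unfolding I_def by (rule integral_cos_weight_pos)
    have "(\<integral>x. cos_weight (\<lambda>_::'n. n) x * norm x powr \<gamma> \<partial>\<T>)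
        \<le> (1 + 8 * real CARD('n)) * real n powr (- \<gamma> / 2) * I"
      unfolding I_def by (rule cos_weight_moment) (use elim assms in auto)
    moreover have "(\<integral>x. vp_kernel n x * norm (x :: real ^ 'n) powr \<gamma> \<partial>\<T>)
       = (\<integral>x. cos_weight (\<lambda>_::'n. n) x * norm x powr \<gamma> \<partial>\<T>) / I"
      unfolding vp_kernel_def I_def[symmetric] by (simp add: mult.assoc)
    ultimately show ?case using \<open>0 < I\<close> by (simp add: pos_divide_le_eq)
  qed
qed (use assms in auto)

text \<open>Differentiation costs a factor n and lowers one exponent, while |sin(pi x_j)| \<le> pi
  |x| gains one power of the norm. What remains is n times a moment of order \<beta> + 1 = \<gamma>
  + 2, which is of order n^(-\<gamma>/2 - 1); altogether the decay is n^(-(\<beta> - 1)/2).\<close>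

lemma vp_kernel_gradient_moment:
  assumes "1 < \<beta>" "\<beta> < 3"
  shows "(\<lambda>n. \<integral>x. \<bar>partial_x j (vp_kernel n) x\<bar> * norm (x :: real ^ 'n) powr \<beta> \<partial>\<T>) \<longlonglongrightarrow> 0"
proof -
  define \<gamma> where "\<gamma> = \<beta> - 1"
  have \<gamma>: "0 < \<gamma>" "\<gamma> < 2" using assms by (auto simp: \<gamma>_def)
  define c where "c = 8 * real CARD('n) + 192 * (real CARD('n))\<^sup>2"
  show ?thesis
  \<comment> \<open>The constant \<open>pi\<^sup>2\<close> is pi/2 from the derivative of the
    weight, times pi from the bound of the sine, times 2 from the comparison of the masses J and
    I.\<close>
  proof (rule tendsto_sandwich[OF _ _ tendsto_const tendsto_powr_neg_sequentially[of "\<gamma> / 2" "pi\<^sup>2 * c"]])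
    show "\<forall>\<^sub>F n in sequentially. 0 \<le> (\<integral>x. \<bar>partial_x j (vp_kernel n) x\<bar> * norm (x :: real ^ 'n) powr \<beta> \<partial>\<T>)"
      by (intro always_eventually allI integral_nonneg_AE) auto
    show "\<forall>\<^sub>F n in sequentially. (\<integral>x. \<bar>partial_x j (vp_kernel n) x\<bar> * norm (x :: real ^ 'n) powr \<beta> \<partial>\<T>)
        \<le> pi\<^sup>2 * c * real n powr (- (\<gamma> / 2))"
      using eventually_gt_at_top[of 0]
    proof eventually_elim
      case (elim n)
      define m where "m = (\<lambda>_::'n. n)(j := n - 1)"
      define I where "I = (\<integral>x. cos_weight (\<lambda>_::'n. n) x \<partial>\<T>)"
      define J where "J = (\<integral>x. cos_weight m x \<partial>\<T>)"
      have "0 < I" unfolding I_def by (rule integral_cos_weight_pos)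
      have "0 < J" unfolding J_def by (rule integral_cos_weight_pos)
      have "m(j := Suc (m j)) = (\<lambda>_. n)" using elim by (auto simp: m_def)
      \<comment> \<open>Lowering one exponent from n to n - 1 changes the mass by a factor at most
        2.\<close>
      then have "I = (1 - 1 / (2 * real (m j) + 2)) * J"
        using integral_cos_weight_Suc[of m j] by (simp add: I_def J_def)
      also have "\<dots> \<ge> (1 / 2) * J"
        using \<open>0 < J\<close> by (intro mult_right_mono) (auto simp: field_simps)
      finally have J: "J \<le> 2 * I" by simp
      have D: "\<bar>partial_x j (vp_kernel n) x\<bar> * norm x powr \<beta> \<le> (pi\<^sup>2 / 2 * n / I) * (cos_weight m x * norm x powr (\<gamma> + 2))" for x
      proof -
        have "partial_x j (vp_kernel n) x = (1 / I) * partial_x j (cos_weight (\<lambda>_. n)) x"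
          using partial_x_sum_trig_poly[of "{0::nat}" "\<lambda>_. cos_weight (\<lambda>_. n)" j "\<lambda>_. 1 / I" x]
          by (simp add: vp_kernel_def[abs_def] I_def trig_poly_cos_weight)
        then have "\<bar>partial_x j (vp_kernel n) x\<bar> = pi / 2 * n / I * cos_weight m x * \<bar>sin (pi * x $ j)\<bar>"
          using \<open>0 < I\<close> by (simp add: partial_x_cos_weight m_def abs_mult cos_weight_nonneg mult_ac)
        also have "\<dots> \<le> pi / 2 * n / I * cos_weight m x * (pi * norm x)"
        proof (rule mult_left_mono)
          have "\<bar>sin (pi * x $ j)\<bar> \<le> pi * \<bar>x $ j\<bar>" using abs_sin_x_le_abs_x[of "pi * x $ j"] by (simp add: abs_mult)
          also have "\<dots> \<le> pi * norm x" by (intro mult_left_mono component_le_norm_cart) auto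
          finally show "\<bar>sin (pi * x $ j)\<bar> \<le> pi * norm x" .
          show "0 \<le> pi / 2 * n / I * cos_weight m x" using \<open>0 < I\<close> cos_weight_nonneg[of m x] by simp
        qed
        finally have "\<bar>partial_x j (vp_kernel n) x\<bar> * norm x powr \<beta>
            \<le> pi / 2 * n / I * cos_weight m x * (pi * norm x) * norm x powr \<beta>" by (rule mult_right_mono) simp
        also have "\<dots> = (pi\<^sup>2 / 2 * n / I) * (cos_weight m x * (norm x powr 1 * norm x powr \<beta>))"
          by (simp add: power2_eq_square)
        also have "norm x powr 1 * norm x powr \<beta> = norm x powr (\<gamma> + 2)"
          unfolding powr_add[symmetric] by (simp add: \<gamma>_def)
        finally show ?thesis .
      qed
      obtain B where B: "\<And>x. \<bar>cos_weight m x\<bar> \<le> B" using trig_poly_bounded[OF trig_poly_cos_weight[of m]] by blast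
      have int: "integrable \<T> (\<lambda>x. cos_weight m x * norm x powr (\<gamma> + 2))"
      proof (rule torus.integrable_const_bound)
        show "(\<lambda>x. cos_weight m x * norm x powr (\<gamma> + 2)) \<in> borel_measurable \<T>"
          using trig_poly_borel[OF trig_poly_cos_weight[of m]] by measurable
        show "AE x in \<T>. norm (cos_weight m x * norm x powr (\<gamma> + 2)) \<le> B * (4 * sqrt (real CARD('n))) powr (\<gamma> + 2)"
          using AE_torus_measure_cell
        proof eventually_elim
          case (elim x)
          have "(norm x)\<^sup>2 \<le> 16 * (\<Sum>i\<in>UNIV. sinq x i)" by (rule norm_sq_le_sinq[OF elim])
          also have "\<dots> \<le> 16 * (\<Sum>i\<in>(UNIV :: 'n set). 1)"
            using cosq_nonneg[of x] by (intro mult_left_mono sum_mono) (auto simp: cosq_sinq)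
          also have "\<dots> = (4 * sqrt (real CARD('n)))\<^sup>2" by (simp add: power_mult_distrib)
          finally have "norm x \<le> 4 * sqrt (real CARD('n))" by (rule power2_le_imp_le) simp
          then have "norm x powr (\<gamma> + 2) \<le> (4 * sqrt (real CARD('n))) powr (\<gamma> + 2)"
            using \<gamma> by (intro powr_mono2) auto
          then show ?case using B[of x] order_trans[OF abs_ge_zero B[of x]]
            by (simp add: abs_mult mult_mono)
        qed
      qed
      have "(\<integral>x. \<bar>partial_x j (vp_kernel n) x\<bar> * norm (x :: real ^ 'n) powr \<beta> \<partial>\<T>)
          \<le> (\<integral>x. (pi\<^sup>2 / 2 * n / I) * (cos_weight m x * norm x powr (\<gamma> + 2)) \<partial>\<T>)"
        by (rule integral_mono_AE') (use D int \<open>0 < I\<close> in \<open>auto simp: cos_weight_nonneg\<close>)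
      also have "\<dots> = (pi\<^sup>2 / 2 * n / I) * (\<integral>x. cos_weight m x * norm x powr (\<gamma> + 2) \<partial>\<T>)" by simp
      also have "\<dots> \<le> (pi\<^sup>2 / 2 * n / I) * (c * real n powr (- \<gamma> / 2 - 1) * J)"
        unfolding c_def J_def
        by (intro mult_left_mono cos_weight_moment') (use elim \<gamma> \<open>0 < I\<close> in \<open>auto simp: m_def\<close>)
      also have "\<dots> \<le> (pi\<^sup>2 / 2 * n / I) * (c * real n powr (- \<gamma> / 2 - 1) * (2 * I))"
        using J \<open>0 < I\<close> by (intro mult_left_mono) (auto simp: c_def)
      also have "\<dots> = pi\<^sup>2 * c * (n * real n powr (- \<gamma> / 2 - 1))"
        using \<open>0 < I\<close> by (simp add: field_simps)
      also have "n * real n powr (- \<gamma> / 2 - 1) = real n powr (- (\<gamma> / 2))"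
        using elim by (simp add: powr_diff)
      finally show ?case .
    qed
  qed (use \<gamma> in auto)
qed

subsection \<open>Bilinear forms with a trigonometric kernel\<close>

text \<open>The pairing of g with the mollification of f, as an iterated integral.\<close>

definition kform :: "(real ^ 'n \<Rightarrow> real) \<Rightarrow> (real ^ 'n \<Rightarrow> real) \<Rightarrow> (real ^ 'n \<Rightarrow> real) \<Rightarrow> real" where
  "kform k f g = (\<integral>x. \<integral>y. k (x - y) * (f x * g y) \<partial>\<T> \<partial>\<T>)"

lemma integrable_trig_poly_mult:
  assumes a: "trig_poly a" and f: "integrable \<T> f"
  shows "integrable \<T> (\<lambda>x. a x * f x)"
proof -
  obtain B where B: "\<And>x. \<bar>a x\<bar> \<le> B" using trig_poly_bounded[OF a] by blast
  have [measurable]: "f \<in> borel_measurable borel" using borel_measurable_integrable[OF f] by simp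
  have [measurable]: "a \<in> borel_measurable borel" by (rule trig_poly_borel[OF a])
  show ?thesis
  proof (rule Bochner_Integration.integrable_bound[OF integrable_mult_right[OF f, of B]])
    show "AE x in \<T>. norm (a x * f x) \<le> norm (B * f x)"
      using B order_trans[OF abs_ge_zero B] by (auto simp: abs_mult intro!: mult_right_mono)
  qed measurable
qed

text \<open>A separable kernel gives a form of finite rank. It is determined by the moments of f
  against \<open>a m\<close> and of g against \<open>b m\<close>, which exist for every pair of
  integrable functions because the factors are bounded.\<close>

lemma kform_separable:
  assumes k: "\<And>x y. k (x - y) = (\<Sum>m<M. a m x * b m y)"
    and a: "\<And>m. m < M \<Longrightarrow> trig_poly (a m)" and b: "\<And>m. m < M \<Longrightarrow> trig_poly (b m)"
    and f: "integrable \<T> f" and g: "integrable \<T> g"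
  shows "integrable \<T> (\<lambda>y. k (x - y) * (f x * g y))"
    and "(\<integral>y. k (x - y) * (f x * g y) \<partial>\<T>) = (\<Sum>m<M. a m x * f x * (\<integral>y. b m y * g y \<partial>\<T>))"
    and "integrable \<T> (\<lambda>x. \<integral>y. k (x - y) * (f x * g y) \<partial>\<T>)"
    and "kform k f g = (\<Sum>m<M. (\<integral>x. a m x * f x \<partial>\<T>) * (\<integral>y. b m y * g y \<partial>\<T>))"
proof -
  have ia: "integrable \<T> (\<lambda>x. a m x * f x)" if "m < M" for m
    by (rule integrable_trig_poly_mult[OF a[OF that] f])
  have ib: "integrable \<T> (\<lambda>x. b m x * g x)" if "m < M" for m
    by (rule integrable_trig_poly_mult[OF b[OF that] g])
  have eq: "k (x - y) * (f x * g y) = (\<Sum>m<M. a m x * f x * (b m y * g y))" for x y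
    unfolding k by (simp add: sum_distrib_left sum_distrib_right mult_ac)
  show "integrable \<T> (\<lambda>y. k (x - y) * (f x * g y))"
    unfolding eq using ib by (auto intro!: Bochner_Integration.integrable_sum)
  show eq2: "(\<integral>y. k (x - y) * (f x * g y) \<partial>\<T>) = (\<Sum>m<M. a m x * f x * (\<integral>y. b m y * g y \<partial>\<T>))" for x
    unfolding eq using ib by (subst Bochner_Integration.integral_sum) auto
  show "integrable \<T> (\<lambda>x. \<integral>y. k (x - y) * (f x * g y) \<partial>\<T>)"
    unfolding eq2 using ia by (auto intro!: Bochner_Integration.integrable_sum)
  show "kform k f g = (\<Sum>m<M. (\<integral>x. a m x * f x \<partial>\<T>) * (\<integral>y. b m y * g y \<partial>\<T>))"
    unfolding kform_def eq2 using ia by (subst Bochner_Integration.integral_sum) auto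
qed

text \<open>Bundles the value of the iterated integral with the integrability of both stages, in the
  manner of \<open>has_integral\<close>, so that integrands which are not products can be assembled
  termwise.\<close>

definition has_kform :: "(real ^ 'n \<Rightarrow> real) \<Rightarrow> (real ^ 'n \<Rightarrow> real ^ 'n \<Rightarrow> real) \<Rightarrow> real \<Rightarrow> bool" where
  "has_kform k \<Phi> r \<longleftrightarrow> (\<forall>x. integrable \<T> (\<lambda>y. k (x - y) * \<Phi> x y)) \<and>
     integrable \<T> (\<lambda>x. \<integral>y. k (x - y) * \<Phi> x y \<partial>\<T>) \<and>
     (\<integral>x. \<integral>y. k (x - y) * \<Phi> x y \<partial>\<T> \<partial>\<T>) = r"

lemma has_kform_product:
  assumes k: "trig_poly k" and f: "integrable \<T> f" and g: "integrable \<T> g"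
  shows "has_kform k (\<lambda>x y. f x * g y) (kform k f g)"
proof -
  obtain M :: nat and a b where ab: "\<And>m. m < M \<Longrightarrow> trig_poly (a m)" "\<And>m. m < M \<Longrightarrow> trig_poly (b m)"
    "\<And>x y. k (x - y) = (\<Sum>m<M. a m x * b m y)"
    using trig_poly_separable[OF k] by blast
  show ?thesis
    unfolding has_kform_def
    using kform_separable(1,3)[OF ab(3,1,2) f g] by (auto simp: kform_def)
qed

lemma has_kform_add:
  assumes "has_kform k \<Phi> r" "has_kform k \<Psi> s"
  shows "has_kform k (\<lambda>x y. \<Phi> x y + \<Psi> x y) (r + s)"
  using assms by (auto simp: has_kform_def distrib_left)

lemma has_kform_diff:
  assumes "has_kform k \<Phi> r" "has_kform k \<Psi> s"
  shows "has_kform k (\<lambda>x y. \<Phi> x y - \<Psi> x y) (r - s)"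
  using assms by (auto simp: has_kform_def right_diff_distrib)

lemma has_kform_unique: "has_kform k \<Phi> r \<Longrightarrow> has_kform k \<Phi> s \<Longrightarrow> r = s"
  by (auto simp: has_kform_def)

lemma kform_add_left:
  assumes k: "trig_poly k" and f: "integrable \<T> f" "integrable \<T> f'" and g: "integrable \<T> g"
  shows "kform k (\<lambda>x. f x + f' x) g = kform k f g + kform k f' g"
proof -
  have "has_kform k (\<lambda>x y. f x * g y + f' x * g y) (kform k f g + kform k f' g)"
    by (intro has_kform_add has_kform_product assms)
  moreover have "has_kform k (\<lambda>x y. (f x + f' x) * g y) (kform k (\<lambda>x. f x + f' x) g)"
    by (intro has_kform_product Bochner_Integration.integrable_add assms)
  ultimately show ?thesis by (auto simp: distrib_right dest: has_kform_unique)
qed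

text \<open>The exchange of the two integrations is an identity between finite sums of products of
  moments.\<close>

lemma kform_flip:
  assumes k: "trig_poly k" and f: "integrable \<T> f" and g: "integrable \<T> g"
  shows "kform k f g = (\<integral>y. g y * (\<integral>x. k (x - y) * f x \<partial>\<T>) \<partial>\<T>)"
    and "integrable \<T> (\<lambda>y. g y * (\<integral>x. k (x - y) * f x \<partial>\<T>))"
proof -
  obtain M :: nat and a b where ab: "\<And>m. m < M \<Longrightarrow> trig_poly (a m)" "\<And>m. m < M \<Longrightarrow> trig_poly (b m)"
    "\<And>x y. k (x - y) = (\<Sum>m<M. a m x * b m y)"
    using trig_poly_separable[OF k] by blast
  have "(\<integral>x. k (x - y) * f x \<partial>\<T>) = (\<Sum>m<M. b m y * (\<integral>x. a m x * f x \<partial>\<T>))" for y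
  proof -
    have "(\<integral>x. k (x - y) * f x \<partial>\<T>) = (\<integral>x. (\<Sum>m<M. b m y * (a m x * f x)) \<partial>\<T>)"
      unfolding ab(3) by (simp add: sum_distrib_left sum_distrib_right mult_ac)
    also have "\<dots> = (\<Sum>m<M. b m y * (\<integral>x. a m x * f x \<partial>\<T>))"
      using integrable_trig_poly_mult[OF ab(1) f] by (subst Bochner_Integration.integral_sum) auto
    finally show ?thesis .
  qed
  then have eq: "g y * (\<integral>x. k (x - y) * f x \<partial>\<T>)
      = (\<Sum>m<M. (\<integral>x. a m x * f x \<partial>\<T>) * (b m y * g y))" for y
    by (simp add: sum_distrib_left mult_ac)
  show "integrable \<T> (\<lambda>y. g y * (\<integral>x. k (x - y) * f x \<partial>\<T>))"
    unfolding eq using integrable_trig_poly_mult[OF ab(2) g] by (auto intro!: Bochner_Integration.integrable_sum)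
  show "kform k f g = (\<integral>y. g y * (\<integral>x. k (x - y) * f x \<partial>\<T>) \<partial>\<T>)"
  proof -
    have "kform k f g = (\<Sum>m<M. (\<integral>x. a m x * f x \<partial>\<T>) * (\<integral>y. b m y * g y \<partial>\<T>))"
      by (rule kform_separable(4)[OF ab(3,1,2) f g])
    then show ?thesis
      unfolding eq using integrable_trig_poly_mult[OF ab(2) g] by (subst Bochner_Integration.integral_sum) auto
  qed
qed

text \<open>The sign s is 1 for the even mollifier and -1 for its odd partial derivatives.\<close>

lemma kform_swap:
  assumes k: "trig_poly k" and f: "integrable \<T> f" and g: "integrable \<T> g"
    and sym: "\<And>z. k (- z) = s * k z"
  shows "kform k f g = s * kform k g f"
proof -
  have "kform k f g = (\<integral>y. g y * (\<integral>x. k (x - y) * f x \<partial>\<T>) \<partial>\<T>)"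
    by (rule kform_flip(1)[OF k f g])
  also have "\<dots> = (\<integral>y. \<integral>x. s * (k (y - x) * (g y * f x)) \<partial>\<T> \<partial>\<T>)"
  proof (rule Bochner_Integration.integral_cong[OF refl])
    fix y
    have "k (x - y) = s * k (y - x)" for x using sym[of "y - x"] by simp
    then have "(\<lambda>x. s * (k (y - x) * (g y * f x))) = (\<lambda>x. g y * (k (x - y) * f x))" by (simp add: mult_ac)
    then show "g y * (\<integral>x. k (x - y) * f x \<partial>\<T>) = (\<integral>x. s * (k (y - x) * (g y * f x)) \<partial>\<T>)"
      by (simp only: integral_mult_right_zero)
  qed
  also have "\<dots> = s * kform k g f" unfolding kform_def by simp
  finally show ?thesis .
qed

text \<open>By invariance under y -> x - y the inner integral of the kernel is the same for every
  x.\<close>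

lemma kform_one_right:
  assumes k: "trig_poly k" and f: "integrable \<T> f"
  shows "kform k f (\<lambda>_. 1) = (\<integral>x. k x \<partial>\<T>) * (\<integral>x. f x \<partial>\<T>)"
proof -
  have "(\<integral>y. k (x - y) * (f x * 1) \<partial>\<T>) = f x * (\<integral>y. k y \<partial>\<T>)" for x
  proof -
    have "(\<integral>y. k (x - y) * (f x * 1) \<partial>\<T>) = f x * (\<integral>y. k (x - y) \<partial>\<T>)"
      by (simp add: mult.commute)
    also have "(\<integral>y. k (x - y) \<partial>\<T>) = (\<integral>y. k y \<partial>\<T>)"
      by (rule integral_torus_shift_reflection) (intro trig_poly_borel trig_poly_periodic k)+
    finally show ?thesis .
  qed
  then have "(\<lambda>x. \<integral>y. k (x - y) * (f x * 1) \<partial>\<T>) = (\<lambda>x. f x * (\<integral>y. k y \<partial>\<T>))" by blast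
  then show ?thesis unfolding kform_def by (simp only: integral_mult_left_zero mult.commute)
qed

subsection \<open>Increments\<close>

text \<open>With the displacement z = x - y, Tonelli's theorem and a translation by z in x, a
  two-point integral becomes an average over z of the increment functionals that Besov norms
  control.\<close>

lemma nn_integral_kernel_increment:
  fixes f k :: "real ^ 'n \<Rightarrow> real" and h :: "real \<Rightarrow> ennreal"
  assumes [measurable]: "f \<in> borel_measurable borel" "k \<in> borel_measurable borel" "h \<in> borel_measurable borel"
    and per: "torus_periodic f" "torus_periodic k"
  shows "(\<integral>\<^sup>+x. \<integral>\<^sup>+y. ennreal \<bar>k (x - y)\<bar> * h (f x - f y) \<partial>\<T> \<partial>\<T>)
       = (\<integral>\<^sup>+z. ennreal \<bar>k z\<bar> * (\<integral>\<^sup>+x. h (f (x + z) - f x) \<partial>\<T>) \<partial>\<T>)"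
proof -
  have "(\<integral>\<^sup>+x. \<integral>\<^sup>+y. ennreal \<bar>k (x - y)\<bar> * h (f x - f y) \<partial>\<T> \<partial>\<T>)
      = (\<integral>\<^sup>+x. \<integral>\<^sup>+z. ennreal \<bar>k z\<bar> * h (f x - f (x - z)) \<partial>\<T> \<partial>\<T>)"
  proof (rule nn_integral_cong)
    fix x :: "real ^ 'n"
    have "torus_periodic (\<lambda>y. ennreal \<bar>k (x - y)\<bar> * h (f x - f y))"
    proof -
      have "k (x - (y + 2 *\<^sub>R axis i 1)) = k (x - y)" for y i
        using per(2)[unfolded torus_periodic_def, rule_format, of "x - (y + 2 *\<^sub>R axis i 1)" i] by simp
      then show ?thesis using per(1) by (simp add: torus_periodic_def)
    qed
    from nn_integral_torus_shift_reflection[OF _ this, of x]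
    show "(\<integral>\<^sup>+y. ennreal \<bar>k (x - y)\<bar> * h (f x - f y) \<partial>\<T>)
        = (\<integral>\<^sup>+z. ennreal \<bar>k z\<bar> * h (f x - f (x - z)) \<partial>\<T>)" by simp
  qed
  also have "\<dots> = (\<integral>\<^sup>+z. \<integral>\<^sup>+x. ennreal \<bar>k z\<bar> * h (f x - f (x - z)) \<partial>\<T> \<partial>\<T>)"
    by (rule torus2.Fubini') measurable
  also have "\<dots> = (\<integral>\<^sup>+z. ennreal \<bar>k z\<bar> * (\<integral>\<^sup>+x. h (f (x + z) - f x) \<partial>\<T>) \<partial>\<T>)"
  proof (rule nn_integral_cong)
    fix z :: "real ^ 'n"
    have "torus_periodic (\<lambda>x. h (f x - f (x - z)))"
    proof -
      have "f (x + 2 *\<^sub>R axis i 1 - z) = f (x - z)" for x i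
        using per(1)[unfolded torus_periodic_def, rule_format, of "x - z" i] by (simp add: algebra_simps)
      then show ?thesis using per(1) by (simp add: torus_periodic_def)
    qed
    from nn_integral_torus_translation[OF _ this, of z]
    have "(\<integral>\<^sup>+x. h (f x - f (x - z)) \<partial>\<T>) = (\<integral>\<^sup>+x. h (f (x + z) - f x) \<partial>\<T>)" by simp
    then show "(\<integral>\<^sup>+x. ennreal \<bar>k z\<bar> * h (f x - f (x - z)) \<partial>\<T>)
      = ennreal \<bar>k z\<bar> * (\<integral>\<^sup>+x. h (f (x + z) - f x) \<partial>\<T>)"
      by (subst nn_integral_cmult) auto
  qed
  finally show ?thesis .
qed

text \<open>The q-th power of an L^q modulus of continuity. It is applied with \<beta> = q\<alpha>
  and M proportional to the q-th power of a Besov norm plus one. Borel measurability and periodicity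
  are what the change of variables above asks for.\<close>

definition increment_bound :: "nat \<Rightarrow> real \<Rightarrow> real \<Rightarrow> (real ^ 'n \<Rightarrow> real) \<Rightarrow> bool" where
  "increment_bound q \<beta> M f \<longleftrightarrow> f \<in> borel_measurable borel \<and> torus_periodic f \<and>
     (\<forall>z. (\<integral>\<^sup>+x. ennreal (\<bar>f (x + z) - f x\<bar> ^ q) \<partial>\<T>) \<le> ennreal (M * norm z powr \<beta>))"

lemma trig_poly_moment_integrable:
  fixes k :: "real ^ 'n \<Rightarrow> real"
  assumes k: "trig_poly k" and \<beta>: "0 \<le> \<beta>"
  shows "integrable \<T> (\<lambda>x. \<bar>k x\<bar> * norm x powr \<beta>)"
proof (rule torus.integrable_const_bound)
  obtain B where B: "\<And>x. \<bar>k x\<bar> \<le> B" using trig_poly_bounded[OF k] by blast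
  have "AE x::real ^ 'n in \<T>. norm x \<le> real CARD('n)"
    using AE_torus_measure_cell
  proof eventually_elim
    case (elim x)
    then have "\<bar>x $ i\<bar> \<le> 1" for i by (auto simp: torus_cell_def mem_box_cart abs_le_iff minus_le_iff)
    then have "(\<Sum>i\<in>UNIV. \<bar>x $ i\<bar>) \<le> real CARD('n)" using sum_mono[of UNIV "\<lambda>i. \<bar>x $ i\<bar>" "\<lambda>_. 1"] by simp
    then show ?case using norm_le_l1_cart[of x] by simp
  qed
  then show "AE x in \<T>. norm (\<bar>k x\<bar> * norm x powr \<beta>) \<le> (SUP x. \<bar>k x\<bar>) * real CARD('n) powr \<beta>"
  proof eventually_elim
    case (elim x)
    have "\<bar>k x\<bar> \<le> (SUP x. \<bar>k x\<bar>)" using B by (intro cSUP_upper bdd_aboveI2[of _ _ B]) auto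
    then show ?case using elim \<beta> by (auto simp: abs_mult intro!: mult_mono powr_mono2)
  qed
  show "(\<lambda>x. \<bar>k x\<bar> * norm x powr \<beta>) \<in> borel_measurable \<T>"
    using trig_poly_borel[OF k] by measurable
qed

lemma nn_integral_kernel_increment_le:
  fixes f k :: "real ^ 'n \<Rightarrow> real"
  assumes k: "trig_poly k" and f: "increment_bound q \<beta> M f" and "0 \<le> M" "0 \<le> \<beta>"
  shows "(\<integral>\<^sup>+x. \<integral>\<^sup>+y. ennreal (\<bar>k (x - y)\<bar> * \<bar>f x - f y\<bar> ^ q) \<partial>\<T> \<partial>\<T>)
       \<le> ennreal (M * (\<integral>z. \<bar>k z\<bar> * norm z powr \<beta> \<partial>\<T>))"
proof -
  have [measurable]: "f \<in> borel_measurable borel" "k \<in> borel_measurable borel"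
    using f k by (auto simp: increment_bound_def trig_poly_borel)
  have "(\<integral>\<^sup>+x. \<integral>\<^sup>+y. ennreal (\<bar>k (x - y)\<bar> * \<bar>f x - f y\<bar> ^ q) \<partial>\<T> \<partial>\<T>)
      = (\<integral>\<^sup>+z. ennreal \<bar>k z\<bar> * (\<integral>\<^sup>+x. ennreal (\<bar>f (x + z) - f x\<bar> ^ q) \<partial>\<T>) \<partial>\<T>)"
    using nn_integral_kernel_increment[of f k "\<lambda>t. ennreal (\<bar>t\<bar> ^ q)"] f trig_poly_periodic[OF k]
    by (simp add: ennreal_mult increment_bound_def)
  also have "\<dots> \<le> (\<integral>\<^sup>+z. ennreal (M * (\<bar>k z\<bar> * norm z powr \<beta>)) \<partial>\<T>)"
  proof (rule nn_integral_mono)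
    fix z
    have "ennreal \<bar>k z\<bar> * (\<integral>\<^sup>+x. ennreal (\<bar>f (x + z) - f x\<bar> ^ q) \<partial>\<T>) \<le> ennreal \<bar>k z\<bar> * ennreal (M * norm z powr \<beta>)"
      using f by (intro mult_left_mono) (auto simp: increment_bound_def)
    also have "\<dots> = ennreal (M * (\<bar>k z\<bar> * norm z powr \<beta>))"
      using assms by (simp add: ennreal_mult'[symmetric] mult_ac)
    finally show "ennreal \<bar>k z\<bar> * (\<integral>\<^sup>+x. ennreal (\<bar>f (x + z) - f x\<bar> ^ q) \<partial>\<T>) \<le> \<dots>" .
  qed
  also have "\<dots> = ennreal (M * (\<integral>z. \<bar>k z\<bar> * norm z powr \<beta> \<partial>\<T>))"
    using trig_poly_moment_integrable[OF k \<open>0 \<le> \<beta>\<close>] assms by (subst nn_integral_eq_integral) auto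
  finally show ?thesis .
qed

lemma has_kform_abs_le:
  assumes "has_kform k \<Phi> r"
  shows "ennreal \<bar>r\<bar> \<le> (\<integral>\<^sup>+x. \<integral>\<^sup>+y. ennreal (\<bar>k (x - y)\<bar> * \<bar>\<Phi> x y\<bar>) \<partial>\<T> \<partial>\<T>)"
proof -
  have "ennreal \<bar>r\<bar> = ennreal (norm (\<integral>x. \<integral>y. k (x - y) * \<Phi> x y \<partial>\<T> \<partial>\<T>))"
    using assms by (simp add: has_kform_def)
  also have "\<dots> \<le> (\<integral>\<^sup>+x. ennreal (norm (\<integral>y. k (x - y) * \<Phi> x y \<partial>\<T>)) \<partial>\<T>)"
    using assms by (intro integral_norm_bound_ennreal) (auto simp: has_kform_def)
  also have "\<dots> \<le> (\<integral>\<^sup>+x. \<integral>\<^sup>+y. ennreal (norm (k (x - y) * \<Phi> x y)) \<partial>\<T> \<partial>\<T>)"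
    using assms by (intro nn_integral_mono integral_norm_bound_ennreal) (auto simp: has_kform_def)
  finally show ?thesis by (simp add: abs_mult)
qed

subsection \<open>The commutator estimate at a fixed time\<close>

text \<open>The integrability under which the cubic products of components converge; it follows from
  the Besov assumption since p \<ge> 3.\<close>

definition torus_L3 :: "(real ^ 'n \<Rightarrow> real) \<Rightarrow> bool" where
  "torus_L3 f \<longleftrightarrow> f \<in> borel_measurable borel \<and> integrable \<T> (\<lambda>x. \<bar>f x\<bar> ^ 3)"

text \<open>A crude pointwise form of Hoelder's inequality with exponents 3, 3, 3.\<close>

lemma abs_triple_le_cubes: "\<bar>a * b * c\<bar> \<le> \<bar>a\<bar> ^ 3 + \<bar>b\<bar> ^ 3 + \<bar>c :: real\<bar> ^ 3"
proof -
  let ?m = "max \<bar>a\<bar> (max \<bar>b\<bar> \<bar>c\<bar>)"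
  have "\<bar>a * b * c\<bar> \<le> ?m * ?m * ?m"
    unfolding abs_mult by (intro mult_mono) auto
  also have "\<dots> = ?m ^ 3" by (simp add: power3_eq_cube)
  also have "\<dots> \<le> \<bar>a\<bar> ^ 3 + \<bar>b\<bar> ^ 3 + \<bar>c\<bar> ^ 3"
    by (simp add: max_def)
  finally show ?thesis .
qed

text \<open>Constants fill the empty slots when integrability of products of one or two functions is
  read off from that of triple products.\<close>

lemma torus_L3_const: "torus_L3 (\<lambda>_. c)"
  by (simp add: torus_L3_def)

lemma torus_L3_integrable_mult3:
  fixes f g h :: "real ^ 'n \<Rightarrow> real"
  assumes "torus_L3 f" "torus_L3 g" "torus_L3 h"
  shows "integrable \<T> (\<lambda>x. f x * g x * h x)"
proof (rule Bochner_Integration.integrable_bound)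
  show "integrable \<T> (\<lambda>x. \<bar>f x\<bar> ^ 3 + \<bar>g x\<bar> ^ 3 + \<bar>h x\<bar> ^ 3)"
    using assms by (simp add: torus_L3_def)
  have [measurable]: "f \<in> borel_measurable borel" "g \<in> borel_measurable borel" "h \<in> borel_measurable borel"
    using assms by (auto simp: torus_L3_def)
  show "(\<lambda>x. f x * g x * h x) \<in> borel_measurable \<T>" by measurable
qed (use abs_triple_le_cubes in auto)

lemma torus_L3_integrable_mult:
  assumes "torus_L3 f" "torus_L3 g"
  shows "integrable \<T> (\<lambda>x. f x * g x)"
  using torus_L3_integrable_mult3[OF assms torus_L3_const[of 1]] by simp

lemma torus_L3_integrable:
  assumes "torus_L3 f"
  shows "integrable \<T> f"
  using torus_L3_integrable_mult[OF assms torus_L3_const[of 1]] by simp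

lemma torus_L3_diff:
  assumes "torus_L3 f" "torus_L3 g"
  shows "torus_L3 (\<lambda>x. f x - g x)"
proof -
  have [measurable]: "f \<in> borel_measurable borel" "g \<in> borel_measurable borel"
    using assms by (auto simp: torus_L3_def)
  have "integrable \<T> (\<lambda>x. \<bar>f x - g x\<bar> ^ 3)"
  proof (rule Bochner_Integration.integrable_bound)
    show "integrable \<T> (\<lambda>x. 8 * (\<bar>f x\<bar> ^ 3 + \<bar>g x\<bar> ^ 3))"
      using assms by (simp add: torus_L3_def)
    have "\<bar>a - b\<bar> ^ 3 \<le> 8 * (\<bar>a\<bar> ^ 3 + \<bar>b\<bar> ^ 3)" for a b :: real
    proof -
      have "\<bar>a - b\<bar> ^ 3 \<le> (2 * max \<bar>a\<bar> \<bar>b\<bar>) ^ 3" by (intro power_mono) auto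
      also have "\<dots> \<le> 8 * (\<bar>a\<bar> ^ 3 + \<bar>b\<bar> ^ 3)" by (simp add: max_def)
      finally show ?thesis .
    qed
    then show "AE x in \<T>. norm (\<bar>f x - g x\<bar> ^ 3) \<le> norm (8 * (\<bar>f x\<bar> ^ 3 + \<bar>g x\<bar> ^ 3))" by simp
  qed measurable
  then show ?thesis by (simp add: torus_L3_def)
qed

text \<open>Of the eight terms of the expanded product those depending on one point only vanish because \<open>D\<close> has
  mean zero, and the others coincide in pairs because \<open>D\<close> is odd.\<close>

lemma has_kform_trilinear:
  fixes D f g h :: "real ^ 'n \<Rightarrow> real"
  assumes D: "trig_poly D" and odd: "\<And>z. D (- z) = - D z" and zero: "(\<integral>x. D x \<partial>\<T>) = 0"
    and f: "torus_L3 f" and g: "torus_L3 g" and h: "torus_L3 h"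
  shows "has_kform D (\<lambda>x y. (f x - f y) * (g x - g y) * (h x - h y))
    (- 2 * (kform D (\<lambda>x. f x * g x) h + kform D (\<lambda>x. f x * h x) g + kform D (\<lambda>x. g x * h x) f))"
proof -
  note [intro] = torus_L3_integrable torus_L3_integrable_mult torus_L3_integrable_mult3 f g h
  let ?k = "\<lambda>a b. kform D a b" and ?o = "\<lambda>_ :: real ^ 'n. 1 :: real"
  have o: "integrable \<T> ?o" by simp
  have sw: "kform D a b = - kform D b a" if "integrable \<T> a" "integrable \<T> b" for a b
    using kform_swap[OF D that, of "-1"] odd by simp
  have r: "kform D a ?o = 0" if "integrable \<T> a" for a
    using kform_one_right[OF D that] zero by simp
  have l: "kform D ?o a = 0" if "integrable \<T> a" for a
    using sw[OF o that] r[OF that] by simp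
  have "has_kform D (\<lambda>x y. (f x * g x * h x) * 1 - (f x * g x) * h y - (f x * h x) * g y - (g x * h x) * f y
      + f x * (g y * h y) + g x * (f y * h y) + h x * (f y * g y) - 1 * (f y * g y * h y))
     (?k (\<lambda>x. f x * g x * h x) ?o - ?k (\<lambda>x. f x * g x) h - ?k (\<lambda>x. f x * h x) g - ?k (\<lambda>x. g x * h x) f
      + ?k f (\<lambda>x. g x * h x) + ?k g (\<lambda>x. f x * h x) + ?k h (\<lambda>x. f x * g x) - ?k ?o (\<lambda>x. f x * g x * h x))"
    by (intro has_kform_diff has_kform_add has_kform_product D o) auto
  moreover have "(\<lambda>x y. (f x * g x * h x) * 1 - (f x * g x) * h y - (f x * h x) * g y - (g x * h x) * f y
      + f x * (g y * h y) + g x * (f y * h y) + h x * (f y * g y) - 1 * (f y * g y * h y))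
      = (\<lambda>x y. (f x - f y) * (g x - g y) * (h x - h y))"
    by (intro ext) (simp add: algebra_simps)
  moreover have "?k (\<lambda>x. f x * g x * h x) ?o = 0" "?k ?o (\<lambda>x. f x * g x * h x) = 0"
    by (intro r l; blast)+
  moreover have "?k f (\<lambda>x. g x * h x) = - ?k (\<lambda>x. g x * h x) f" "?k g (\<lambda>x. f x * h x) = - ?k (\<lambda>x. f x * h x) g"
    "?k h (\<lambda>x. f x * g x) = - ?k (\<lambda>x. f x * g x) h"
    by (intro sw; blast)+
  ultimately show ?thesis by (simp add: algebra_simps)
qed

text \<open>In the constant, 3 counts the cubes that bound the product of the increments, and 1/2
  undoes the factor -2 of the trilinear identity.\<close>

lemma trilinear_increment_bound:
  fixes D f g h :: "real ^ 'n \<Rightarrow> real"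
  assumes D: "trig_poly D" and odd: "\<And>z. D (- z) = - D z" and zero: "(\<integral>x. D x \<partial>\<T>) = 0"
    and L3: "torus_L3 f" "torus_L3 g" "torus_L3 h"
    and inc: "increment_bound 3 \<beta> M f" "increment_bound 3 \<beta> M g" "increment_bound 3 \<beta> M h"
    and M: "0 \<le> M" "0 \<le> \<beta>"
  shows "\<bar>kform D (\<lambda>x. f x * g x) h + kform D (\<lambda>x. f x * h x) g + kform D (\<lambda>x. g x * h x) f\<bar>
     \<le> 3 / 2 * M * (\<integral>z. \<bar>D z\<bar> * norm z powr \<beta> \<partial>\<T>)" (is "\<bar>?r\<bar> \<le> 3 / 2 * M * ?\<mu>")
proof -
  have [measurable]: "D \<in> borel_measurable borel" "f \<in> borel_measurable borel" "g \<in> borel_measurable borel" "h \<in> borel_measurable borel"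
    using L3 D by (auto simp: torus_L3_def trig_poly_borel)
  have \<mu>: "0 \<le> ?\<mu>" by (intro integral_nonneg_AE) auto
  let ?J = "\<lambda>f. \<integral>\<^sup>+x. \<integral>\<^sup>+y. ennreal (\<bar>D (x - y)\<bar> * \<bar>f x - f y\<bar> ^ 3) \<partial>\<T> \<partial>\<T>"
  have "ennreal \<bar>- 2 * ?r\<bar> \<le> (\<integral>\<^sup>+x. \<integral>\<^sup>+y. ennreal (\<bar>D (x - y)\<bar> * \<bar>(f x - f y) * (g x - g y) * (h x - h y)\<bar>) \<partial>\<T> \<partial>\<T>)"
    by (rule has_kform_abs_le[OF has_kform_trilinear[OF D odd zero L3]])
  also have "\<dots> \<le> (\<integral>\<^sup>+x. \<integral>\<^sup>+y. ennreal (\<bar>D (x - y)\<bar> * \<bar>f x - f y\<bar> ^ 3) + ennreal (\<bar>D (x - y)\<bar> * \<bar>g x - g y\<bar> ^ 3)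
      + ennreal (\<bar>D (x - y)\<bar> * \<bar>h x - h y\<bar> ^ 3) \<partial>\<T> \<partial>\<T>)"
  proof (intro nn_integral_mono)
    fix x y
    have "\<bar>D (x - y)\<bar> * \<bar>(f x - f y) * (g x - g y) * (h x - h y)\<bar>
       \<le> \<bar>D (x - y)\<bar> * (\<bar>f x - f y\<bar> ^ 3 + \<bar>g x - g y\<bar> ^ 3 + \<bar>h x - h y\<bar> ^ 3)"
      by (intro mult_left_mono abs_triple_le_cubes) auto
    then show "ennreal (\<bar>D (x - y)\<bar> * \<bar>(f x - f y) * (g x - g y) * (h x - h y)\<bar>)
        \<le> ennreal (\<bar>D (x - y)\<bar> * \<bar>f x - f y\<bar> ^ 3) + ennreal (\<bar>D (x - y)\<bar> * \<bar>g x - g y\<bar> ^ 3)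
      + ennreal (\<bar>D (x - y)\<bar> * \<bar>h x - h y\<bar> ^ 3)"
      by (simp add: ennreal_plus[symmetric] distrib_left ennreal_leI del: ennreal_plus)
  qed
  also have "\<dots> = ?J f + ?J g + ?J h"
    by (simp add: nn_integral_add)
  also have "\<dots> \<le> ennreal (M * ?\<mu>) + ennreal (M * ?\<mu>) + ennreal (M * ?\<mu>)"
    using M by (intro add_mono nn_integral_kernel_increment_le D inc)
  also have "\<dots> = ennreal (3 * (M * ?\<mu>))"
    using M \<mu> by (simp add: ennreal_plus[symmetric] del: ennreal_plus)
  finally have "\<bar>- 2 * ?r\<bar> \<le> 3 * (M * ?\<mu>)"
    using M \<mu> by (subst (asm) ennreal_le_iff) auto
  then have "2 * \<bar>?r\<bar> \<le> 3 * (M * ?\<mu>)" by (simp only: abs_mult abs_minus_cancel abs_numeral)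
  then show ?thesis by simp
qed

text \<open>For an even kernel of mass one the integral of
  \<open>K (x - y) * (f x - f y)\<^sup>2\<close> is twice the defect between the energy and the
  mollified energy. This shows that the mollified energies converge to the energy.\<close>

lemma energy_increment_bound:
  fixes K f :: "real ^ 'n \<Rightarrow> real"
  assumes K: "trig_poly K" and even: "\<And>z. K (- z) = K z" and one: "(\<integral>x. K x \<partial>\<T>) = 1"
    and nonneg: "\<And>z. 0 \<le> K z"
    and L3: "torus_L3 f" and inc: "increment_bound 2 \<beta> M f" and M: "0 \<le> M" "0 \<le> \<beta>"
  shows "(\<integral>x. (f x)\<^sup>2 \<partial>\<T>) - kform K f f \<le> M * (\<integral>z. K z * norm z powr \<beta> \<partial>\<T>)"
proof -
  let ?o = "\<lambda>_ :: real ^ 'n. 1 :: real" and ?s = "\<lambda>x. f x * f x"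
  have int: "integrable \<T> ?o" "integrable \<T> f" "integrable \<T> ?s"
    using torus_L3_integrable[OF L3] torus_L3_integrable_mult[OF L3 L3] by auto
  have "has_kform K (\<lambda>x y. f x * f x * 1 - f x * f y - f x * f y + 1 * (f y * f y))
     (kform K ?s ?o - kform K f f - kform K f f + kform K ?o ?s)"
    by (intro has_kform_add has_kform_diff has_kform_product K int)
  moreover have "kform K ?s ?o = (\<integral>x. (f x)\<^sup>2 \<partial>\<T>)"
    by (subst kform_one_right[OF K int(3)]) (simp add: one power2_eq_square)
  moreover have "kform K ?o ?s = (\<integral>x. (f x)\<^sup>2 \<partial>\<T>)"
    using kform_swap[OF K int(1,3), of 1] kform_one_right[OF K int(3)] even by (simp add: one power2_eq_square)
  moreover have "(\<lambda>x y. f x * f x * 1 - f x * f y - f x * f y + 1 * (f y * f y)) = (\<lambda>x y. (f x - f y)\<^sup>2)"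
    by (intro ext) (simp add: power2_eq_square algebra_simps)
  ultimately have hk: "has_kform K (\<lambda>x y. (f x - f y)\<^sup>2) (2 * ((\<integral>x. (f x)\<^sup>2 \<partial>\<T>) - kform K f f))"
    by (simp add: algebra_simps)
  let ?\<mu> = "\<integral>z. \<bar>K z\<bar> * norm z powr \<beta> \<partial>\<T>"
  have \<mu>: "0 \<le> ?\<mu>" by (intro integral_nonneg_AE) auto
  have "ennreal \<bar>2 * ((\<integral>x. (f x)\<^sup>2 \<partial>\<T>) - kform K f f)\<bar>
      \<le> (\<integral>\<^sup>+x. \<integral>\<^sup>+y. ennreal (\<bar>K (x - y)\<bar> * \<bar>f x - f y\<bar> ^ 2) \<partial>\<T> \<partial>\<T>)"
    using has_kform_abs_le[OF hk] by simp
  also have "\<dots> \<le> ennreal (M * ?\<mu>)"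
    using M by (intro nn_integral_kernel_increment_le K inc)
  finally have "\<bar>2 * ((\<integral>x. (f x)\<^sup>2 \<partial>\<T>) - kform K f f)\<bar> \<le> M * ?\<mu>"
    using M \<mu> by (subst (asm) ennreal_le_iff) auto
  moreover have "0 \<le> M * ?\<mu>" using M \<mu> by simp
  ultimately have "(\<integral>x. (f x)\<^sup>2 \<partial>\<T>) - kform K f f \<le> M * ?\<mu>"
    unfolding right_diff_distrib by linarith
  then show ?thesis using nonneg by simp
qed

text \<open>Trigonometric test functions are the ones that occur: the condition is always applied to
  a translate or reflection of the kernel.\<close>

definition weakly_div_free :: "(real ^ 'n \<Rightarrow> real ^ 'n) \<Rightarrow> bool" where
  "weakly_div_free u \<longleftrightarrow> (\<forall>\<phi>. trig_poly \<phi> \<longrightarrow> (\<Sum>j\<in>UNIV. \<integral>x. u x $ j * partial_x j \<phi> x \<partial>\<T>) = 0)"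

lemma weakly_div_free_diff:
  fixes u v :: "real ^ 'n \<Rightarrow> real ^ 'n"
  assumes "\<And>j. integrable \<T> (\<lambda>x. u x $ j)" "\<And>j. integrable \<T> (\<lambda>x. v x $ j)"
    and div: "weakly_div_free u" "weakly_div_free v"
  shows "weakly_div_free (\<lambda>x. u x - v x)"
  unfolding weakly_div_free_def
proof (intro allI impI)
  fix \<phi> :: "real ^ 'n \<Rightarrow> real" assume \<phi>: "trig_poly \<phi>"
  have "integrable \<T> (\<lambda>x. u x $ j * partial_x j \<phi> x)" "integrable \<T> (\<lambda>x. v x $ j * partial_x j \<phi> x)" for j
    using integrable_trig_poly_mult[OF trig_poly_partial_x[OF \<phi>] assms(1)]
      integrable_trig_poly_mult[OF trig_poly_partial_x[OF \<phi>] assms(2)]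
    by (simp_all add: mult.commute)
  then have "(\<Sum>j\<in>UNIV. \<integral>x. (u x - v x) $ j * partial_x j \<phi> x \<partial>\<T>)
     = (\<Sum>j\<in>UNIV. \<integral>x. u x $ j * partial_x j \<phi> x \<partial>\<T>) - (\<Sum>j\<in>UNIV. \<integral>x. v x $ j * partial_x j \<phi> x \<partial>\<T>)"
    by (simp add: left_diff_distrib sum_subtractf)
  then show "(\<Sum>j\<in>UNIV. \<integral>x. (u x - v x) $ j * partial_x j \<phi> x \<partial>\<T>) = 0"
    using div \<phi> by (simp add: weakly_div_free_def)
qed

text \<open>For fixed y the sum over j of the inner integrals is the weak divergence of u tested
  with \<open>K (x - y)\<close> as a function of x.\<close>

lemma weakly_div_free_kform:
  fixes K g :: "real ^ 'n \<Rightarrow> real"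
  assumes K: "trig_poly K" and u: "\<And>j. integrable \<T> (\<lambda>x. u x $ j)" "weakly_div_free u"
    and g: "integrable \<T> g"
  shows "(\<Sum>j\<in>UNIV. kform (partial_x j K) (\<lambda>x. u x $ j) g) = 0"
proof -
  have "(\<Sum>j\<in>UNIV. kform (partial_x j K) (\<lambda>x. u x $ j) g)
      = (\<Sum>j\<in>UNIV. \<integral>y. g y * (\<integral>x. partial_x j K (x - y) * u x $ j \<partial>\<T>) \<partial>\<T>)"
    by (intro sum.cong refl kform_flip(1) trig_poly_partial_x K u g)
  also have "\<dots> = (\<integral>y. (\<Sum>j\<in>UNIV. g y * (\<integral>x. partial_x j K (x - y) * u x $ j \<partial>\<T>)) \<partial>\<T>)"
    by (intro Bochner_Integration.integral_sum[symmetric] kform_flip(2) trig_poly_partial_x K u g)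
  also have "\<dots> = (\<integral>y. 0 \<partial>(\<T> :: (real ^ 'n) measure))"
  proof (rule Bochner_Integration.integral_cong[OF refl])
    fix y
    have "trig_poly (\<lambda>x. K (x - y))" using trig_poly_translation[OF K, of "- y"] by simp
    then have "(\<Sum>j\<in>UNIV. \<integral>x. u x $ j * partial_x j (\<lambda>x. K (x - y)) x \<partial>\<T>) = 0"
      using u(2) by (simp add: weakly_div_free_def)
    then have "(\<Sum>j\<in>UNIV. \<integral>x. partial_x j K (x - y) * u x $ j \<partial>\<T>) = 0"
      by (simp add: partial_x_trig_poly_shift(1)[OF K] mult.commute)
    then show "(\<Sum>j\<in>UNIV. g y * (\<integral>x. partial_x j K (x - y) * u x $ j \<partial>\<T>)) = 0"
      by (simp add: sum_distrib_left[symmetric])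
  qed
  finally show ?thesis by simp
qed

definition one_sided_Lipschitz :: "real \<Rightarrow> (real ^ 'n \<Rightarrow> real ^ 'n) \<Rightarrow> bool" where
  "one_sided_Lipschitz C v \<longleftrightarrow> (\<forall>\<zeta> \<phi>. trig_poly \<phi> \<longrightarrow> (\<forall>x. 0 \<le> \<phi> x) \<longrightarrow>
     0 \<le> (\<integral>x. - (\<zeta> \<bullet> v x) * (\<Sum>j\<in>UNIV. \<zeta> $ j * partial_x j \<phi> x) + C * (norm \<zeta>)\<^sup>2 * \<phi> x \<partial>\<T>))"

text \<open>The condition is used for each x separately before integrating in x: \<open>w x\<close>
  is a constant for the integration in y and may serve as direction. Differentiating
  \<open>K (x - y)\<close> in y produces a minus sign that cancels the one in the condition, and
  mass one of K turns the other term into \<open>C * (norm (w x))\<^sup>2\<close>.\<close>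

lemma one_sided_Lipschitz_kform:
  fixes K :: "real ^ 'n \<Rightarrow> real" and v w :: "real ^ 'n \<Rightarrow> real ^ 'n"
  assumes K: "trig_poly K" and nonneg: "\<And>z. 0 \<le> K z" and one: "(\<integral>x. K x \<partial>\<T>) = 1"
    and v: "\<And>i. torus_L3 (\<lambda>x. v x $ i)" and w: "\<And>i. torus_L3 (\<lambda>x. w x $ i)" and lip: "one_sided_Lipschitz C v"
  shows "- C * (\<integral>x. (norm (w x))\<^sup>2 \<partial>\<T>)
    \<le> (\<Sum>i\<in>UNIV. \<Sum>j\<in>UNIV. kform (partial_x j K) (\<lambda>x. w x $ j * w x $ i) (\<lambda>x. v x $ i))"
proof -
  have hk: "has_kform (partial_x j K) (\<lambda>x y. (w x $ j * w x $ i) * v y $ i) (kform (partial_x j K) (\<lambda>x. w x $ j * w x $ i) (\<lambda>x. v x $ i))" for i j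
    by (intro has_kform_product trig_poly_partial_x K torus_L3_integrable torus_L3_integrable_mult v w)
  let ?I = "\<lambda>i j x. \<integral>y. partial_x j K (x - y) * ((w x $ j * w x $ i) * v y $ i) \<partial>\<T>"
  have iI: "integrable \<T> (?I i j)" for i j
    using hk[of j i] by (simp add: has_kform_def)
  have nsq: "(norm (w x))\<^sup>2 = (\<Sum>i\<in>UNIV. w x $ i * w x $ i)" for x
    unfolding power2_norm_eq_inner by (simp add: inner_vec_def)
  have "(\<Sum>i\<in>UNIV. \<Sum>j\<in>UNIV. kform (partial_x j K) (\<lambda>x. w x $ j * w x $ i) (\<lambda>x. v x $ i))
      = (\<integral>x. (\<Sum>i\<in>UNIV. \<Sum>j\<in>UNIV. ?I i j x) \<partial>\<T>)"
    using iI by (simp add: Bochner_Integration.integral_sum kform_def)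
  also have "\<dots> \<ge> (\<integral>x. - C * (norm (w x))\<^sup>2 \<partial>\<T>)"
  proof (rule integral_mono)
    show "integrable \<T> (\<lambda>x. - C * (norm (w x))\<^sup>2)"
      unfolding nsq by (intro integrable_mult_right Bochner_Integration.integrable_sum torus_L3_integrable_mult w)
    show "integrable \<T> (\<lambda>x. \<Sum>i\<in>UNIV. \<Sum>j\<in>UNIV. ?I i j x)"
      by (intro Bochner_Integration.integrable_sum iI)
    fix x
    let ?\<zeta> = "w x" and ?\<phi> = "\<lambda>y. K (x - y)"
    have \<phi>: "trig_poly ?\<phi>" by (rule trig_poly_shift_reflection[OF K])
    have i1: "integrable \<T> (\<lambda>y. partial_x j K (x - y) * ((w x $ j * w x $ i) * v y $ i))" for i j
      using hk[of j i] by (simp add: has_kform_def)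
    have i2: "integrable \<T> ?\<phi>" by (rule trig_poly_integrable[OF \<phi>])
    have "0 \<le> (\<integral>y. - (?\<zeta> \<bullet> v y) * (\<Sum>j\<in>UNIV. ?\<zeta> $ j * partial_x j ?\<phi> y) + C * (norm ?\<zeta>)\<^sup>2 * ?\<phi> y \<partial>\<T>)"
      using lip \<phi> nonneg unfolding one_sided_Lipschitz_def by blast
    also have "\<dots> = (\<integral>y. (\<Sum>i\<in>UNIV. \<Sum>j\<in>UNIV. partial_x j K (x - y) * ((w x $ j * w x $ i) * v y $ i)) + C * (norm ?\<zeta>)\<^sup>2 * ?\<phi> y \<partial>\<T>)"
    proof (rule Bochner_Integration.integral_cong[OF refl])
      fix y
      have "- (?\<zeta> \<bullet> v y) * (\<Sum>j\<in>UNIV. ?\<zeta> $ j * partial_x j ?\<phi> y) = (?\<zeta> \<bullet> v y) * (\<Sum>j\<in>UNIV. ?\<zeta> $ j * partial_x j K (x - y))"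
        by (simp add: partial_x_trig_poly_shift(2)[OF K] sum_negf)
      also have "\<dots> = (\<Sum>i\<in>UNIV. \<Sum>j\<in>UNIV. partial_x j K (x - y) * ((w x $ j * w x $ i) * v y $ i))"
        by (simp add: inner_vec_def sum_product mult_ac)
      finally show "- (?\<zeta> \<bullet> v y) * (\<Sum>j\<in>UNIV. ?\<zeta> $ j * partial_x j ?\<phi> y) + C * (norm ?\<zeta>)\<^sup>2 * ?\<phi> y
        = (\<Sum>i\<in>UNIV. \<Sum>j\<in>UNIV. partial_x j K (x - y) * ((w x $ j * w x $ i) * v y $ i)) + C * (norm ?\<zeta>)\<^sup>2 * ?\<phi> y"
        by simp
    qed
    also have "\<dots> = (\<Sum>i\<in>UNIV. \<Sum>j\<in>UNIV. ?I i j x) + C * (norm ?\<zeta>)\<^sup>2 * (\<integral>y. ?\<phi> y \<partial>\<T>)"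
      using i1 i2 by (subst Bochner_Integration.integral_add)
        (auto simp: Bochner_Integration.integral_sum intro!: Bochner_Integration.integrable_sum)
    also have "(\<integral>y. ?\<phi> y \<partial>\<T>) = 1"
      using integral_torus_shift_reflection[OF trig_poly_borel[OF K] trig_poly_periodic[OF K], of x] one by simp
    finally show "- C * (norm (w x))\<^sup>2 \<le> (\<Sum>i\<in>UNIV. \<Sum>j\<in>UNIV. ?I i j x)" by simp
  qed
  finally show ?thesis by simp
qed

lemma sum_sum_distrib_left: "(\<Sum>i\<in>I. \<Sum>j\<in>J. c * f i j) = c * (\<Sum>i\<in>I. \<Sum>j\<in>J. f i j :: real)"
  by (simp add: sum_distrib_left)

text \<open>With \<open>w = u - v\<close> and \<open>u \<otimes> u - v \<otimes> v = w \<otimes> u + v \<otimes> w\<close> the flux becomes \<open>Q1 + Q2\<close>. By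
  \<open>has_kform_trilinear\<close> and the divergence constraints, it differs by integrals of cubic expressions in
  the increments from \<open>- P\<close>, where the one-sided Lipschitz condition, with \<open>\<zeta> = w x\<close> and
  \<open>\<phi> = K (x - \<cdot>)\<close>, applies to \<open>P\<close>.\<close>

lemma euler_flux_bound:
  fixes K :: "real ^ 'n \<Rightarrow> real" and u v w :: "real ^ 'n \<Rightarrow> real ^ 'n"
  assumes K: "trig_poly K" and nonneg: "\<And>z. 0 \<le> K z" and one: "(\<integral>x. K x \<partial>\<T>) = 1"
    and odd: "\<And>j z. partial_x j K (- z) = - partial_x j K z"
    and w_def: "\<And>x. w x = u x - v x"
    and u: "\<And>i. torus_L3 (\<lambda>x. u x $ i)" and v: "\<And>i. torus_L3 (\<lambda>x. v x $ i)"
    and div: "weakly_div_free u" "weakly_div_free v"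
    and inc: "\<And>i. increment_bound 3 \<beta> M (\<lambda>x. u x $ i)" "\<And>i. increment_bound 3 \<beta> M (\<lambda>x. v x $ i)"
      "\<And>i. increment_bound 3 \<beta> M (\<lambda>x. w x $ i)"
    and M: "0 \<le> M" "0 \<le> \<beta>" and lip: "one_sided_Lipschitz C v"
  shows "(\<Sum>i\<in>UNIV. \<Sum>j\<in>UNIV. kform (partial_x j K) (\<lambda>x. u x $ i * u x $ j - v x $ i * v x $ j) (\<lambda>x. w x $ i))
    \<le> C * (\<integral>x. (norm (w x))\<^sup>2 \<partial>\<T>)
       + 3 * M * real CARD('n) * (\<Sum>j\<in>UNIV. \<integral>z. \<bar>partial_x j K z\<bar> * norm z powr \<beta> \<partial>\<T>)"
proof -
  define D where "D j = partial_x j K" for j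
  define \<mu> where "\<mu> j = (\<integral>z. \<bar>D j z\<bar> * norm z powr \<beta> \<partial>\<T>)" for j
  have D: "trig_poly (D j)" "\<And>z. D j (- z) = - D j z" "(\<integral>x. D j x \<partial>\<T>) = 0" for j
    unfolding D_def by (intro trig_poly_partial_x K odd integral_partial_x_trig_poly)+
  have w: "torus_L3 (\<lambda>x. w x $ i)" for i
    using torus_L3_diff[OF u[of i] v[of i]] by (simp add: w_def)
  note int = torus_L3_integrable torus_L3_integrable_mult u v w
  have div_w: "weakly_div_free w"
    using weakly_div_free_diff[OF torus_L3_integrable[OF u] torus_L3_integrable[OF v] div] by (simp add: w_def[abs_def])
  have sw: "kform (D j) a b = - kform (D j) b a" if "integrable \<T> a" "integrable \<T> b" for a b j
    using kform_swap[OF D(1)[of j] that, where s = "-1"] D(2)[of j] by simp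
  have divz: "(\<Sum>j\<in>UNIV. kform (D j) g (\<lambda>x. a x $ j)) = 0"
    if "\<And>j. integrable \<T> (\<lambda>x. a x $ j)" "weakly_div_free a" "integrable \<T> g" for a g
  proof -
    have "(\<Sum>j\<in>UNIV. kform (D j) g (\<lambda>x. a x $ j)) = (\<Sum>j\<in>UNIV. - kform (D j) (\<lambda>x. a x $ j) g)"
      by (intro sum.cong refl sw that)
    also have "\<dots> = 0" using weakly_div_free_kform[OF K that] by (simp add: D_def sum_negf)
    finally show ?thesis .
  qed
  define Q1 where "Q1 = (\<Sum>i\<in>UNIV. \<Sum>j\<in>UNIV. kform (D j) (\<lambda>x. u x $ j * w x $ i) (\<lambda>x. w x $ i))"
  define Q2 where "Q2 = (\<Sum>i\<in>UNIV. \<Sum>j\<in>UNIV. kform (D j) (\<lambda>x. w x $ j * v x $ i) (\<lambda>x. w x $ i))"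
  define P where "P = (\<Sum>i\<in>UNIV. \<Sum>j\<in>UNIV. kform (D j) (\<lambda>x. w x $ j * w x $ i) (\<lambda>x. v x $ i))"
  \<comment> \<open>\<open>T1\<close> and \<open>T2\<close> are the combinations bounded by
    \<open>trilinear_increment_bound\<close>, for the components (u_j, w_i, w_i) and (w_j, v_i,
    w_i). In each, the last form has a solenoidal field alone at the second point and vanishes after
    summation over j.\<close>
  define T1 where "T1 i j = kform (D j) (\<lambda>x. u x $ j * w x $ i) (\<lambda>x. w x $ i)
      + kform (D j) (\<lambda>x. u x $ j * w x $ i) (\<lambda>x. w x $ i) + kform (D j) (\<lambda>x. w x $ i * w x $ i) (\<lambda>x. u x $ j)" for i j
  define T2 where "T2 i j = kform (D j) (\<lambda>x. w x $ j * v x $ i) (\<lambda>x. w x $ i)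
      + kform (D j) (\<lambda>x. w x $ j * w x $ i) (\<lambda>x. v x $ i) + kform (D j) (\<lambda>x. v x $ i * w x $ i) (\<lambda>x. w x $ j)" for i j
  have T1: "\<bar>T1 i j\<bar> \<le> 3 / 2 * M * \<mu> j" for i j
    unfolding T1_def \<mu>_def by (intro trilinear_increment_bound D u v w inc M)
  have T2: "\<bar>T2 i j\<bar> \<le> 3 / 2 * M * \<mu> j" for i j
    unfolding T2_def \<mu>_def by (intro trilinear_increment_bound D u v w inc M)
  have sumT1: "(\<Sum>i\<in>UNIV. \<Sum>j\<in>UNIV. T1 i j) = 2 * Q1"
  proof -
    have "(\<Sum>j\<in>UNIV. kform (D j) (\<lambda>x. w x $ i * w x $ i) (\<lambda>x. u x $ j)) = 0" for i
      by (intro divz div int)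
    then show ?thesis unfolding T1_def Q1_def by (simp add: sum.distrib sum_sum_distrib_left)
  qed
  have sumT2: "(\<Sum>i\<in>UNIV. \<Sum>j\<in>UNIV. T2 i j) = Q2 + P"
  proof -
    have "(\<Sum>j\<in>UNIV. kform (D j) (\<lambda>x. v x $ i * w x $ i) (\<lambda>x. w x $ j)) = 0" for i
      by (intro divz div_w int)
    then show ?thesis unfolding T2_def Q2_def P_def by (simp add: sum.distrib)
  qed
  have "(\<Sum>i\<in>UNIV. \<Sum>j\<in>UNIV. kform (D j) (\<lambda>x. u x $ i * u x $ j - v x $ i * v x $ j) (\<lambda>x. w x $ i)) = Q1 + Q2"
    unfolding Q1_def Q2_def sum.distrib[symmetric]
  proof (intro sum.cong refl)
    fix i j
    have "u x $ i * u x $ j - v x $ i * v x $ j = u x $ j * w x $ i + w x $ j * v x $ i" for x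
      by (simp add: w_def algebra_simps)
    then show "kform (D j) (\<lambda>x. u x $ i * u x $ j - v x $ i * v x $ j) (\<lambda>x. w x $ i)
       = kform (D j) (\<lambda>x. u x $ j * w x $ i) (\<lambda>x. w x $ i) + kform (D j) (\<lambda>x. w x $ j * v x $ i) (\<lambda>x. w x $ i)"
      by (simp only:) (intro kform_add_left D int)
  qed
  also have "\<dots> = (1 / 2) * (\<Sum>i\<in>UNIV. \<Sum>j\<in>UNIV. T1 i j) + (\<Sum>i\<in>UNIV. \<Sum>j\<in>UNIV. T2 i j) - P"
    using sumT1 sumT2 by simp
  also have "\<dots> \<le> (1 / 2) * (\<Sum>i\<in>(UNIV :: 'n set). \<Sum>j\<in>UNIV. 3 / 2 * M * \<mu> j) + (\<Sum>i\<in>(UNIV :: 'n set). \<Sum>j\<in>UNIV. 3 / 2 * M * \<mu> j)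
      + C * (\<integral>x. (norm (w x))\<^sup>2 \<partial>\<T>)"
  proof -
    have "- C * (\<integral>x. (norm (w x))\<^sup>2 \<partial>\<T>) \<le> P"
      unfolding P_def D_def by (rule one_sided_Lipschitz_kform[OF K nonneg one v w lip])
    moreover have "(\<Sum>i\<in>UNIV. \<Sum>j\<in>UNIV. T1 i j) \<le> (\<Sum>i\<in>(UNIV :: 'n set). \<Sum>j\<in>UNIV. 3 / 2 * M * \<mu> j)"
      by (intro sum_mono abs_le_D1[OF T1])
    moreover have "(\<Sum>i\<in>UNIV. \<Sum>j\<in>UNIV. T2 i j) \<le> (\<Sum>i\<in>(UNIV :: 'n set). \<Sum>j\<in>UNIV. 3 / 2 * M * \<mu> j)"
      by (intro sum_mono abs_le_D1[OF T2])
    ultimately show ?thesis by linarith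
  qed
  \<comment> \<open>The weights 1/2 for \<open>T1\<close>, where \<open>Q1\<close> occurs twice, and
    1 for \<open>T2\<close> give 9/4 = (1/2 + 1) * 3/2, afterwards rounded up to 3. The sum over i
    contributes CARD('n).\<close>
  also have "\<dots> = C * (\<integral>x. (norm (w x))\<^sup>2 \<partial>\<T>) + 9 / 4 * M * real CARD('n) * (\<Sum>j\<in>UNIV. \<mu> j)"
    unfolding sum_distrib_left[of "3 / 2 * M", symmetric] by (simp add: algebra_simps)
  also have "\<dots> \<le> C * (\<integral>x. (norm (w x))\<^sup>2 \<partial>\<T>) + 3 * M * real CARD('n) * (\<Sum>j\<in>UNIV. \<mu> j)"
  proof -
    have "0 \<le> \<mu> j" for j unfolding \<mu>_def by (intro integral_nonneg_AE) auto
    then have "0 \<le> M * real CARD('n) * (\<Sum>j\<in>UNIV. \<mu> j)" using M by (intro mult_nonneg_nonneg sum_nonneg) auto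
    then show ?thesis by linarith
  qed
  finally show ?thesis unfolding D_def \<mu>_def .
qed

subsection \<open>Continuous paths in \<open>L\<^sup>2\<close>\<close>

text \<open>Continuity into L^2 for a single component, with the squared distance so that roots are
  avoided. Only the slices at fixed time are required to be measurable.\<close>

definition L2_path :: "real \<Rightarrow> (real \<Rightarrow> real ^ 'n \<Rightarrow> real) \<Rightarrow> bool" where
  "L2_path T f \<longleftrightarrow> (\<forall>t\<in>{0..<T}. f t \<in> borel_measurable borel \<and> integrable \<T> (\<lambda>x. (f t x)\<^sup>2) \<and>
     ((\<lambda>s. \<integral>x. (f s x - f t x)\<^sup>2 \<partial>\<T>) \<longlongrightarrow> 0) (at t within {0..<T}))"

lemma abs_mult_le_sum_squares: "\<bar>x * y\<bar> \<le> x\<^sup>2 + (y :: real)\<^sup>2"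
proof -
  have "2 * (\<bar>x\<bar> * \<bar>y\<bar>) \<le> x\<^sup>2 + y\<^sup>2" using sum_squares_bound[of "\<bar>x\<bar>" "\<bar>y\<bar>"] by (simp add: mult.assoc)
  moreover have "0 \<le> \<bar>x\<bar> * \<bar>y\<bar>" by simp
  ultimately show ?thesis unfolding abs_mult by linarith
qed

lemma integrable_mult_square:
  fixes f g \<phi> :: "real ^ 'n \<Rightarrow> real"
  assumes [measurable]: "f \<in> borel_measurable borel" "g \<in> borel_measurable borel" "\<phi> \<in> borel_measurable borel"
    and int: "integrable \<T> (\<lambda>x. (f x)\<^sup>2)" "integrable \<T> (\<lambda>x. (g x)\<^sup>2)" and B: "\<And>x. \<bar>\<phi> x\<bar> \<le> B"
  shows "integrable \<T> (\<lambda>x. f x * g x * \<phi> x)"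
proof (rule Bochner_Integration.integrable_bound)
  show "integrable \<T> (\<lambda>x. B * ((f x)\<^sup>2 + (g x)\<^sup>2))" using int by simp
  have "\<bar>f x * g x * \<phi> x\<bar> \<le> B * ((f x)\<^sup>2 + (g x)\<^sup>2)" for x
  proof -
    have "\<bar>f x\<bar> * \<bar>g x\<bar> \<le> (f x)\<^sup>2 + (g x)\<^sup>2"
      using abs_mult_le_sum_squares[of "f x" "g x"] by (simp add: abs_mult)
    then have "\<bar>\<phi> x\<bar> * (\<bar>f x\<bar> * \<bar>g x\<bar>) \<le> B * ((f x)\<^sup>2 + (g x)\<^sup>2)"
      using B[of x] by (intro mult_mono) auto
    then show ?thesis by (simp add: abs_mult mult_ac)
  qed
  then show "AE x in \<T>. norm (f x * g x * \<phi> x) \<le> norm (B * ((f x)\<^sup>2 + (g x)\<^sup>2))"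
    by (auto intro: order_trans[OF _ abs_ge_self])
qed measurable

lemma integrable_diff_square:
  fixes f g :: "real ^ 'n \<Rightarrow> real"
  assumes [measurable]: "f \<in> borel_measurable borel" "g \<in> borel_measurable borel"
    and int: "integrable \<T> (\<lambda>x. (f x)\<^sup>2)" "integrable \<T> (\<lambda>x. (g x)\<^sup>2)"
  shows "integrable \<T> (\<lambda>x. (f x - g x)\<^sup>2)"
proof -
  have "integrable \<T> (\<lambda>x. f x * g x * 1)"
    by (rule integrable_mult_square[OF assms(1,2) _ int, of _ 1]) auto
  with int have "integrable \<T> (\<lambda>x. (f x)\<^sup>2 + (g x)\<^sup>2 - 2 * (f x * g x * 1))" by simp
  then show ?thesis by (simp add: power2_diff mult.assoc)
qed

text \<open>Young's inequality with parameter \<epsilon>: the possibly large factor 1 + 1/\<epsilon>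
  multiplies only the squared increments, and the small \<epsilon> the squares at the fixed base
  point. Integrated, this gives continuity of products of two L^2 paths.\<close>

lemma product_increment_le:
  fixes a b a' b' \<epsilon> :: real
  assumes "0 < \<epsilon>"
  shows "\<bar>a' * b' - a * b\<bar> \<le> (1 + 1 / \<epsilon>) * ((a' - a)\<^sup>2 + (b' - b)\<^sup>2) + \<epsilon> * (a\<^sup>2 + b\<^sup>2)"
proof -
  have young: "\<bar>x * y\<bar> \<le> x\<^sup>2 / \<epsilon> + \<epsilon> * y\<^sup>2" for x y
  proof -
    have "(\<bar>x\<bar> - \<epsilon> * \<bar>y\<bar>)\<^sup>2 \<ge> 0" by simp
    then have "2 * \<epsilon> * \<bar>x * y\<bar> \<le> x\<^sup>2 + \<epsilon>\<^sup>2 * y\<^sup>2"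
      by (simp add: power2_diff power_mult_distrib abs_mult mult_ac)
    moreover have "0 \<le> \<epsilon> * \<bar>x * y\<bar>" using assms by simp
    ultimately have "\<epsilon> * \<bar>x * y\<bar> \<le> x\<^sup>2 + \<epsilon>\<^sup>2 * y\<^sup>2" by linarith
    then show ?thesis using assms by (simp add: field_simps power2_eq_square)
  qed
  have "\<bar>(a' - a) * (b' - b)\<bar> \<le> (a' - a)\<^sup>2 + (b' - b)\<^sup>2"
    by (rule abs_mult_le_sum_squares)
  moreover have "a' * b' - a * b = (a' - a) * (b' - b) + (a' - a) * b + (b' - b) * a" by (simp add: algebra_simps)
  ultimately have "\<bar>a' * b' - a * b\<bar> \<le> (a' - a)\<^sup>2 + (b' - b)\<^sup>2 + ((a' - a)\<^sup>2 / \<epsilon> + \<epsilon> * b\<^sup>2) + ((b' - b)\<^sup>2 / \<epsilon> + \<epsilon> * a\<^sup>2)"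
    using young[of "a' - a" b] young[of "b' - b" a] by linarith
  then show ?thesis by (simp add: algebra_simps add_divide_distrib)
qed

lemma L2_path_mult_continuous:
  fixes f g :: "real \<Rightarrow> real ^ 'n \<Rightarrow> real"
  assumes f: "L2_path T f" and g: "L2_path T g" and \<phi>[measurable]: "\<phi> \<in> borel_measurable borel" and B: "\<And>x. \<bar>\<phi> x\<bar> \<le> B"
  shows "continuous_on {0..<T} (\<lambda>t. \<integral>x. f t x * g t x * \<phi> x \<partial>\<T>)"
  unfolding continuous_on_def
proof
  fix t assume t: "t \<in> {0..<T}"
  have B0: "0 \<le> B" using B[of 0] by linarith
  define \<delta> where "\<delta> s = (\<integral>x. (f s x - f t x)\<^sup>2 \<partial>\<T>) + (\<integral>x. (g s x - g t x)\<^sup>2 \<partial>\<T>)" for s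
  define A where "A = (\<integral>x. (f t x)\<^sup>2 \<partial>\<T>) + (\<integral>x. (g t x)\<^sup>2 \<partial>\<T>)"
  have \<delta>: "(\<delta> \<longlongrightarrow> 0) (at t within {0..<T})"
    using tendsto_add[of "\<lambda>s. \<integral>x. (f s x - f t x)\<^sup>2 \<partial>\<T>" 0 _ "\<lambda>s. \<integral>x. (g s x - g t x)\<^sup>2 \<partial>\<T>" 0] f g t
    unfolding \<delta>_def[abs_def] L2_path_def by auto
  have A: "0 \<le> A" unfolding A_def by (intro add_nonneg_nonneg integral_nonneg_AE) auto
  have bound: "\<bar>(\<integral>x. f s x * g s x * \<phi> x \<partial>\<T>) - (\<integral>x. f t x * g t x * \<phi> x \<partial>\<T>)\<bar>
      \<le> B * ((1 + 1 / \<epsilon>) * \<delta> s + \<epsilon> * A)" if s: "s \<in> {0..<T}" and \<epsilon>: "0 < \<epsilon>" for s \<epsilon>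
  proof -
    have m[measurable]: "f s \<in> borel_measurable borel" "f t \<in> borel_measurable borel" "g s \<in> borel_measurable borel" "g t \<in> borel_measurable borel"
      and i: "integrable \<T> (\<lambda>x. (f s x)\<^sup>2)" "integrable \<T> (\<lambda>x. (f t x)\<^sup>2)"
       "integrable \<T> (\<lambda>x. (g s x)\<^sup>2)" "integrable \<T> (\<lambda>x. (g t x)\<^sup>2)"
      using f g s t by (auto simp: L2_path_def)
    have i1: "integrable \<T> (\<lambda>x. f s x * g s x * \<phi> x)" "integrable \<T> (\<lambda>x. f t x * g t x * \<phi> x)"
      by (rule integrable_mult_square[OF m(1,3) \<phi> i(1,3) B], rule integrable_mult_square[OF m(2,4) \<phi> i(2,4) B])
    have i2: "integrable \<T> (\<lambda>x. (f s x - f t x)\<^sup>2)" "integrable \<T> (\<lambda>x. (g s x - g t x)\<^sup>2)"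
      by (intro integrable_diff_square m i)+
    have "\<bar>(\<integral>x. f s x * g s x * \<phi> x \<partial>\<T>) - (\<integral>x. f t x * g t x * \<phi> x \<partial>\<T>)\<bar>
       = norm (\<integral>x. f s x * g s x * \<phi> x - f t x * g t x * \<phi> x \<partial>\<T>)"
      using i1 by simp
    also have "\<dots> \<le> (\<integral>x. B * ((1 + 1 / \<epsilon>) * ((f s x - f t x)\<^sup>2 + (g s x - g t x)\<^sup>2) + \<epsilon> * ((f t x)\<^sup>2 + (g t x)\<^sup>2)) \<partial>\<T>)"
    proof (rule Bochner_Integration.integral_norm_bound_integral)
      fix x
      have "\<bar>\<phi> x\<bar> * \<bar>f s x * g s x - f t x * g t x\<bar>
        \<le> B * ((1 + 1 / \<epsilon>) * ((f s x - f t x)\<^sup>2 + (g s x - g t x)\<^sup>2) + \<epsilon> * ((f t x)\<^sup>2 + (g t x)\<^sup>2))"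
        by (intro mult_mono B product_increment_le \<epsilon> B0) auto
      then show "norm (f s x * g s x * \<phi> x - f t x * g t x * \<phi> x)
        \<le> B * ((1 + 1 / \<epsilon>) * ((f s x - f t x)\<^sup>2 + (g s x - g t x)\<^sup>2) + \<epsilon> * ((f t x)\<^sup>2 + (g t x)\<^sup>2))"
        by (simp add: abs_mult[symmetric] algebra_simps)
    qed (use i i1 i2 in auto)
    also have "\<dots> = B * ((1 + 1 / \<epsilon>) * \<delta> s + \<epsilon> * A)"
      using i i2 by (simp add: \<delta>_def A_def)
    finally show ?thesis .
  qed
  show "((\<lambda>t. \<integral>x. f t x * g t x * \<phi> x \<partial>\<T>) \<longlongrightarrow> (\<integral>x. f t x * g t x * \<phi> x \<partial>\<T>)) (at t within {0..<T})"
  proof (rule tendstoI)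
    fix e :: real assume e: "0 < e"
    \<comment> \<open>Chosen so that \<open>B * (\<epsilon> * A)\<close> is at most e/2; the summand
      1 keeps the denominator positive when B or A vanishes.\<close>
    define \<epsilon> where "\<epsilon> = e / (2 * (B * A + 1))"
    have BA: "0 < B * A + 1" using B0 A by (simp add: add_nonneg_pos)
    then have \<epsilon>: "0 < \<epsilon>" using e by (simp add: \<epsilon>_def)
    have small: "B * (\<epsilon> * A) \<le> e / 2"
    proof -
      have "\<epsilon> * (B * A) \<le> \<epsilon> * (B * A + 1)" using \<epsilon> by (intro mult_left_mono) auto
      also have "\<dots> = e / 2" using BA by (simp add: \<epsilon>_def field_simps)
      finally show ?thesis by (simp add: mult_ac)
    qed

    have "((\<lambda>s. B * ((1 + 1 / \<epsilon>) * \<delta> s)) \<longlongrightarrow> B * ((1 + 1 / \<epsilon>) * 0)) (at t within {0..<T})"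
      by (intro tendsto_intros \<delta>)
    then have "\<forall>\<^sub>F s in at t within {0..<T}. B * ((1 + 1 / \<epsilon>) * \<delta> s) < e / 2"
      using e by (intro order_tendstoD(2)) auto
    moreover have "\<forall>\<^sub>F s in at t within {0..<T}. s \<in> {0..<T}"
      by (simp add: eventually_at_filter)
    ultimately show "\<forall>\<^sub>F s in at t within {0..<T}. dist (\<integral>x. f s x * g s x * \<phi> x \<partial>\<T>) (\<integral>x. f t x * g t x * \<phi> x \<partial>\<T>) < e"
    proof eventually_elim
      case (elim s)
      then show ?case using bound[OF elim(2) \<epsilon>] small unfolding dist_real_def distrib_left by linarith
    qed
  qed
qed

lemma L2_path_const1: "L2_path T (\<lambda>_ _. 1)"
  by (simp add: L2_path_def)

lemma L2_path_continuous:
  assumes f: "L2_path T f" and \<phi>: "\<phi> \<in> borel_measurable borel" "\<And>x. \<bar>\<phi> x\<bar> \<le> B"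
  shows "continuous_on {0..<T} (\<lambda>t. \<integral>x. f t x * \<phi> x \<partial>\<T>)"
  using L2_path_mult_continuous[OF f L2_path_const1 \<phi>] by simp

text \<open>The estimates of increments swap integrals over two points of the torus, which needs joint
  measurability; Lebesgue measurable functions are therefore replaced by Borel representatives.\<close>

definition represents :: "real \<Rightarrow> (real \<Rightarrow> real ^ 'n \<Rightarrow> real ^ 'm) \<Rightarrow> (real \<Rightarrow> real ^ 'n \<Rightarrow> real ^ 'm) \<Rightarrow> bool" where
  "represents T u U \<longleftrightarrow> (\<forall>t\<in>{0..<T}. U t \<in> borel_measurable borel \<and> torus_periodic (U t) \<and> (AE x in lebesgue. u t x = U t x))"

lemma ex_represents:
  fixes u :: "real \<Rightarrow> real ^ 'n \<Rightarrow> real ^ 'm"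
  assumes "continuous_torus_L2 T u"
  shows "\<exists>U. represents T u U"
proof -
  have "\<exists>g. g \<in> borel_measurable borel \<and> torus_periodic g \<and> (AE x in lebesgue. u t x = g x)" if "t \<in> {0..<T}" for t
    by (rule torus_borel_representative) (use assms that in \<open>auto simp: continuous_torus_L2_def torus_Lp_def\<close>)
  then have "\<forall>t\<in>{0..<T}. \<exists>g. g \<in> borel_measurable borel \<and> torus_periodic g \<and> (AE x in lebesgue. u t x = g x)" by blast
  from bchoice[OF this] show ?thesis unfolding represents_def .
qed

lemma L2_path_component:
  fixes u U :: "real \<Rightarrow> real ^ 'n \<Rightarrow> real ^ 'm"
  assumes u: "continuous_torus_L2 T u" and U: "represents T u U"
  shows "L2_path T (\<lambda>t x. U t x $ i)"
  unfolding L2_path_def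
proof (intro ballI conjI)
  fix t assume t: "t \<in> {0..<T}"
  have Um: "U s \<in> borel_measurable borel" "AE x in lebesgue. u s x = U s x" if "s \<in> {0..<T}" for s
    using U that by (auto simp: represents_def)
  have nth: "(\<lambda>x. V x $ i) \<in> borel_measurable borel" if "V \<in> borel_measurable borel" for V :: "real ^ 'n \<Rightarrow> real ^ 'm"
    using that by (rule measurable_compose) (simp add: borel_measurable_continuous_onI continuous_on_component)
  note [measurable] = Um(1)
  show "(\<lambda>x. U t x $ i) \<in> borel_measurable borel" by (rule nth[OF Um(1)[OF t]])
  have le: "(y $ i)\<^sup>2 \<le> (norm y)\<^sup>2" for y :: "real ^ 'm"
    using component_le_norm_cart[of y i] by (simp add: abs_le_square_iff[symmetric])
  have i1: "integrable \<T> (\<lambda>x. (norm (U s x))\<^sup>2)" if s: "s \<in> {0..<T}" for s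
  proof (rule integrable_torus_measure_AE)
    show "set_integrable lebesgue torus_cell (\<lambda>x. norm (u s x) powr 2)"
      using u s by (simp add: continuous_torus_L2_def torus_Lp_def)
    show "AE x in lebesgue. norm (u s x) powr 2 = (norm (U s x))\<^sup>2" using Um(2)[OF s] by (auto elim: eventually_mono)
  qed (use Um(1)[OF s] in measurable)
  have i1': "integrable \<T> (\<lambda>x. (U s x $ i)\<^sup>2)" if s: "s \<in> {0..<T}" for s
    by (rule Bochner_Integration.integrable_bound[OF i1[OF s]]) (use le nth[OF Um(1)[OF s]] in auto)
  show "integrable \<T> (\<lambda>x. (U t x $ i)\<^sup>2)" by (rule i1'[OF t])
  have "((\<lambda>s. torus_Lp_norm 2 (\<lambda>x. u s x - u t x)) \<longlongrightarrow> 0) (at t within {0..<T})"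
    using u t by (simp add: continuous_torus_L2_def)
  then have lim: "((\<lambda>s. (torus_Lp_norm 2 (\<lambda>x. u s x - u t x))\<^sup>2) \<longlongrightarrow> 0) (at t within {0..<T})"
    using tendsto_power[of _ 0 _ 2] by fastforce
  have bd: "(\<integral>x. (U s x $ i - U t x $ i)\<^sup>2 \<partial>\<T>) \<le> (torus_Lp_norm 2 (\<lambda>x. u s x - u t x))\<^sup>2" if s: "s \<in> {0..<T}" for s
  proof -
    have [measurable]: "U s \<in> borel_measurable borel" "U t \<in> borel_measurable borel" using Um s t by auto
    have i2: "integrable \<T> (\<lambda>x. (norm (U s x - U t x))\<^sup>2)"
    proof (rule Bochner_Integration.integrable_bound)
      show "integrable \<T> (\<lambda>x. 2 * (norm (U s x))\<^sup>2 + 2 * (norm (U t x))\<^sup>2)" using i1[OF s] i1[OF t] by simp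
      have "(norm (y - z))\<^sup>2 \<le> 2 * (norm y)\<^sup>2 + 2 * (norm z)\<^sup>2" for y z :: "real ^ 'm"
      proof -
        have "(norm (y - z))\<^sup>2 \<le> (norm y + norm z)\<^sup>2" by (intro power_mono norm_triangle_ineq4) auto
        also have "\<dots> \<le> 2 * (norm y)\<^sup>2 + 2 * (norm z)\<^sup>2"
          using sum_squares_bound[of "norm y" "norm z"] by (simp add: power2_sum)
        finally show ?thesis .
      qed
      then show "AE x in \<T>. norm ((norm (U s x - U t x))\<^sup>2) \<le> norm (2 * (norm (U s x))\<^sup>2 + 2 * (norm (U t x))\<^sup>2)"
        by simp
    qed measurable
    have "(\<integral>x. (U s x $ i - U t x $ i)\<^sup>2 \<partial>\<T>) \<le> (\<integral>x. (norm (U s x - U t x))\<^sup>2 \<partial>\<T>)"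
      using le[of "U s x - U t x" for x] i2 by (intro integral_mono_AE') auto
    also have "\<dots> = (LINT x:torus_cell|lebesgue. norm (u s x - u t x) powr 2)"
    proof (rule integral_torus_measure_AE[symmetric])
      show "AE x in lebesgue. norm (u s x - u t x) powr 2 = (norm (U s x - U t x))\<^sup>2"
        using Um(2)[OF s] Um(2)[OF t] by eventually_elim simp
    qed measurable
    also have "\<dots> = (torus_Lp_norm 2 (\<lambda>x. u s x - u t x))\<^sup>2"
    proof -
      have "0 \<le> (LINT x:torus_cell|lebesgue. norm (u s x - u t x) powr 2)"
        unfolding set_lebesgue_integral_def by (intro integral_nonneg_AE) auto
      then show ?thesis unfolding torus_Lp_norm_def by (simp add: powr_half_sqrt)
    qed
    finally show ?thesis .
  qed
  show "((\<lambda>s. \<integral>x. (U s x $ i - U t x $ i)\<^sup>2 \<partial>\<T>) \<longlongrightarrow> 0) (at t within {0..<T})"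
  proof (rule tendsto_sandwich[OF _ _ tendsto_const lim])
    show "\<forall>\<^sub>F s in at t within {0..<T}. 0 \<le> (\<integral>x. (U s x $ i - U t x $ i)\<^sup>2 \<partial>\<T>)"
      by (intro always_eventually allI integral_nonneg_AE) auto
    show "\<forall>\<^sub>F s in at t within {0..<T}. (\<integral>x. (U s x $ i - U t x $ i)\<^sup>2 \<partial>\<T>) \<le> (torus_Lp_norm 2 (\<lambda>x. u s x - u t x))\<^sup>2"
      using bd by (simp add: eventually_at_filter)
  qed
qed

subsection \<open>Test functions that are constant in time up to a cutoff\<close>

text \<open>The simplest C^1 function that is zero on the negative axis and positive on the positive
  one; it is the building block of the time cutoff.\<close>

definition pos_sq :: "real \<Rightarrow> real" where "pos_sq s = (max 0 s)\<^sup>2"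

lemma DERIV_pos_sq: "(pos_sq has_real_derivative 2 * max 0 s) (at s)"
proof -
  consider "s < 0" | "s = 0" | "0 < s" by linarith
  then show ?thesis
  proof cases
    case 1
    have "((\<lambda>_. 0) has_real_derivative 2 * max 0 s) (at s)" using 1 by simp
    then show ?thesis
      by (rule has_field_derivative_transform_within_open[of _ _ _ "{..<0}"]) (use 1 in \<open>auto simp: pos_sq_def\<close>)
  next
    case 2
    have "((\<lambda>h. pos_sq h / h) \<longlongrightarrow> 0) (at 0)"
    proof (rule Lim_null_comparison)
      show "\<forall>\<^sub>F h in at 0. norm (pos_sq h / h) \<le> \<bar>h\<bar>"
        by (intro always_eventually allI) (auto simp: pos_sq_def max_def power2_eq_square)
      show "((\<lambda>h::real. \<bar>h\<bar>) \<longlongrightarrow> 0) (at 0)" by (auto intro!: tendsto_eq_intros)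
    qed
    then show ?thesis using 2 by (simp add: has_field_derivative_iff pos_sq_def)
  next
    case 3
    have "((\<lambda>s. s\<^sup>2) has_real_derivative 2 * max 0 s) (at s)" using 3 by (auto intro!: derivative_eq_intros)
    then show ?thesis
      by (rule has_field_derivative_transform_within_open[of _ _ _ "{0<..}"]) (use 3 in \<open>auto simp: pos_sq_def\<close>)
  qed
qed

text \<open>The cutoff is \<open>pos_sq (1 - pos_sq (t - a) / (b - a)\<^sup>2)\<close>: C^1,
  constant up to a, and zero once t - a \<ge> b - a. Its derivative vanishes at a itself too, so
  that on a time interval ending at a it acts as the constant 1.\<close>

lemma ex_time_cutoff:
  assumes "a < (b :: real)"
  shows "\<exists>\<eta> \<eta>'. (\<forall>t. (\<eta> has_real_derivative \<eta>' t) (at t)) \<and> continuous_on UNIV \<eta>' \<and>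
     (\<forall>t\<le>a. \<eta> t = 1 \<and> \<eta>' t = 0) \<and> (\<forall>t\<ge>b. \<eta> t = 0)"
proof -
  define c where "c = 1 / (b - a)\<^sup>2"
  define \<eta> where "\<eta> t = pos_sq (1 - c * pos_sq (t - a))" for t
  define \<eta>' where "\<eta>' t = 2 * max 0 (1 - c * pos_sq (t - a)) * (- (c * (2 * max 0 (t - a))))" for t
  have "(\<eta> has_real_derivative \<eta>' t) (at t)" for t
    unfolding \<eta>_def[abs_def] \<eta>'_def
    by (rule DERIV_chain2[OF DERIV_pos_sq]) (auto intro!: derivative_eq_intros DERIV_chain2[OF DERIV_pos_sq])
  moreover have "continuous_on UNIV \<eta>'"
    unfolding \<eta>'_def[abs_def] pos_sq_def by (intro continuous_intros)
  moreover have "\<eta> t = 1 \<and> \<eta>' t = 0" if "t \<le> a" for t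
    using that by (simp add: \<eta>_def \<eta>'_def pos_sq_def max_def)
  moreover have "\<eta> t = 0" if "b \<le> t" for t
  proof -
    have "(b - a)\<^sup>2 \<le> pos_sq (t - a)" using that assms by (auto simp: pos_sq_def intro!: power_mono)
    then have "1 \<le> c * pos_sq (t - a)" using assms by (simp add: c_def field_simps)
    then show ?thesis by (simp add: \<eta>_def pos_sq_def)
  qed
  ultimately show ?thesis by blast
qed

lemma C1_test_product:
  fixes \<phi> :: "real ^ 'n \<Rightarrow> 'b::real_normed_vector" and \<phi>' :: "'n \<Rightarrow> real ^ 'n \<Rightarrow> 'b"
  assumes \<eta>: "\<And>t. (\<eta> has_real_derivative \<eta>' t) (at t)" "continuous_on UNIV \<eta>'" "\<And>t. b \<le> t \<Longrightarrow> \<eta> t = 0"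
    and b: "0 \<le> b" "b < T"
    and \<phi>: "\<And>x. (\<phi> has_derivative (\<lambda>h. \<Sum>j\<in>UNIV. h $ j *\<^sub>R \<phi>' j x)) (at x)" "\<And>j. continuous_on UNIV (\<phi>' j)"
    and per: "torus_periodic \<phi>"
  shows "C1_test T (\<lambda>t x. \<eta> t *\<^sub>R \<phi> x)"
proof -
  define f' where "f' z h = (\<eta>' (fst z) * fst h) *\<^sub>R \<phi> (snd z) + \<eta> (fst z) *\<^sub>R (\<Sum>j\<in>UNIV. snd h $ j *\<^sub>R \<phi>' j (snd z))"
    for z h :: "real \<times> (real ^ 'n)"
  have d: "((\<lambda>z. \<eta> (fst z) *\<^sub>R \<phi> (snd z)) has_derivative f' z) (at z)" for z :: "real \<times> (real ^ 'n)"
  proof -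
    have "((\<lambda>z :: real \<times> (real ^ 'n). \<eta> (fst z)) has_derivative (\<lambda>h. \<eta>' (fst z) * fst h)) (at z)"
      by (rule has_derivative_compose[OF has_derivative_fst[OF has_derivative_ident] \<eta>(1)[unfolded has_field_derivative_def]])
    moreover have "((\<lambda>z :: real \<times> (real ^ 'n). \<phi> (snd z)) has_derivative (\<lambda>h. \<Sum>j\<in>UNIV. snd h $ j *\<^sub>R \<phi>' j (snd z))) (at z)"
      by (rule has_derivative_compose[OF has_derivative_snd[OF has_derivative_ident] \<phi>(1)])
    ultimately show ?thesis
      unfolding f'_def[abs_def] by (auto intro!: derivative_eq_intros simp: add.commute)
  qed
  have bl: "bounded_linear (f' z)" for z by (rule has_derivative_bounded_linear[OF d])
  have c\<eta>: "continuous_on UNIV \<eta>" by (rule DERIV_continuous_on) (use \<eta>(1) in \<open>auto intro: has_field_derivative_at_within\<close>)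
  have c\<phi>: "continuous_on UNIV \<phi>"
    using \<phi>(1) by (meson has_derivative_continuous continuous_at_imp_continuous_on)
  have comp: "continuous_on A (\<lambda>z. g (fst z))" if "continuous_on UNIV g" for g :: "real \<Rightarrow> 'c::topological_space" and A :: "(real \<times> (real ^ 'n)) set"
    by (rule continuous_on_compose2[OF that]) (auto intro!: continuous_intros)
  have comp2: "continuous_on A (\<lambda>z. g (snd z))" if "continuous_on UNIV g" for g :: "real ^ 'n \<Rightarrow> 'c::topological_space" and A :: "(real \<times> (real ^ 'n)) set"
    by (rule continuous_on_compose2[OF that]) (auto intro!: continuous_intros)
  have "C1_on ({0..<T} \<times> UNIV) (\<lambda>(t, x). \<eta> t *\<^sub>R \<phi> x)"
    unfolding C1_on_def
  proof (intro exI[of _ "\<lambda>z. Blinfun (f' z)"] conjI ballI)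
    fix z
    show "((\<lambda>(t, x). \<eta> t *\<^sub>R \<phi> x) has_derivative blinfun_apply (Blinfun (f' z))) (at z within {0..<T} \<times> UNIV)"
      unfolding bounded_linear_Blinfun_apply[OF bl] case_prod_beta by (rule has_derivative_at_withinI[OF d])
    \<comment> \<open>On a finite-dimensional domain, continuity of the derivative in operator norm
      is continuity in each fixed direction.\<close>
    show "continuous_on ({0..<T} \<times> UNIV) (\<lambda>z. Blinfun (f' z))"
    proof (rule continuous_on_blinfun_componentwise)
      fix h :: "real \<times> (real ^ 'n)"
      show "continuous_on ({0..<T} \<times> UNIV) (\<lambda>z. blinfun_apply (Blinfun (f' z)) h)"
        unfolding bounded_linear_Blinfun_apply[OF bl] f'_def
        by (intro continuous_intros comp comp2 \<eta>(2) c\<eta> c\<phi> \<phi>(2))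
    qed
  qed
  moreover have "torus_periodic (\<lambda>x. \<eta> t *\<^sub>R \<phi> x)" for t using per by (simp add: torus_periodic_def)
  moreover have "\<exists>T'\<in>{0..<T}. \<forall>t\<in>{T'<..<T}. \<forall>x. \<eta> t *\<^sub>R \<phi> x = 0"
    using \<eta>(3) b by (intro bexI[of _ b]) auto
  ultimately show ?thesis by (simp add: C1_test_def)
qed

text \<open>Guarantees uniqueness of the derivative in \<open>partial_t\<close>, including the
  one-sided one at t = 0.\<close>

lemma at_within_Ico_not_bot:
  assumes "t \<in> {0..<T::real}"
  shows "at t within {0..<T} \<noteq> bot"
proof -
  have "t islimpt {t<..<T}" using assms by (intro islimpt_greaterThanLessThan1) auto
  then have "t islimpt {0..<T}" by (rule islimpt_subset) (use assms in auto)
  then show ?thesis by (simp add: trivial_limit_within)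
qed

subsection \<open>The weak formulation for trigonometric test functions\<close>

text \<open>Turns the time integrals of the weak formulation into Henstock-Kurzweil integrals.
  Measurability of F comes from the continuous function G with which it coincides on the
  interval.\<close>

lemma lebesgue_integral_Icc_eq:
  fixes F G :: "real \<Rightarrow> real"
  assumes "continuous_on {a..b} G" and "\<And>t. t \<in> {a..b} \<Longrightarrow> F t = G t"
  shows "(LINT t:{a..b}|lebesgue. F t) = integral {a..b} G"
proof -
  have "(LINT t:{a..b}|lebesgue. F t) = (LINT t:{a..b}|lebesgue. G t)"
    unfolding set_lebesgue_integral_def
    by (rule Bochner_Integration.integral_cong[OF refl]) (use assms(2) in \<open>auto simp: indicator_def\<close>)
  then show ?thesis
    using set_lebesgue_integral_eq_integral(2)[OF absolutely_integrable_continuous_real[OF assms(1)]] by simp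
qed

text \<open>The primitive of G vanishes identically, hence so does its derivative. Passing to a
  closed interval \<open>{0..b}\<close> with t < b < T makes the one-sided derivative at 0
  unique.\<close>

lemma zero_if_integrals_zero:
  fixes G :: "real \<Rightarrow> real"
  assumes cont: "continuous_on {0..<T} G" and zero: "\<And>\<tau>. 0 < \<tau> \<Longrightarrow> \<tau> < T \<Longrightarrow> integral {0..\<tau>} G = 0"
    and t: "t \<in> {0..<T}"
  shows "G t = 0"
proof -
  obtain b where b: "t < b" "b < T" using t dense[of t T] by auto
  have "((\<lambda>x. integral {0..x} G) has_real_derivative G t) (at t within {0..b})"
    by (rule integral_has_real_derivative) (use t b in \<open>auto intro: continuous_on_subset[OF cont]\<close>)
  then have "((\<lambda>x. 0) has_real_derivative G t) (at t within {0..b})"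
  proof (rule has_field_derivative_transform_within[OF _ zero_less_one])
    show "t \<in> {0..b}" using t b by auto
    show "integral {0..x} G = 0" if "x \<in> {0..b}" for x
      using zero[of x] that b by (cases "x = 0") auto
  qed
  then have "((\<lambda>x. 0 :: real) has_vector_derivative G t) (at t within {0..b})"
    by (simp add: has_real_derivative_iff_has_vector_derivative)
  moreover have "((\<lambda>x. 0 :: real) has_vector_derivative 0) (at t within {0..b})" by simp
  ultimately show ?thesis
    using vector_derivative_unique_within_closed_interval[of 0 b t "\<lambda>_. 0" "G t" 0] t b by auto
qed

lemma borel_measurable_vec_nth_comp:
  fixes V :: "'a \<Rightarrow> real ^ 'm"
  assumes "V \<in> borel_measurable M"
  shows "(\<lambda>x. V x $ i) \<in> borel_measurable M"
  using assms by (rule measurable_compose) (simp add: borel_measurable_continuous_onI continuous_on_component)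

lemma represents_component:
  assumes "represents T u U" "t \<in> {0..<T}"
  shows "U t \<in> borel_measurable borel" "(\<lambda>x. U t x $ i) \<in> borel_measurable borel" "AE x in lebesgue. u t x = U t x"
    "torus_periodic (U t)"
  using assms by (auto simp: represents_def intro: borel_measurable_vec_nth_comp)

lemma L2_path_integrable:
  assumes "L2_path T f" "L2_path T g" "t \<in> {0..<T}"
  shows "integrable \<T> (f t)" "integrable \<T> (\<lambda>x. f t x * g t x)"
proof -
  have 1: "integrable \<T> (\<lambda>x. f t x * h x * 1)"
    if "h \<in> borel_measurable borel" "integrable \<T> (\<lambda>x. (h x)\<^sup>2)" for h
    by (rule integrable_mult_square[where B = 1]) (use assms that in \<open>auto simp: L2_path_def\<close>)
  show "integrable \<T> (f t)" using 1[of "\<lambda>_. 1"] by simp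
  show "integrable \<T> (\<lambda>x. f t x * g t x)" using 1[of "g t"] assms by (simp add: L2_path_def)
qed

lemma L2_path_trig_continuous:
  assumes f: "L2_path T f" and g: "L2_path T g" and \<phi>: "trig_poly \<phi>"
  shows "continuous_on {0..<T} (\<lambda>t. \<integral>x. f t x * \<phi> x \<partial>\<T>)"
    and "continuous_on {0..<T} (\<lambda>t. \<integral>x. f t x * g t x * \<phi> x \<partial>\<T>)"
proof -
  obtain B where B: "\<And>x. \<bar>\<phi> x\<bar> \<le> B" using trig_poly_bounded[OF \<phi>] by blast
  show "continuous_on {0..<T} (\<lambda>t. \<integral>x. f t x * \<phi> x \<partial>\<T>)"
    by (rule L2_path_continuous[OF f trig_poly_borel[OF \<phi>] B])
  show "continuous_on {0..<T} (\<lambda>t. \<integral>x. f t x * g t x * \<phi> x \<partial>\<T>)"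
    by (rule L2_path_mult_continuous[OF f g trig_poly_borel[OF \<phi>] B])
qed

lemma integrable_mult_trig_poly:
  "trig_poly a \<Longrightarrow> integrable \<T> f \<Longrightarrow> integrable \<T> (\<lambda>x. f x * a x)"
  using integrable_trig_poly_mult[of a f] by (simp add: mult.commute)

lemma partial_x_scaleR:
  fixes \<phi> :: "real ^ 'n \<Rightarrow> 'b::real_normed_vector"
  assumes "(\<phi> has_derivative (\<lambda>h. \<Sum>j\<in>UNIV. h $ j *\<^sub>R \<phi>' j)) (at x)"
  shows "partial_x j (\<lambda>x. c *\<^sub>R \<phi> x) x = c *\<^sub>R \<phi>' j"
proof (rule partial_x_unique)
  have "((\<lambda>x. c *\<^sub>R \<phi> x) has_derivative (\<lambda>h. c *\<^sub>R (\<Sum>j\<in>UNIV. h $ j *\<^sub>R \<phi>' j))) (at x)"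
    by (rule has_derivative_scaleR_right[OF assms])
  then show "((\<lambda>x. c *\<^sub>R \<phi> x) has_derivative (\<lambda>h. \<Sum>j\<in>UNIV. h $ j *\<^sub>R c *\<^sub>R \<phi>' j)) (at x)"
    by (simp add: scaleR_sum_right mult.commute)
qed

text \<open>The incompressibility condition is integrated in time. A spatial test function times a
  cutoff equal to 1 on \<open>{0..\<tau>}\<close> shows that all integrals over such intervals
  vanish; as the integrand is continuous in time, it vanishes at every t.\<close>

lemma weakly_div_free_solution:
  fixes u U :: "real \<Rightarrow> real ^ 'n \<Rightarrow> real ^ 'n"
  assumes u: "continuous_torus_L2 T u" and U: "represents T u U" and inc: "euler_incompressible T u"
    and t: "t \<in> {0..<T}"
  shows "weakly_div_free (U t)"
  unfolding weakly_div_free_def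
proof (intro allI impI)
  fix \<phi> :: "real ^ 'n \<Rightarrow> real" assume \<phi>: "trig_poly \<phi>"
  note path = L2_path_component[OF u U]
  have d\<phi>: "(\<phi> has_derivative (\<lambda>h. \<Sum>j\<in>UNIV. h $ j *\<^sub>R partial_x j \<phi> x)) (at x)" for x
    using trig_poly_has_derivative[OF \<phi>, of x] by (simp add: mult.commute)
  define G where "G t = (\<Sum>j\<in>UNIV. \<integral>x. U t x $ j * partial_x j \<phi> x \<partial>\<T>)" for t
  have cont: "continuous_on {0..<T} G"
    unfolding G_def by (intro continuous_on_sum L2_path_trig_continuous(1)[OF path path] trig_poly_partial_x \<phi>)
  have "integral {0..\<tau>} G = 0" if \<tau>: "0 < \<tau>" "\<tau> < T" for \<tau>
  proof -
    define b where "b = (\<tau> + T) / 2"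
    have b: "\<tau> < b" "0 \<le> b" "b < T" using \<tau> by (auto simp: b_def)
    obtain \<eta> \<eta>' where \<eta>: "\<And>t. (\<eta> has_real_derivative \<eta>' t) (at t)" "continuous_on UNIV \<eta>'"
      "\<And>t. t \<le> \<tau> \<Longrightarrow> \<eta> t = 1" "\<And>t. b \<le> t \<Longrightarrow> \<eta> t = 0"
      using ex_time_cutoff[OF b(1)] by blast
    have "C1_test T (\<lambda>t x. \<eta> t *\<^sub>R \<phi> x)"
      using trig_poly_continuous[OF trig_poly_partial_x[OF \<phi>]] trig_poly_periodic[OF \<phi>]
      by (intro C1_test_product[OF \<eta>(1,2,4) b(2,3) d\<phi>]) auto
    then have "0 = (LINT t:{0..\<tau>}|lebesgue. LINT x:torus_cell|lebesgue.
            (\<Sum>j\<in>UNIV. u t x $ j * partial_x j (\<lambda>x. \<eta> t *\<^sub>R \<phi> x) x))"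
      using inc \<tau> unfolding euler_incompressible_def by simp
    also have "\<dots> = integral {0..\<tau>} G"
    proof (rule lebesgue_integral_Icc_eq)
      show "continuous_on {0..\<tau>} G" by (rule continuous_on_subset[OF cont]) (use \<tau> in auto)
      fix t assume t: "t \<in> {0..\<tau>}"
      then have t': "t \<in> {0..<T}" using \<tau> by auto
      have [measurable]: "(\<lambda>x. U t x $ j) \<in> borel_measurable borel" "partial_x j \<phi> \<in> borel_measurable borel" for j
        using represents_component(2)[OF U t'] trig_poly_borel[OF trig_poly_partial_x[OF \<phi>]] by auto
      have "(LINT x:torus_cell|lebesgue. (\<Sum>j\<in>UNIV. u t x $ j * partial_x j (\<lambda>x. \<eta> t *\<^sub>R \<phi> x) x))
          = (\<integral>x. (\<Sum>j\<in>UNIV. U t x $ j * partial_x j \<phi> x) \<partial>\<T>)"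
      proof (rule integral_torus_measure_AE)
        show "AE x in lebesgue. (\<Sum>j\<in>UNIV. u t x $ j * partial_x j (\<lambda>x. \<eta> t *\<^sub>R \<phi> x) x) = (\<Sum>j\<in>UNIV. U t x $ j * partial_x j \<phi> x)"
          using represents_component(3)[OF U t']
          by eventually_elim (use t \<eta>(3) in \<open>simp add: partial_x_scaleR[OF d\<phi>]\<close>)
      qed measurable
      also have "\<dots> = G t"
        unfolding G_def by (intro Bochner_Integration.integral_sum integrable_mult_trig_poly trig_poly_partial_x \<phi> L2_path_integrable(1)[OF path path t'])
      finally show "(LINT x:torus_cell|lebesgue. (\<Sum>j\<in>UNIV. u t x $ j * partial_x j (\<lambda>x. \<eta> t *\<^sub>R \<phi> x) x)) = G t" .
    qed
    finally show ?thesis by simp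
  qed
  from zero_if_integrals_zero[OF cont this t]
  show "(\<Sum>j\<in>UNIV. \<integral>x. U t x $ j * partial_x j \<phi> x \<partial>\<T>) = 0" by (simp add: G_def)
qed

lemma vec_trig_poly_has_derivative:
  fixes \<phi> :: "real ^ 'n \<Rightarrow> real ^ 'm"
  assumes \<phi>: "\<And>i. trig_poly (\<lambda>x. \<phi> x $ i)"
  shows "(\<phi> has_derivative (\<lambda>h. \<Sum>j\<in>UNIV. h $ j *\<^sub>R (\<chi> i. partial_x j (\<lambda>x. \<phi> x $ i) x))) (at x)"
proof (subst has_derivative_componentwise_within, intro ballI)
  fix e :: "real ^ 'm" assume "e \<in> Basis"
  then obtain i where e: "e = axis i 1" by (auto simp: Basis_vec_def)
  show "((\<lambda>x. \<phi> x \<bullet> e) has_derivative (\<lambda>h. (\<Sum>j\<in>UNIV. h $ j *\<^sub>R (\<chi> i. partial_x j (\<lambda>x. \<phi> x $ i) x)) \<bullet> e)) (at x)"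
    using trig_poly_has_derivative[OF \<phi>[of i], of x] by (simp add: e inner_axis mult.commute)
qed

text \<open>Test functions have to vanish near T, so \<phi> is multiplied by a cutoff that is 1 up
  to t and 0 from the midpoint of t and T on. On \<open>{s..t}\<close> the time derivative of the
  product is zero and only the flux remains.\<close>

lemma weak_momentum:
  fixes u U :: "real \<Rightarrow> real ^ 'n \<Rightarrow> real ^ 'n"
  assumes u: "continuous_torus_L2 T u" and U: "represents T u U" and mom: "euler_momentum T u"
    and \<phi>: "\<And>i. trig_poly (\<lambda>x. \<phi> x $ i)" and div: "\<And>x. (\<Sum>i\<in>UNIV. partial_x i (\<lambda>x. \<phi> x $ i) x) = 0"
    and st: "0 \<le> s" "s \<le> t" "t < T"
  shows "(\<Sum>i\<in>UNIV. \<integral>x. U t x $ i * \<phi> x $ i \<partial>\<T>) - (\<Sum>i\<in>UNIV. \<integral>x. U s x $ i * \<phi> x $ i \<partial>\<T>)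
    = integral {s..t} (\<lambda>r. \<Sum>i\<in>UNIV. \<Sum>j\<in>UNIV. \<integral>x. U r x $ i * U r x $ j * partial_x j (\<lambda>x. \<phi> x $ i) x \<partial>\<T>)"
proof (cases "s = t")
  case False
  then have st': "s < t" using st by simp
  note path = L2_path_component[OF u U]
  define \<phi>' where "\<phi>' j x = (\<chi> i. partial_x j (\<lambda>x. \<phi> x $ i) x)" for j x
  have d\<phi>: "(\<phi> has_derivative (\<lambda>h. \<Sum>j\<in>UNIV. h $ j *\<^sub>R \<phi>' j x)) (at x)" for x
    unfolding \<phi>'_def by (rule vec_trig_poly_has_derivative[OF \<phi>])
  define G where "G r = (\<Sum>i\<in>UNIV. \<Sum>j\<in>UNIV. \<integral>x. U r x $ i * U r x $ j * partial_x j (\<lambda>x. \<phi> x $ i) x \<partial>\<T>)" for r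
  have cont: "continuous_on {0..<T} G"
    unfolding G_def by (intro continuous_on_sum L2_path_trig_continuous(2)[OF path path] trig_poly_partial_x \<phi>)
  define b where "b = (t + T) / 2"
  have b: "t < b" "0 \<le> b" "b < T" using st by (auto simp: b_def)
  obtain \<eta> \<eta>' where \<eta>: "\<And>t. (\<eta> has_real_derivative \<eta>' t) (at t)" "continuous_on UNIV \<eta>'"
    "\<And>r. r \<le> t \<Longrightarrow> \<eta> r = 1" "\<And>r. r \<le> t \<Longrightarrow> \<eta>' r = 0" "\<And>t. b \<le> t \<Longrightarrow> \<eta> t = 0"
    using ex_time_cutoff[OF b(1)] by blast
  let ?\<psi> = "\<lambda>t x. \<eta> t *\<^sub>R \<phi> x"
  have "C1_test T ?\<psi>"
  proof (rule C1_test_product[OF \<eta>(1,2,5) b(2,3) d\<phi>])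
    show "continuous_on UNIV (\<phi>' j)" for j
      unfolding \<phi>'_def by (intro continuous_on_vec_lambda trig_poly_continuous trig_poly_partial_x \<phi>)
    show "torus_periodic \<phi>"
      using trig_poly_periodic[OF \<phi>] by (auto simp: torus_periodic_def vec_eq_iff)
  qed
  moreover have "div_free T ?\<psi>"
    unfolding div_free_def using div by (simp add: partial_x_scaleR[OF d\<phi>] \<phi>'_def sum_distrib_left[symmetric])
  ultimately have eq: "(LINT r:{s..t}|lebesgue. LINT x:torus_cell|lebesgue.
            u r x \<bullet> partial_t T ?\<psi> r x
            + (\<Sum>i\<in>UNIV. \<Sum>j\<in>UNIV. u r x $ i * u r x $ j * partial_x j (?\<psi> r) x $ i))
        = (LINT x:torus_cell|lebesgue. u t x \<bullet> ?\<psi> t x) - (LINT x:torus_cell|lebesgue. u s x \<bullet> ?\<psi> s x)"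
    using mom st st' unfolding euler_momentum_def by blast
  have [measurable]: "(\<lambda>x. \<phi> x $ i) \<in> borel_measurable borel" "partial_x j (\<lambda>x. \<phi> x $ i) \<in> borel_measurable borel" for i j
    using trig_poly_borel[OF \<phi>] trig_poly_borel[OF trig_poly_partial_x[OF \<phi>]] by auto
  have "(LINT r:{s..t}|lebesgue. LINT x:torus_cell|lebesgue.
            u r x \<bullet> partial_t T ?\<psi> r x
            + (\<Sum>i\<in>UNIV. \<Sum>j\<in>UNIV. u r x $ i * u r x $ j * partial_x j (?\<psi> r) x $ i)) = integral {s..t} G"
  proof (rule lebesgue_integral_Icc_eq)
    show "continuous_on {s..t} G" by (rule continuous_on_subset[OF cont]) (use st in auto)
    fix r assume r: "r \<in> {s..t}"
    then have r': "r \<in> {0..<T}" using st by auto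
    note [measurable] = represents_component(2)[OF U r']
    have pt: "partial_t T ?\<psi> r x = 0" for x
    proof -
      have "((\<lambda>r. \<eta> r *\<^sub>R \<phi> x) has_vector_derivative 0) (at r within {0..<T})"
        using has_vector_derivative_scaleR[OF has_field_derivative_at_within[OF \<eta>(1)[of r]] has_vector_derivative_const[of "\<phi> x"]] \<eta>(4)[of r] r
        by simp
      then show ?thesis unfolding partial_t_def by (intro vector_derivative_within at_within_Ico_not_bot r')
    qed
    have "(LINT x:torus_cell|lebesgue. u r x \<bullet> partial_t T ?\<psi> r x
            + (\<Sum>i\<in>UNIV. \<Sum>j\<in>UNIV. u r x $ i * u r x $ j * partial_x j (?\<psi> r) x $ i))
        = (\<integral>x. (\<Sum>i\<in>UNIV. \<Sum>j\<in>UNIV. U r x $ i * U r x $ j * partial_x j (\<lambda>x. \<phi> x $ i) x) \<partial>\<T>)"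
    proof (rule integral_torus_measure_AE)
      show "AE x in lebesgue. u r x \<bullet> partial_t T ?\<psi> r x
            + (\<Sum>i\<in>UNIV. \<Sum>j\<in>UNIV. u r x $ i * u r x $ j * partial_x j (?\<psi> r) x $ i)
          = (\<Sum>i\<in>UNIV. \<Sum>j\<in>UNIV. U r x $ i * U r x $ j * partial_x j (\<lambda>x. \<phi> x $ i) x)"
        using represents_component(3)[OF U r']
        by eventually_elim (use r \<eta>(3) in \<open>simp add: pt partial_x_unique[OF d\<phi>]\<close>, simp add: \<phi>'_def)
    qed measurable
    also have "\<dots> = G r"
      unfolding G_def
      by (subst Bochner_Integration.integral_sum)
        (intro Bochner_Integration.integrable_sum sum.cong refl Bochner_Integration.integral_sum integrable_mult_trig_poly trig_poly_partial_x \<phi> L2_path_integrable(2)[OF path path r'])+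
    finally show "(LINT x:torus_cell|lebesgue. u r x \<bullet> partial_t T ?\<psi> r x
            + (\<Sum>i\<in>UNIV. \<Sum>j\<in>UNIV. u r x $ i * u r x $ j * partial_x j (?\<psi> r) x $ i)) = G r" .
  qed
  moreover have "(LINT x:torus_cell|lebesgue. u r x \<bullet> ?\<psi> r x) = (\<Sum>i\<in>UNIV. \<integral>x. U r x $ i * \<phi> x $ i \<partial>\<T>)"
    if r: "r \<in> {s, t}" for r
  proof -
    have r': "r \<in> {0..<T}" using r st by auto
    note [measurable] = represents_component(2)[OF U r']
    have "(LINT x:torus_cell|lebesgue. u r x \<bullet> ?\<psi> r x) = (\<integral>x. (\<Sum>i\<in>UNIV. U r x $ i * \<phi> x $ i) \<partial>\<T>)"
    proof (rule integral_torus_measure_AE)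
      show "AE x in lebesgue. u r x \<bullet> ?\<psi> r x = (\<Sum>i\<in>UNIV. U r x $ i * \<phi> x $ i)"
        using represents_component(3)[OF U r'] by eventually_elim (use r st \<eta>(3) in \<open>auto simp: inner_vec_def\<close>)
    qed measurable
    also have "\<dots> = (\<Sum>i\<in>UNIV. \<integral>x. U r x $ i * \<phi> x $ i \<partial>\<T>)"
      by (intro Bochner_Integration.integral_sum integrable_mult_trig_poly \<phi> L2_path_integrable(1)[OF path path r'])
    finally show ?thesis .
  qed
  ultimately show ?thesis using eq by (simp add: G_def[abs_def])
qed simp

subsection \<open>Evolution of the mollified energy\<close>

text \<open>Separability of \<open>K\<close> reduces the evolution of the form to finitely many scalar functions of
  time: the moments \<open>c\<close> of \<open>u - v\<close>, which are continuous, and primitives \<open>A\<close> of continuous fluxes.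
  Symmetry of \<open>K\<close> gives \<open>F t' - F t = \<Sum> (c t' + c t) * (A t' - A t)\<close>, so that \<open>F\<close> is differentiable.\<close>

lemma kform_evolution:
  fixes u v U V :: "real \<Rightarrow> real ^ 'n \<Rightarrow> real ^ 'n" and K :: "real ^ 'n \<Rightarrow> real"
  assumes u: "continuous_torus_L2 T u" "represents T u U" "euler_momentum T u" "euler_incompressible T u"
    and v: "continuous_torus_L2 T v" "represents T v V" "euler_momentum T v" "euler_incompressible T v"
    and K: "trig_poly K" and even: "\<And>z. K (- z) = K z"
  defines "F \<equiv> \<lambda>t. \<Sum>i\<in>UNIV. kform K (\<lambda>x. U t x $ i - V t x $ i) (\<lambda>x. U t x $ i - V t x $ i)"
    and "Q \<equiv> \<lambda>t. \<Sum>i\<in>UNIV. \<Sum>j\<in>UNIV. kform (partial_x j K)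
       (\<lambda>x. U t x $ i * U t x $ j - V t x $ i * V t x $ j) (\<lambda>x. U t x $ i - V t x $ i)"
  assumes t: "0 \<le> t" "t < T"
  shows "((\<lambda>r. 2 * Q r) has_integral (F t - F 0)) {0..t}"
proof -
  obtain M :: nat and a b where a: "\<And>m. m < M \<Longrightarrow> trig_poly (a m)" and b: "\<And>m. m < M \<Longrightarrow> trig_poly (b m)"
    and ab: "\<And>x y. K (x - y) = (\<Sum>m<M. a m x * b m y)"
    using trig_poly_separable[OF K] by blast
  let ?S = "{0..<T}"
  define w where "w r x = U r x - V r x" for r x
  note pU = L2_path_component[OF u(1,2)] and pV = L2_path_component[OF v(1,2)]
  note iU = L2_path_integrable[OF pU pU] and iV = L2_path_integrable[OF pV pV]
  have iw: "integrable \<T> (\<lambda>x. w r x $ i)" if "r \<in> ?S" for r i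
    using iU(1)[OF that] iV(1)[OF that] by (simp add: w_def)
  have F: "F r = (\<Sum>i\<in>UNIV. kform K (\<lambda>x. w r x $ i) (\<lambda>x. w r x $ i))" for r
    by (simp add: F_def w_def)
  have da: "partial_x j K (x - y) = (\<Sum>m<M. partial_x j (a m) x * b m y)" for j x y
  proof -
    have "partial_x j K (x - y) = partial_x j (\<lambda>x. K (x - y)) x" by (rule partial_x_trig_poly_shift(1)[OF K, symmetric])
    also have "(\<lambda>x. K (x - y)) = (\<lambda>x. \<Sum>m<M. b m y * a m x)" by (simp add: ab mult.commute)
    also have "partial_x j \<dots> x = (\<Sum>m<M. b m y * partial_x j (a m) x)"
      by (rule partial_x_sum_trig_poly) (use a in auto)
    finally show ?thesis by (simp add: mult.commute)
  qed

  \<comment> \<open>Scalar moments of the difference and of the flux\<close>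
  define c where "c m i r = (\<integral>x. b m x * w r x $ i \<partial>\<T>)" for m i r
  define d where "d m i r = (\<integral>x. a m x * w r x $ i \<partial>\<T>)" for m i r
  define B where "B m i r = (\<Sum>j\<in>UNIV. (\<integral>x. U r x $ i * U r x $ j * partial_x j (a m) x \<partial>\<T>)
      - (\<integral>x. V r x $ i * V r x $ j * partial_x j (a m) x \<partial>\<T>))" for m i r
  define A where "A m i r = integral {0..r} (B m i)" for m i r
  \<comment> \<open>The polarised form of F: w is taken at time r in the first argument and at time
    s in the second. Moving r with s frozen is what the weak formulation allows.\<close>
  define G where "G r s = (\<Sum>i\<in>UNIV. \<Sum>m<M. d m i r * c m i s)" for r s
  have contc: "continuous_on ?S (c m i)" if "m < M" for m i
  proof -
    have "continuous_on ?S (\<lambda>r. (\<integral>x. U r x $ i * b m x \<partial>\<T>) - (\<integral>x. V r x $ i * b m x \<partial>\<T>))"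
      by (intro continuous_on_diff L2_path_trig_continuous(1)[OF pU pU] L2_path_trig_continuous(1)[OF pV pV] b that)
    moreover have "(\<integral>x. U r x $ i * b m x \<partial>\<T>) - (\<integral>x. V r x $ i * b m x \<partial>\<T>) = c m i r" if r: "r \<in> ?S" for r
      using integrable_mult_trig_poly[OF b[OF \<open>m < M\<close>] iU(1)[OF r]] integrable_mult_trig_poly[OF b[OF \<open>m < M\<close>] iV(1)[OF r]]
      by (simp add: c_def w_def mult.commute[of "b m _"] left_diff_distrib)
    ultimately show ?thesis by (rule continuous_on_eq)
  qed
  have contB: "continuous_on ?S (B m i)" if "m < M" for m i
    unfolding B_def
    by (intro continuous_on_sum continuous_on_diff L2_path_trig_continuous(2)[OF pU pU] L2_path_trig_continuous(2)[OF pV pV]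
        trig_poly_partial_x a that)
  have intB: "B m i integrable_on {r..s}" if "0 \<le> r" "s < T" "m < M" for r s m i
    by (rule integrable_continuous_real, rule continuous_on_subset[OF contB]) (use that in auto)
  have kG: "(\<Sum>i\<in>UNIV. kform K (\<lambda>x. w r x $ i) (\<lambda>x. w s x $ i)) = G r s" if "r \<in> ?S" "s \<in> ?S" for r s
    unfolding G_def c_def d_def by (intro sum.cong refl kform_separable(4)[OF ab a b iw iw] that)
  have Gsym: "G r s = G s r" if "r \<in> ?S" "s \<in> ?S" for r s
  proof -
    have "kform K (\<lambda>x. w r x $ i) (\<lambda>x. w s x $ i) = kform K (\<lambda>x. w s x $ i) (\<lambda>x. w r x $ i)" for i
      using kform_swap[OF K iw[OF that(1)] iw[OF that(2)], of 1] even by simp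
    then show ?thesis using kG[OF that] kG[OF that(2,1)] by simp
  qed

  \<comment> \<open>Evolution with one argument frozen in time\<close>
  have step: "G r2 s - G r1 s = (\<Sum>i\<in>UNIV. \<Sum>m<M. c m i s * (A m i r2 - A m i r1))"
    if s: "s \<in> ?S" and r: "0 \<le> r1" "r1 \<le> r2" "r2 < T" for r1 r2 s
  proof -
    \<comment> \<open>This is the convolution of K with \<open>w s\<close> in separated form, hence
      a trigonometric polynomial.\<close>
    define \<phi> where "\<phi> x = (\<chi> i. \<Sum>m<M. c m i s * a m x)" for x
    have \<phi>: "trig_poly (\<lambda>x. \<phi> x $ i)" for i
      unfolding \<phi>_def by (simp, intro trig_poly_sum trig_poly_cmult a) auto
    have d\<phi>: "partial_x j (\<lambda>x. \<phi> x $ i) x = (\<Sum>m<M. c m i s * partial_x j (a m) x)" for i j x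
      unfolding \<phi>_def by (simp, rule partial_x_sum_trig_poly) (use a in auto)
    \<comment> \<open>The divergence falls on K, and the difference of the two solutions is weakly
      divergence free at the fixed time s.\<close>
    have div: "(\<Sum>i\<in>UNIV. partial_x i (\<lambda>x. \<phi> x $ i) x) = 0" for x
    proof -
      have "partial_x i (\<lambda>x. \<phi> x $ i) x = - (\<integral>y. w s y $ i * partial_x i (\<lambda>y. K (x - y)) y \<partial>\<T>)" for i
      proof -
        have "(\<integral>y. w s y $ i * partial_x i (\<lambda>y. K (x - y)) y \<partial>\<T>)
           = - (\<integral>y. (\<Sum>m<M. partial_x i (a m) x * (b m y * w s y $ i)) \<partial>\<T>)"
          by (simp add: partial_x_trig_poly_shift(2)[OF K] da sum_distrib_left mult_ac)
        also have "\<dots> = - (\<Sum>m<M. partial_x i (a m) x * c m i s)"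
          unfolding c_def
          by (subst Bochner_Integration.integral_sum)
            (auto intro!: integrable_mult_right integrable_trig_poly_mult b iw s)
        finally show ?thesis unfolding d\<phi> by (simp add: mult.commute)
      qed
      moreover have "weakly_div_free (w s)"
        unfolding w_def[abs_def]
        by (intro weakly_div_free_diff iU(1) iV(1) s weakly_div_free_solution[OF u(1,2,4)] weakly_div_free_solution[OF v(1,2,4)])
      ultimately show ?thesis
        using trig_poly_shift_reflection[OF K, of x] by (simp add: weakly_div_free_def sum_negf)
    qed
    have X: "(\<Sum>i\<in>UNIV. \<integral>x. U q x $ i * \<phi> x $ i \<partial>\<T>) - (\<Sum>i\<in>UNIV. \<integral>x. V q x $ i * \<phi> x $ i \<partial>\<T>) = G q s"
      if q: "q \<in> ?S" for q
    proof -
      have "(\<Sum>i\<in>UNIV. \<integral>x. U q x $ i * \<phi> x $ i \<partial>\<T>) - (\<Sum>i\<in>UNIV. \<integral>x. V q x $ i * \<phi> x $ i \<partial>\<T>)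
        = (\<Sum>i\<in>UNIV. \<integral>x. (\<Sum>m<M. c m i s * (a m x * w q x $ i)) \<partial>\<T>)"
        unfolding sum_subtractf[symmetric]
      proof (intro sum.cong refl)
        fix i
        have "(\<integral>x. U q x $ i * \<phi> x $ i \<partial>\<T>) - (\<integral>x. V q x $ i * \<phi> x $ i \<partial>\<T>)
           = (\<integral>x. U q x $ i * \<phi> x $ i - V q x $ i * \<phi> x $ i \<partial>\<T>)"
          by (intro Bochner_Integration.integral_diff[symmetric] integrable_mult_trig_poly \<phi> iU(1)[OF q] iV(1)[OF q])
        also have "\<dots> = (\<integral>x. (\<Sum>m<M. c m i s * (a m x * w q x $ i)) \<partial>\<T>)"
          unfolding left_diff_distrib[symmetric] by (simp add: w_def \<phi>_def sum_distrib_left mult_ac)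
        finally show "(\<integral>x. U q x $ i * \<phi> x $ i \<partial>\<T>) - (\<integral>x. V q x $ i * \<phi> x $ i \<partial>\<T>)
           = (\<integral>x. (\<Sum>m<M. c m i s * (a m x * w q x $ i)) \<partial>\<T>)" .
      qed
      also have "\<dots> = (\<Sum>i\<in>UNIV. \<Sum>m<M. c m i s * d m i q)"
        unfolding d_def
        by (intro sum.cong refl, subst Bochner_Integration.integral_sum)
          (auto intro!: integrable_mult_right integrable_trig_poly_mult a iw q)
      finally show ?thesis by (simp add: G_def mult.commute)
    qed
    have mom: "(\<Sum>i\<in>UNIV. \<integral>x. W r2 x $ i * \<phi> x $ i \<partial>\<T>) - (\<Sum>i\<in>UNIV. \<integral>x. W r1 x $ i * \<phi> x $ i \<partial>\<T>)
      = integral {r1..r2} (\<lambda>q. \<Sum>i\<in>UNIV. \<Sum>j\<in>UNIV. \<integral>x. W q x $ i * W q x $ j * partial_x j (\<lambda>x. \<phi> x $ i) x \<partial>\<T>)"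
      "(\<lambda>q. \<Sum>i\<in>UNIV. \<Sum>j\<in>UNIV. \<integral>x. W q x $ i * W q x $ j * partial_x j (\<lambda>x. \<phi> x $ i) x \<partial>\<T>) integrable_on {r1..r2}"
      if W: "continuous_torus_L2 T y" "represents T y W" "euler_momentum T y" for y W
    proof -
      show "(\<Sum>i\<in>UNIV. \<integral>x. W r2 x $ i * \<phi> x $ i \<partial>\<T>) - (\<Sum>i\<in>UNIV. \<integral>x. W r1 x $ i * \<phi> x $ i \<partial>\<T>)
      = integral {r1..r2} (\<lambda>q. \<Sum>i\<in>UNIV. \<Sum>j\<in>UNIV. \<integral>x. W q x $ i * W q x $ j * partial_x j (\<lambda>x. \<phi> x $ i) x \<partial>\<T>)"
        by (rule weak_momentum[OF W \<phi> div r])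
      have "continuous_on ?S (\<lambda>q. \<Sum>i\<in>UNIV. \<Sum>j\<in>UNIV. \<integral>x. W q x $ i * W q x $ j * partial_x j (\<lambda>x. \<phi> x $ i) x \<partial>\<T>)"
        by (intro continuous_on_sum L2_path_trig_continuous(2) L2_path_component[OF W(1,2)] trig_poly_partial_x \<phi>)
      then show "(\<lambda>q. \<Sum>i\<in>UNIV. \<Sum>j\<in>UNIV. \<integral>x. W q x $ i * W q x $ j * partial_x j (\<lambda>x. \<phi> x $ i) x \<partial>\<T>) integrable_on {r1..r2}"
        using r by (intro integrable_continuous_real) (auto elim!: continuous_on_subset)
    qed
    have "G r2 s - G r1 s = integral {r1..r2} (\<lambda>q. (\<Sum>i\<in>UNIV. \<Sum>j\<in>UNIV. \<integral>x. U q x $ i * U q x $ j * partial_x j (\<lambda>x. \<phi> x $ i) x \<partial>\<T>)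
        - (\<Sum>i\<in>UNIV. \<Sum>j\<in>UNIV. \<integral>x. V q x $ i * V q x $ j * partial_x j (\<lambda>x. \<phi> x $ i) x \<partial>\<T>))"
      using X[of r1] X[of r2] r mom(1)[OF u(1-3)] mom(1)[OF v(1-3)]
      by (simp add: Henstock_Kurzweil_Integration.integral_diff[OF mom(2)[OF u(1-3)] mom(2)[OF v(1-3)]])
    also have "\<dots> = integral {r1..r2} (\<lambda>q. \<Sum>i\<in>UNIV. \<Sum>m<M. c m i s * B m i q)"
    proof (rule integral_cong)
      fix q assume "q \<in> {r1..r2}"
      then have q: "q \<in> ?S" using r by auto
      have *: "(\<integral>x. W x $ i * W x $ j * partial_x j (\<lambda>x. \<phi> x $ i) x \<partial>\<T>)
        = (\<Sum>m<M. c m i s * (\<integral>x. W x $ i * W x $ j * partial_x j (a m) x \<partial>\<T>))"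
        if "integrable \<T> (\<lambda>x. W x $ i * W x $ j)" for W :: "real ^ 'n \<Rightarrow> real ^ 'n" and i j
      proof -
        have "(\<integral>x. W x $ i * W x $ j * partial_x j (\<lambda>x. \<phi> x $ i) x \<partial>\<T>)
          = (\<integral>x. (\<Sum>m<M. c m i s * (W x $ i * W x $ j * partial_x j (a m) x)) \<partial>\<T>)"
          unfolding d\<phi> by (simp add: sum_distrib_left mult_ac)
        also have "\<dots> = (\<Sum>m<M. c m i s * (\<integral>x. W x $ i * W x $ j * partial_x j (a m) x \<partial>\<T>))"
          by (subst Bochner_Integration.integral_sum)
            (auto intro!: integrable_mult_right integrable_mult_trig_poly trig_poly_partial_x a that)
        finally show ?thesis .
      qed
      have "(\<Sum>i\<in>UNIV. \<Sum>j\<in>UNIV. \<integral>x. U q x $ i * U q x $ j * partial_x j (\<lambda>x. \<phi> x $ i) x \<partial>\<T>)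
          - (\<Sum>i\<in>UNIV. \<Sum>j\<in>UNIV. \<integral>x. V q x $ i * V q x $ j * partial_x j (\<lambda>x. \<phi> x $ i) x \<partial>\<T>)
        = (\<Sum>i\<in>UNIV. \<Sum>j\<in>UNIV. \<Sum>m<M. c m i s * ((\<integral>x. U q x $ i * U q x $ j * partial_x j (a m) x \<partial>\<T>)
          - (\<integral>x. V q x $ i * V q x $ j * partial_x j (a m) x \<partial>\<T>)))"
        by (simp add: *[OF iU(2)[OF q]] *[OF iV(2)[OF q]] sum_subtractf[symmetric] right_diff_distrib)
      also have "\<dots> = (\<Sum>i\<in>UNIV. \<Sum>m<M. c m i s * B m i q)"
        unfolding B_def sum_distrib_left by (intro sum.cong refl sum.swap)
      finally show "(\<Sum>i\<in>UNIV. \<Sum>j\<in>UNIV. \<integral>x. U q x $ i * U q x $ j * partial_x j (\<lambda>x. \<phi> x $ i) x \<partial>\<T>)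
          - (\<Sum>i\<in>UNIV. \<Sum>j\<in>UNIV. \<integral>x. V q x $ i * V q x $ j * partial_x j (\<lambda>x. \<phi> x $ i) x \<partial>\<T>)
        = (\<Sum>i\<in>UNIV. \<Sum>m<M. c m i s * B m i q)" .
    qed
    also have "\<dots> = (\<Sum>i\<in>UNIV. \<Sum>m<M. c m i s * integral {r1..r2} (B m i))"
      by (rule integral_unique, intro has_integral_sum has_integral_mult_right integrable_integral intB)
        (use r in auto)
    also have "\<dots> = (\<Sum>i\<in>UNIV. \<Sum>m<M. c m i s * (A m i r2 - A m i r1))"
    proof (intro sum.cong refl)
      fix i m assume "m \<in> {..<M}"
      then have "integral {0..r1} (B m i) + integral {r1..r2} (B m i) = integral {0..r2} (B m i)"
        using r by (intro Henstock_Kurzweil_Integration.integral_combine intB) auto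
      then have "integral {r1..r2} (B m i) = A m i r2 - A m i r1" by (simp add: A_def)
      then show "c m i s * integral {r1..r2} (B m i) = c m i s * (A m i r2 - A m i r1)" by simp
    qed
    finally show ?thesis .
  qed
  have step': "G r2 s - G r1 s = (\<Sum>i\<in>UNIV. \<Sum>m<M. c m i s * (A m i r2 - A m i r1))"
    if "s \<in> ?S" "r1 \<in> ?S" "r2 \<in> ?S" for r1 r2 s
  proof (cases "r1 \<le> r2")
    case True
    then show ?thesis using that by (intro step) auto
  next
    case False
    then have "G r1 s - G r2 s = (\<Sum>i\<in>UNIV. \<Sum>m<M. c m i s * (A m i r1 - A m i r2))"
      using that by (intro step) auto
    then have "G r2 s - G r1 s = - (\<Sum>i\<in>UNIV. \<Sum>m<M. c m i s * (A m i r1 - A m i r2))" by simp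
    then show ?thesis by (simp add: sum_negf[symmetric] algebra_simps)
  qed
  have Fdiff: "F s - F r = (\<Sum>i\<in>UNIV. \<Sum>m<M. (c m i s + c m i r) * (A m i s - A m i r))"
    if "r \<in> ?S" "s \<in> ?S" for r s
  proof -
    \<comment> \<open>The two middle terms cancel by symmetry of G. The first bracket freezes the
      second argument at s, the other one at r.\<close>
    have "F s - F r = (G s s - G r s) + (G s r - G r r)"
      unfolding F kG[OF that(1,1)] kG[OF that(2,2)] using Gsym[OF that] by simp
    also have "\<dots> = (\<Sum>i\<in>UNIV. \<Sum>m<M. (c m i s + c m i r) * (A m i s - A m i r))"
      unfolding step'[OF that(2,1,2)] step'[OF that(1,1,2)] by (simp add: sum.distrib[symmetric] distrib_right)
    finally show ?thesis .
  qed

  \<comment> \<open>The flux in terms of the moments\<close>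
  have Q: "Q r = (\<Sum>i\<in>UNIV. \<Sum>m<M. c m i r * B m i r)" if r: "r \<in> ?S" for r
  proof -
    have "kform (partial_x j K) (\<lambda>x. U r x $ i * U r x $ j - V r x $ i * V r x $ j) (\<lambda>x. w r x $ i)
       = (\<Sum>m<M. c m i r * ((\<integral>x. U r x $ i * U r x $ j * partial_x j (a m) x \<partial>\<T>)
          - (\<integral>x. V r x $ i * V r x $ j * partial_x j (a m) x \<partial>\<T>)))" for i j
    proof -
      have "kform (partial_x j K) (\<lambda>x. U r x $ i * U r x $ j - V r x $ i * V r x $ j) (\<lambda>x. w r x $ i)
        = (\<Sum>m<M. (\<integral>x. partial_x j (a m) x * (U r x $ i * U r x $ j - V r x $ i * V r x $ j) \<partial>\<T>)
            * (\<integral>y. b m y * w r y $ i \<partial>\<T>))"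
        by (rule kform_separable(4)[OF da trig_poly_partial_x[OF a] b]) (auto intro!: Bochner_Integration.integrable_diff iU(2) iV(2) iw r)
      also have "\<dots> = (\<Sum>m<M. c m i r * ((\<integral>x. U r x $ i * U r x $ j * partial_x j (a m) x \<partial>\<T>)
          - (\<integral>x. V r x $ i * V r x $ j * partial_x j (a m) x \<partial>\<T>)))"
      proof (intro sum.cong refl)
        fix m assume "m \<in> {..<M}"
        then have "trig_poly (partial_x j (a m))" by (intro trig_poly_partial_x a) auto
        from integrable_mult_trig_poly[OF this iU(2)[OF r]] integrable_mult_trig_poly[OF this iV(2)[OF r]]
        have "(\<integral>x. partial_x j (a m) x * (U r x $ i * U r x $ j - V r x $ i * V r x $ j) \<partial>\<T>)
           = (\<integral>x. U r x $ i * U r x $ j * partial_x j (a m) x \<partial>\<T>)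
          - (\<integral>x. V r x $ i * V r x $ j * partial_x j (a m) x \<partial>\<T>)"
          by (simp add: mult.commute[of "partial_x j (a m) _"] left_diff_distrib)
        then show "(\<integral>x. partial_x j (a m) x * (U r x $ i * U r x $ j - V r x $ i * V r x $ j) \<partial>\<T>)
            * (\<integral>y. b m y * w r y $ i \<partial>\<T>)
           = c m i r * ((\<integral>x. U r x $ i * U r x $ j * partial_x j (a m) x \<partial>\<T>)
          - (\<integral>x. V r x $ i * V r x $ j * partial_x j (a m) x \<partial>\<T>))"
          by (simp add: c_def mult.commute)
      qed
      finally show ?thesis .
    qed
    then have "Q r = (\<Sum>i\<in>UNIV. \<Sum>j\<in>UNIV. \<Sum>m<M. c m i r * ((\<integral>x. U r x $ i * U r x $ j * partial_x j (a m) x \<partial>\<T>)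
          - (\<integral>x. V r x $ i * V r x $ j * partial_x j (a m) x \<partial>\<T>)))"
      by (simp add: Q_def w_def)
    also have "\<dots> = (\<Sum>i\<in>UNIV. \<Sum>m<M. c m i r * B m i r)"
      unfolding B_def sum_distrib_left by (intro sum.cong refl sum.swap)
    finally show ?thesis .
  qed

  \<comment> \<open>Differentiation of the form in time\<close>
  have "(F has_real_derivative 2 * Q r) (at r within {0..t})" if r: "r \<in> {0..t}" for r
  proof -
    have sub: "{0..t} \<subseteq> ?S" and r': "r \<in> ?S" using t r by auto
    have lim: "((\<lambda>s. \<Sum>i\<in>UNIV. \<Sum>m<M. (c m i s + c m i r) * ((A m i s - A m i r) / (s - r)))
       \<longlongrightarrow> (\<Sum>i\<in>UNIV. \<Sum>m<M. (c m i r + c m i r) * B m i r)) (at r within {0..t})"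
    proof (intro tendsto_intros)
      fix i m assume "m \<in> {..<M}"
      then have m: "m < M" by simp
      show "(c m i \<longlongrightarrow> c m i r) (at r within {0..t})"
        using continuous_on_subset[OF contc[OF m] sub] r by (auto simp: continuous_on_def)
      have "((\<lambda>x. integral {0..x} (B m i)) has_real_derivative B m i r) (at r within {0..t})"
        by (rule integral_has_real_derivative) (use r continuous_on_subset[OF contB[OF m] sub] in auto)
      then show "((\<lambda>s. (A m i s - A m i r) / (s - r)) \<longlongrightarrow> B m i r) (at r within {0..t})"
        by (simp add: has_field_derivative_iff A_def)
    qed
    have val: "(\<Sum>i\<in>UNIV. \<Sum>m<M. (c m i r + c m i r) * B m i r) = 2 * Q r"
      unfolding Q[OF r'] sum_distrib_left by (intro sum.cong refl) simp
    have ev: "\<forall>\<^sub>F s in at r within {0..t}. (\<Sum>i\<in>UNIV. \<Sum>m<M. (c m i s + c m i r) * ((A m i s - A m i r) / (s - r))) = (F s - F r) / (s - r)"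
      unfolding eventually_at_filter
    proof (intro always_eventually allI impI)
      fix s assume "s \<in> {0..t}"
      then have "s \<in> ?S" using sub by blast
      from Fdiff[OF r' this] show "(\<Sum>i\<in>UNIV. \<Sum>m<M. (c m i s + c m i r) * ((A m i s - A m i r) / (s - r))) = (F s - F r) / (s - r)"
        by (simp add: sum_divide_distrib)
    qed
    show ?thesis
      using Lim_transform_eventually[OF lim ev] unfolding has_field_derivative_iff val .
  qed
  then show ?thesis
    by (intro fundamental_theorem_of_calculus t) (simp add: has_real_derivative_iff_has_vector_derivative[symmetric])
qed

subsection \<open>A Gronwall inequality with integrable coefficient\<close>

lemma AE_lebesgue_negligible:
  fixes P :: "'a::euclidean_space \<Rightarrow> bool"
  assumes "AE x in lebesgue. P x"
  obtains N where "negligible N" "\<And>x. x \<notin> N \<Longrightarrow> P x"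
proof -
  obtain N where "{x. \<not> P x} \<subseteq> N" "N \<in> null_sets lebesgue"
    using assms by (auto elim!: AE_E simp: null_sets_def)
  then show ?thesis using that by (auto simp: negligible_iff_null_sets)
qed

text \<open>If f exceeded g at t, it would do so on an interval to the right of t, which stays in
  the domain even for t = 0 and is not negligible.\<close>

lemma AE_le_continuous:
  fixes f g :: "real \<Rightarrow> real"
  assumes f: "continuous_on {0..<T} f" and g: "continuous_on {0..<T} g"
    and ae: "AE t in lebesgue. t \<in> {0..<T} \<longrightarrow> f t \<le> g t" and t: "t \<in> {0..<T}"
  shows "f t \<le> g t"
proof (rule ccontr)
  assume "\<not> f t \<le> g t"
  then have pos: "0 < f t - g t" by simp
  have "((\<lambda>s. f s - g s) \<longlongrightarrow> f t - g t) (at t within {0..<T})"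
    using f g t by (auto simp: continuous_on_def intro!: tendsto_intros)
  then have "\<forall>\<^sub>F s in at t within {0..<T}. 0 < f s - g s"
    using pos by (rule order_tendstoD(1))
  then obtain d where d: "0 < d" "\<And>s. s \<in> {0..<T} \<Longrightarrow> s \<noteq> t \<Longrightarrow> dist s t < d \<Longrightarrow> 0 < f s - g s"
    unfolding eventually_at by auto
  define e where "e = min (d / 2) ((T - t) / 2)"
  have e: "0 < e" "e < d" "t + e < T" using d t by (auto simp: e_def min_def field_simps)
  obtain N where N: "negligible N" "\<And>s. s \<notin> N \<Longrightarrow> s \<in> {0..<T} \<longrightarrow> f s \<le> g s"
    using AE_lebesgue_negligible[OF ae] by blast
  have "{t..t + e} \<subseteq> N"
  proof
    fix s assume s: "s \<in> {t..t + e}"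
    then have "0 < f s - g s" using d(2)[of s] pos e t by (cases "s = t") (auto simp: dist_real_def)
    then show "s \<in> N" using N(2)[of s] s e t by force
  qed
  then have "negligible (cbox t (t + e))" using N(1) negligible_subset by auto
  then have "box t (t + e) = {}" by (simp only: negligible_interval)
  then show False using e by simp
qed

text \<open>Since b < T, W is bounded on the compact interval, and a bounded measurable factor
  preserves absolute integrability.\<close>

lemma integrable_coefficient_mult:
  fixes C W :: "real \<Rightarrow> real"
  assumes W: "continuous_on {0..<T} W" and C: "set_integrable lebesgue {0..<T} C" and ab: "0 \<le> a" "b < T"
  shows "C integrable_on {a..b}" "(\<lambda>r. C r * W r) integrable_on {a..b}"
proof -
  have sub: "{a..b} \<subseteq> {0..<T}" using ab by auto
  have Cab: "C absolutely_integrable_on {a..b}" by (rule absolutely_integrable_on_subinterval[OF C sub])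
  then show "C integrable_on {a..b}" by (rule set_lebesgue_integral_eq_integral(1))
  have Wab: "continuous_on {a..b} W" by (rule continuous_on_subset[OF W sub])
  have "(\<lambda>r. W r * C r) absolutely_integrable_on {a..b}"
    by (rule absolutely_integrable_bounded_measurable_product_real[OF _ _ _ Cab])
      (auto intro!: continuous_imp_measurable_on_sets_lebesgue Wab compact_imp_bounded compact_continuous_image)
  then show "(\<lambda>r. C r * W r) integrable_on {a..b}"
    using set_lebesgue_integral_eq_integral(1) by (simp add: mult.commute)
qed

text \<open>C is merely integrable, so the proof advances by steps on which C has small integral
  instead of using a pointwise bound. If W vanishes up to s, its maximum on the next step is at most
  half of itself, hence zero.\<close>

lemma integral_gronwall_zero:
  fixes C W :: "real \<Rightarrow> real"
  assumes W: "continuous_on {0..<T} W" and W0: "\<And>t. t \<in> {0..<T} \<Longrightarrow> 0 \<le> W t"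
    and C: "set_integrable lebesgue {0..<T} C" and C0: "\<And>t. t \<in> {0..<T} \<Longrightarrow> 0 \<le> C t"
    and le: "\<And>t. t \<in> {0..<T} \<Longrightarrow> W t \<le> 2 * integral {0..t} (\<lambda>r. C r * W r)"
    and t: "t \<in> {0..<T}"
  shows "W t = 0"
proof -
  note int = integrable_coefficient_mult[OF W C]
  have cont: "continuous_on {0..t} (\<lambda>s. integral {0..s} C)"
    by (rule indefinite_integral_continuous_1, rule int(1)) (use t in auto)
  then have "uniformly_continuous_on {0..t} (\<lambda>s. integral {0..s} C)"
    by (rule compact_uniformly_continuous) simp
  \<comment> \<open>Uniform continuity of the primitive of C provides one step length for all of
    \<open>{0..t}\<close>. The threshold 1/4, against the factor 2 in the hypothesis, yields the
    contraction factor 1/2.\<close>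
  then obtain d where d: "0 < d" "\<And>r s. r \<in> {0..t} \<Longrightarrow> s \<in> {0..t} \<Longrightarrow> dist s r < d \<Longrightarrow> dist (integral {0..s} C) (integral {0..r} C) < 1 / 4"
    unfolding uniformly_continuous_on_def by (metis zero_less_divide_1_iff zero_less_numeral)
  have "\<forall>r\<in>{0..min t (real n * (d / 2))}. W r = 0" for n
  proof (induction n)
    case 0
    have "W 0 = 0" using le[of 0] W0[of 0] t by simp
    then show ?case using t by simp
  next
    case (Suc n)
    define s where "s = min t (real n * (d / 2))"
    define s' where "s' = min t (real (Suc n) * (d / 2))"
    have s: "0 \<le> s" "s \<le> s'" "s' \<le> t" "s' - s \<le> d / 2"
      using t d by (auto simp: s_def s'_def min_def algebra_simps)
    have zero: "W r = 0" if "r \<in> {0..s}" for r using Suc that by (simp add: s_def)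
    have "continuous_on {s..s'} W" by (rule continuous_on_subset[OF W]) (use s t in auto)
    \<comment> \<open>The inequality is evaluated where W is maximal on the step, so that
      \<open>W r\<close> under the integral can be replaced by \<open>W q\<close>.\<close>
    then obtain q where q: "q \<in> {s..s'}" "\<And>r. r \<in> {s..s'} \<Longrightarrow> W r \<le> W q"
      using continuous_attains_sup[of "{s..s'}" W] s by auto
    have qT: "0 \<le> q" "q \<le> t" "q < T" using q s t by auto
    have "W q \<le> 2 * integral {0..q} (\<lambda>r. C r * W r)" using le[of q] qT by auto
    also have "integral {0..q} (\<lambda>r. C r * W r) = integral {0..s} (\<lambda>r. C r * W r) + integral {s..q} (\<lambda>r. C r * W r)"
      by (rule Henstock_Kurzweil_Integration.integral_combine[symmetric]) (use q s qT int(2) in auto)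
    also have "integral {0..s} (\<lambda>r. C r * W r) = integral {0..s} (\<lambda>_. 0)"
      by (rule integral_cong) (use zero in auto)
    also have "integral {s..q} (\<lambda>r. C r * W r) \<le> integral {s..q} (\<lambda>r. C r * W q)"
    proof (rule integral_le)
      show "(\<lambda>r. C r * W r) integrable_on {s..q}" using int(2)[of s q] s qT by simp
      show "(\<lambda>r. C r * W q) integrable_on {s..q}" using int(1)[of s q] s qT by (intro integrable_on_mult_left) simp
      show "C r * W r \<le> C r * W q" if "r \<in> {s..q}" for r
        using that q s qT by (intro mult_left_mono C0) auto
    qed
    also have "\<dots> = integral {s..q} C * W q" by simp
    also have "integral {s..q} C = integral {0..q} C - integral {0..s} C"
      using Henstock_Kurzweil_Integration.integral_combine[of 0 s q C] int(1)[of 0 q] q s qT by auto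
    finally have 1: "W q \<le> 2 * ((integral {0..q} C - integral {0..s} C) * W q)" by simp
    have "dist (integral {0..q} C) (integral {0..s} C) < 1 / 4"
      by (rule d(2)) (use q s qT d in \<open>auto simp: dist_real_def\<close>)
    then have "integral {0..q} C - integral {0..s} C \<le> 1 / 4" unfolding dist_real_def by linarith
    moreover have "0 \<le> W q" using W0 qT by simp
    ultimately have "(integral {0..q} C - integral {0..s} C) * W q \<le> 1 / 4 * W q" by (rule mult_right_mono)
    with 1 \<open>0 \<le> W q\<close> have "W q = 0" by linarith
    then have "W r = 0" if "r \<in> {s..s'}" for r using q(2)[OF that] W0[of r] that s t by auto
    then have "W r = 0" if "r \<in> {0..s'}" for r using zero[of r] that by (cases "r \<le> s") auto
    then show ?case by (simp add: s'_def)
  qed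
  moreover obtain n :: nat where "t / (d / 2) < real n" using reals_Archimedean2 by blast
  then have "t \<le> real n * (d / 2)" using d by (simp add: field_simps)
  ultimately show ?thesis using t by (metis atLeastAtMost_iff atLeastLessThan_iff min.absorb1 order_refl)
qed

subsection \<open>Besov functions have small increments in \<open>L\<^sup>q\<close>, \<open>q \<le> p\<close>\<close>

text \<open>Lowers the exponent from p to q on a space of finite measure: |f|^q is at most A^q where
  |f| \<le> A, and A^q (|f| / A)^p elsewhere. The second part integrates to at most A^q, which
  explains the summand 1 in the constant.\<close>

lemma nn_integral_power_le_of_powr:
  fixes f :: "real ^ 'n \<Rightarrow> real" and p A :: real
  assumes [measurable]: "f \<in> borel_measurable borel" and p: "real q \<le> p" and A: "0 < A"
    and int: "integrable \<T> (\<lambda>x. \<bar>f x\<bar> powr p)" and le: "(\<integral>x. \<bar>f x\<bar> powr p \<partial>\<T>) \<le> A powr p"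
  shows "(\<integral>\<^sup>+x. ennreal (\<bar>f x\<bar> ^ q) \<partial>\<T>) \<le> ennreal ((measure (\<T> :: (real ^ 'n) measure) UNIV + 1) * A ^ q)"
proof -
  have pt: "\<bar>f x\<bar> ^ q \<le> A ^ q + A ^ q * A powr (- p) * \<bar>f x\<bar> powr p" for x
  proof (cases "\<bar>f x\<bar> \<le> A")
    case True
    then have "\<bar>f x\<bar> ^ q \<le> A ^ q" by (intro power_mono) auto
    then show ?thesis using A by (simp add: add_increasing2)
  next
    case False
    then have "1 \<le> \<bar>f x\<bar> / A" using A by simp
    then have "(\<bar>f x\<bar> / A) powr real q \<le> (\<bar>f x\<bar> / A) powr p" using p by (intro powr_mono) auto
    then have "\<bar>f x\<bar> ^ q \<le> A ^ q * (\<bar>f x\<bar> powr p / A powr p)"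
      using A False by (simp add: powr_divide powr_realpow power_divide field_simps)
    also have "\<dots> = A ^ q * A powr (- p) * \<bar>f x\<bar> powr p" by (simp add: powr_minus_divide)
    finally show ?thesis using A by (simp add: add_increasing)
  qed
  have "(\<integral>\<^sup>+x. ennreal (\<bar>f x\<bar> ^ q) \<partial>\<T>) \<le> (\<integral>\<^sup>+x. ennreal (A ^ q + A ^ q * A powr (- p) * \<bar>f x\<bar> powr p) \<partial>\<T>)"
    by (intro nn_integral_mono ennreal_leI pt)
  also have "\<dots> = ennreal (\<integral>x. A ^ q + A ^ q * A powr (- p) * \<bar>f x\<bar> powr p \<partial>\<T>)"
    using int A by (intro nn_integral_eq_integral) auto
  also have "(\<integral>x. A ^ q + A ^ q * A powr (- p) * \<bar>f x\<bar> powr p \<partial>\<T>)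
      = measure (\<T> :: (real ^ 'n) measure) UNIV * A ^ q + A ^ q * A powr (- p) * (\<integral>x. \<bar>f x\<bar> powr p \<partial>\<T>)"
    using int by simp
  also have "ennreal \<dots> \<le> ennreal ((measure (\<T> :: (real ^ 'n) measure) UNIV + 1) * A ^ q)"
  proof (rule ennreal_leI)
    have "A ^ q * A powr (- p) * (\<integral>x. \<bar>f x\<bar> powr p \<partial>\<T>) \<le> A ^ q * A powr (- p) * A powr p"
      using A le by (intro mult_left_mono) auto
    also have "\<dots> = A ^ q" using A by (simp add: powr_minus_divide)
    finally show "measure (\<T> :: (real ^ 'n) measure) UNIV * A ^ q + A ^ q * A powr (- p) * (\<integral>x. \<bar>f x\<bar> powr p \<partial>\<T>)
       \<le> (measure (\<T> :: (real ^ 'n) measure) UNIV + 1) * A ^ q" by (simp add: algebra_simps)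
  qed
  finally show ?thesis .
qed

lemma AE_lebesgue_translation:
  fixes P :: "real ^ 'n \<Rightarrow> bool"
  assumes "AE x in lebesgue. P x"
  shows "AE x in lebesgue. P (x + z)"
proof -
  have "AE x in distr lborel borel ((+) z). P x" using assms unfolding lborel_distr_plus by (simp add: AE_completion_iff)
  then have "AE x in lborel. P (z + x)" by (rule AE_distrD[rotated]) auto
  then have "AE x in lebesgue. P (z + x)" by (rule AE_completion)
  then show ?thesis by (simp add: add.commute)
qed

lemma torus_Lp_norm_powr:
  assumes p: "0 < p"
  shows "torus_Lp_norm p h powr p = (LINT x:torus_cell|lebesgue. norm (h x) powr p)"
proof -
  have "0 \<le> (LINT x:torus_cell|lebesgue. norm (h x) powr p)"
    unfolding set_lebesgue_integral_def by (intro integral_nonneg_AE) auto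
  then show ?thesis using p by (simp add: torus_Lp_norm_def powr_powr)
qed

lemma besov_norm_bounds:
  assumes "besov \<alpha> p h"
  shows "0 \<le> torus_Lp_norm p h" "torus_Lp_norm p h \<le> besov_norm \<alpha> p h"
    "z \<noteq> 0 \<Longrightarrow> torus_Lp_norm p (\<lambda>x. h (x + z) - h x) \<le> besov_norm \<alpha> p h * norm z powr \<alpha>"
proof -
  have bdd: "bdd_above (besov_quotient \<alpha> p h ` (UNIV - {0}))" using assms by (simp add: besov_def)
  have q0: "0 \<le> besov_quotient \<alpha> p h \<xi>" for \<xi> by (simp add: besov_quotient_def torus_Lp_norm_def)
  have up: "besov_quotient \<alpha> p h \<xi> \<le> (SUP \<xi>\<in>UNIV - {0}. besov_quotient \<alpha> p h \<xi>)" if "\<xi> \<noteq> 0" for \<xi>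
    using bdd that by (intro cSUP_upper) auto
  show 0: "0 \<le> torus_Lp_norm p h" by (simp add: torus_Lp_norm_def)
  \<comment> \<open>\<open>vec 1\<close> is just some nonzero displacement; its quotient is
    non-negative and lies below the supremum.\<close>
  have "0 \<le> (SUP \<xi>\<in>UNIV - {0}. besov_quotient \<alpha> p h \<xi>)"
    using order_trans[OF q0 up[of "vec 1"]] by (simp add: vec_eq_iff)
  then show "torus_Lp_norm p h \<le> besov_norm \<alpha> p h" by (simp add: besov_norm_def)
  assume z: "z \<noteq> 0"
  have "torus_Lp_norm p (\<lambda>x. h (x + z) - h x) / norm z powr \<alpha> \<le> besov_norm \<alpha> p h"
    using up[OF z] 0 by (simp add: besov_norm_def besov_quotient_def)
  then show "torus_Lp_norm p (\<lambda>x. h (x + z) - h x) \<le> besov_norm \<alpha> p h * norm z powr \<alpha>"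
    using z by (simp add: field_simps)
qed

text \<open>The Besov norm may vanish, whereas \<open>nn_integral_power_le_of_powr\<close> divides
  by its bound A; adding one to the norm makes A positive. The condition \<open>0 < q\<close>
  settles the displacement z = 0, where \<open>0 ^ q\<close> has to be 0.\<close>

lemma
  fixes h g :: "real ^ 'n \<Rightarrow> real"
  assumes h: "besov \<alpha> p h" and p: "0 < p" "real q \<le> p"
    and g[measurable]: "g \<in> borel_measurable borel" and per: "torus_periodic g" and ae: "AE x in lebesgue. h x = g x"
  shows besov_integrable_power: "integrable \<T> (\<lambda>x. \<bar>g x\<bar> ^ q)"
    and besov_increment_bound: "0 < q \<Longrightarrow> increment_bound q (real q * \<alpha>)
       ((measure (\<T> :: (real ^ 'n) measure) UNIV + 1) * (besov_norm \<alpha> p h + 1) ^ q) g"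
proof -
  let ?B = "besov_norm \<alpha> p h"
  note bounds = besov_norm_bounds[OF h]
  have B: "0 \<le> ?B" using bounds(1,2) by linarith
  have intp: "integrable \<T> (\<lambda>x. \<bar>g x\<bar> powr p)"
  proof (rule integrable_torus_measure_AE)
    show "set_integrable lebesgue torus_cell (\<lambda>x. norm (h x) powr p)" using h by (simp add: besov_def torus_Lp_def)
    show "AE x in lebesgue. norm (h x) powr p = \<bar>g x\<bar> powr p" using ae by (auto elim: eventually_mono)
  qed measurable
  have "(\<integral>x. \<bar>g x\<bar> powr p \<partial>\<T>) = torus_Lp_norm p h powr p"
    unfolding torus_Lp_norm_powr[OF p(1)]
    by (rule integral_torus_measure_AE[symmetric]) (use ae in \<open>auto elim: eventually_mono\<close>)
  also have "\<dots> \<le> (?B + 1) powr p" using bounds(1,2) p by (intro powr_mono2) auto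
  finally have "(\<integral>\<^sup>+x. ennreal (\<bar>g x\<bar> ^ q) \<partial>\<T>) \<le> ennreal ((measure (\<T> :: (real ^ 'n) measure) UNIV + 1) * (?B + 1) ^ q)"
    using B by (intro nn_integral_power_le_of_powr[OF g p(2) _ intp]) auto
  then show "integrable \<T> (\<lambda>x. \<bar>g x\<bar> ^ q)"
    by (intro integrableI_bounded) (auto intro: le_less_trans)
  assume q: "0 < q"
  show "increment_bound q (real q * \<alpha>) ((measure (\<T> :: (real ^ 'n) measure) UNIV + 1) * (?B + 1) ^ q) g"
    unfolding increment_bound_def
  proof (intro conjI allI g per)
    fix z :: "real ^ 'n"
    show "(\<integral>\<^sup>+x. ennreal (\<bar>g (x + z) - g x\<bar> ^ q) \<partial>\<T>)
      \<le> ennreal ((measure (\<T> :: (real ^ 'n) measure) UNIV + 1) * (?B + 1) ^ q * norm z powr (real q * \<alpha>))"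
    proof (cases "z = 0")
      case False
      define A where "A = (?B + 1) * norm z powr \<alpha>"
      have A: "0 < A" using B False by (simp add: A_def)
      have intp': "integrable \<T> (\<lambda>x. \<bar>g (x + z)\<bar> powr p)"
        using integrable_torus_translation[of "\<lambda>x. \<bar>g x\<bar> powr p" z] intp per by (simp add: torus_periodic_def)
      have "integrable \<T> (\<lambda>x. \<bar>g (x + z) - g x\<bar> powr p)"
      proof (rule Bochner_Integration.integrable_bound)
        show "integrable \<T> (\<lambda>x. 2 powr p * (\<bar>g (x + z)\<bar> powr p + \<bar>g x\<bar> powr p))" using intp intp' by simp
        have "\<bar>a - b\<bar> powr p \<le> 2 powr p * (\<bar>a\<bar> powr p + \<bar>b\<bar> powr p)" for a b :: real
        proof -
          have "\<bar>a - b\<bar> powr p \<le> (2 * max \<bar>a\<bar> \<bar>b\<bar>) powr p" using p by (intro powr_mono2) auto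
          also have "\<dots> = 2 powr p * max \<bar>a\<bar> \<bar>b\<bar> powr p" by (rule powr_mult)
          also have "\<dots> \<le> 2 powr p * (\<bar>a\<bar> powr p + \<bar>b\<bar> powr p)" by (intro mult_left_mono) (auto simp: max_def)
          finally show ?thesis .
        qed
        then show "AE x in \<T>. norm (\<bar>g (x + z) - g x\<bar> powr p) \<le> norm (2 powr p * (\<bar>g (x + z)\<bar> powr p + \<bar>g x\<bar> powr p))"
          by simp
      qed measurable
      moreover have "(\<integral>x. \<bar>g (x + z) - g x\<bar> powr p \<partial>\<T>) \<le> A powr p"
      proof -
        have "(\<integral>x. \<bar>g (x + z) - g x\<bar> powr p \<partial>\<T>) = torus_Lp_norm p (\<lambda>x. h (x + z) - h x) powr p"
          unfolding torus_Lp_norm_powr[OF p(1)]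
        proof (rule integral_torus_measure_AE[symmetric])
          show "AE x in lebesgue. norm (h (x + z) - h x) powr p = \<bar>g (x + z) - g x\<bar> powr p"
            using ae AE_lebesgue_translation[OF ae, of z] by eventually_elim simp
        qed measurable
        also have "\<dots> \<le> A powr p"
        proof (rule powr_mono2)
          have "torus_Lp_norm p (\<lambda>x. h (x + z) - h x) \<le> ?B * norm z powr \<alpha>" by (rule bounds(3)[OF False])
          also have "\<dots> \<le> A" by (simp add: A_def distrib_right)
          finally show "torus_Lp_norm p (\<lambda>x. h (x + z) - h x) \<le> A" .
        qed (use p in \<open>auto simp: torus_Lp_norm_def\<close>)
        finally show ?thesis .
      qed
      ultimately have "(\<integral>\<^sup>+x. ennreal (\<bar>g (x + z) - g x\<bar> ^ q) \<partial>\<T>)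
         \<le> ennreal ((measure (\<T> :: (real ^ 'n) measure) UNIV + 1) * A ^ q)"
        by (intro nn_integral_power_le_of_powr[OF _ p(2) A]) auto
      also have "A ^ q = (?B + 1) ^ q * norm z powr (real q * \<alpha>)"
        unfolding A_def power_mult_distrib using False by (simp add: powr_realpow[symmetric] powr_powr mult.commute)
      finally show ?thesis by (simp add: mult.assoc)
    qed (use q in simp)
  qed
qed

lemma increment_bound_mono:
  assumes "increment_bound q \<beta> M f" "M \<le> M'"
  shows "increment_bound q \<beta> M' f"
proof -
  have "ennreal (M * norm z powr \<beta>) \<le> ennreal (M' * norm z powr \<beta>)" for z :: "real ^ 'a"
    using assms by (intro ennreal_leI mult_right_mono) auto
  then show ?thesis using assms unfolding increment_bound_def by (meson order_trans)
qed

text \<open>The factor \<open>2 ^ q\<close> comes from bounding a difference by twice the larger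
  term; for q = 3 and q = 2 it supplies the 8 and the 4 in the bounds for w.\<close>

lemma increment_bound_diff:
  fixes f g :: "real ^ 'n \<Rightarrow> real"
  assumes f: "increment_bound q \<beta> M f" and g: "increment_bound q \<beta> M' g" and M: "0 \<le> M" "0 \<le> M'"
  shows "increment_bound q \<beta> (2 ^ q * (M + M')) (\<lambda>x. f x - g x)"
  unfolding increment_bound_def
proof (intro conjI allI)
  have [measurable]: "f \<in> borel_measurable borel" "g \<in> borel_measurable borel"
    using f g by (auto simp: increment_bound_def)
  show "(\<lambda>x. f x - g x) \<in> borel_measurable borel" by measurable
  show "torus_periodic (\<lambda>x. f x - g x)" using f g by (simp add: increment_bound_def torus_periodic_def)
  fix z
  have pt: "\<bar>a - b\<bar> ^ q \<le> 2 ^ q * (\<bar>a\<bar> ^ q + \<bar>b\<bar> ^ q)" for a b :: real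
  proof -
    have "\<bar>a - b\<bar> ^ q \<le> (2 * max \<bar>a\<bar> \<bar>b\<bar>) ^ q" by (intro power_mono) auto
    also have "\<dots> = 2 ^ q * max \<bar>a\<bar> \<bar>b\<bar> ^ q" by (rule power_mult_distrib)
    also have "\<dots> \<le> 2 ^ q * (\<bar>a\<bar> ^ q + \<bar>b\<bar> ^ q)" by (intro mult_left_mono) (auto simp: max_def)
    finally show ?thesis .
  qed
  have "(\<integral>\<^sup>+x. ennreal (\<bar>f (x + z) - g (x + z) - (f x - g x)\<bar> ^ q) \<partial>\<T>)
      \<le> (\<integral>\<^sup>+x. 2 ^ q * (ennreal (\<bar>f (x + z) - f x\<bar> ^ q) + ennreal (\<bar>g (x + z) - g x\<bar> ^ q)) \<partial>\<T>)"
  proof (intro nn_integral_mono)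
    fix x
    have "\<bar>f (x + z) - g (x + z) - (f x - g x)\<bar> ^ q = \<bar>(f (x + z) - f x) - (g (x + z) - g x)\<bar> ^ q"
      by (simp add: algebra_simps)
    also note pt
    finally have "ennreal (\<bar>f (x + z) - g (x + z) - (f x - g x)\<bar> ^ q)
        \<le> ennreal (2 ^ q * (\<bar>f (x + z) - f x\<bar> ^ q + \<bar>g (x + z) - g x\<bar> ^ q))" by (rule ennreal_leI)
    then show "ennreal (\<bar>f (x + z) - g (x + z) - (f x - g x)\<bar> ^ q)
       \<le> 2 ^ q * (ennreal (\<bar>f (x + z) - f x\<bar> ^ q) + ennreal (\<bar>g (x + z) - g x\<bar> ^ q))"
      by (simp add: ennreal_mult ennreal_power[symmetric])
  qed
  also have "\<dots> = 2 ^ q * ((\<integral>\<^sup>+x. ennreal (\<bar>f (x + z) - f x\<bar> ^ q) \<partial>\<T>) + (\<integral>\<^sup>+x. ennreal (\<bar>g (x + z) - g x\<bar> ^ q) \<partial>\<T>))"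
    by (simp add: nn_integral_cmult nn_integral_add)
  also have "\<dots> \<le> 2 ^ q * (ennreal (M * norm z powr \<beta>) + ennreal (M' * norm z powr \<beta>))"
    using f g by (intro mult_left_mono add_mono) (auto simp: increment_bound_def)
  also have "\<dots> = ennreal (2 ^ q * (M + M') * norm z powr \<beta>)"
  proof -
    have "(2 :: ennreal) ^ q = ennreal (2 ^ q)" by (simp add: ennreal_power[symmetric])
    then show ?thesis using M
      by (simp add: ennreal_plus[symmetric] ennreal_mult'[symmetric] algebra_simps del: ennreal_plus)
  qed
  finally show "(\<integral>\<^sup>+x. ennreal (\<bar>f (x + z) - g (x + z) - (f x - g x)\<bar> ^ q) \<partial>\<T>) \<le> ennreal (2 ^ q * (M + M') * norm z powr \<beta>)" .
qed

subsection \<open>Weak-strong uniqueness\<close>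

lemma vec_besov_norm_component:
  assumes "vec_besov \<alpha> p h"
  shows "besov_norm \<alpha> p (\<lambda>x. h x $ i) \<le> vec_besov_norm \<alpha> p h" "0 \<le> besov_norm \<alpha> p (\<lambda>x. h x $ i)"
    "0 \<le> vec_besov_norm \<alpha> p h"
proof -
  have nonneg: "0 \<le> besov_norm \<alpha> p (\<lambda>x. h x $ j)" for j
    using besov_norm_bounds(1,2)[of \<alpha> p "\<lambda>x. h x $ j"] assms by (force simp: vec_besov_def)
  then show "0 \<le> besov_norm \<alpha> p (\<lambda>x. h x $ i)" "0 \<le> vec_besov_norm \<alpha> p h"
    by (auto simp: vec_besov_norm_def intro: sum_nonneg)
  show "besov_norm \<alpha> p (\<lambda>x. h x $ i) \<le> vec_besov_norm \<alpha> p h"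
    unfolding vec_besov_norm_def by (rule member_le_sum) (use nonneg in auto)
qed

lemma vec_besov_increments:
  fixes h g :: "real ^ 'n \<Rightarrow> real ^ 'm"
  assumes h: "vec_besov \<alpha> p h" and p: "3 \<le> p" and q: "0 < q" "q \<le> 3"
    and g: "g \<in> borel_measurable borel" "torus_periodic g" "AE x in lebesgue. h x = g x"
  shows "torus_L3 (\<lambda>x. g x $ i)"
    and "increment_bound q (real q * \<alpha>)
       ((measure (\<T> :: (real ^ 'n) measure) UNIV + 1) * (vec_besov_norm \<alpha> p h + 1) ^ q) (\<lambda>x. g x $ i)"
proof -
  have b: "besov \<alpha> p (\<lambda>x. h x $ i)" using h by (simp add: vec_besov_def)
  have m: "(\<lambda>x. g x $ i) \<in> borel_measurable borel" by (rule borel_measurable_vec_nth_comp[OF g(1)])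
  have per: "torus_periodic (\<lambda>x. g x $ i)" using g(2) by (simp add: torus_periodic_def)
  have ae: "AE x in lebesgue. h x $ i = g x $ i" using g(3) by (auto elim: eventually_mono)
  show "torus_L3 (\<lambda>x. g x $ i)"
    unfolding torus_L3_def using m besov_integrable_power[OF b _ _ m per ae, of 3] p by simp
  show "increment_bound q (real q * \<alpha>)
       ((measure (\<T> :: (real ^ 'n) measure) UNIV + 1) * (vec_besov_norm \<alpha> p h + 1) ^ q) (\<lambda>x. g x $ i)"
  proof (rule increment_bound_mono[OF besov_increment_bound[OF b _ _ m per ae q(1)]])
    show "(measure (\<T> :: (real ^ 'n) measure) UNIV + 1) * (besov_norm \<alpha> p (\<lambda>x. h x $ i) + 1) ^ q
      \<le> (measure (\<T> :: (real ^ 'n) measure) UNIV + 1) * (vec_besov_norm \<alpha> p h + 1) ^ q"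
      using vec_besov_norm_component[OF h] by (intro mult_left_mono power_mono) auto
  qed (use p q in auto)
qed

lemma one_sided_LipschitzI:
  fixes v V :: "real ^ 'n \<Rightarrow> real ^ 'n"
  assumes lip: "\<And>\<zeta> \<phi>. torus_smooth \<phi> \<Longrightarrow> (\<And>x. 0 \<le> \<phi> x) \<Longrightarrow>
      0 \<le> (LINT x:torus_cell|lebesgue. - (\<zeta> \<bullet> v x) * (\<Sum>j\<in>UNIV. \<zeta> $ j * partial_x j \<phi> x) + C * (norm \<zeta>)\<^sup>2 * \<phi> x)"
    and V[measurable]: "V \<in> borel_measurable borel" and ae: "AE x in lebesgue. v x = V x"
  shows "one_sided_Lipschitz C V"
  unfolding one_sided_Lipschitz_def
proof (intro allI impI)
  fix \<zeta> :: "real ^ 'n" and \<phi> :: "real ^ 'n \<Rightarrow> real" assume \<phi>: "trig_poly \<phi>" "\<forall>x. 0 \<le> \<phi> x"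
  have [measurable]: "\<phi> \<in> borel_measurable borel" "partial_x j \<phi> \<in> borel_measurable borel" for j
    using trig_poly_borel[OF \<phi>(1)] trig_poly_borel[OF trig_poly_partial_x[OF \<phi>(1)]] by auto
  have "0 \<le> (LINT x:torus_cell|lebesgue. - (\<zeta> \<bullet> v x) * (\<Sum>j\<in>UNIV. \<zeta> $ j * partial_x j \<phi> x) + C * (norm \<zeta>)\<^sup>2 * \<phi> x)"
    by (rule lip) (use \<phi> trig_poly_smooth in auto)
  also have "\<dots> = (\<integral>x. - (\<zeta> \<bullet> V x) * (\<Sum>j\<in>UNIV. \<zeta> $ j * partial_x j \<phi> x) + C * (norm \<zeta>)\<^sup>2 * \<phi> x \<partial>\<T>)"
    by (rule integral_torus_measure_AE) (measurable, use ae in \<open>auto elim: eventually_mono\<close>)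
  finally show "0 \<le> (\<integral>x. - (\<zeta> \<bullet> V x) * (\<Sum>j\<in>UNIV. \<zeta> $ j * partial_x j \<phi> x) + C * (norm \<zeta>)\<^sup>2 * \<phi> x \<partial>\<T>)" .
qed

lemma kform_zero_AE:
  assumes "AE x in \<T>. f x = 0"
  shows "kform k f f = 0"
proof -
  have "(\<integral>y. k (x - y) * (f x * f y) \<partial>\<T>) = 0" for x
    by (rule integral_eq_zero_AE) (use assms in \<open>auto elim: eventually_mono\<close>)
  then show ?thesis by (simp add: kform_def)
qed

text \<open>Compares the cubes produced by the increment bounds with the powers
  \<open>powr 3\<close> whose integrability in time is assumed.\<close>

lemma cube_add_one_le:
  assumes "0 \<le> (a :: real)"
  shows "(a + 1) ^ 3 \<le> 8 * (a powr 3 + 1)"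
proof -
  have "(a + 1) ^ 3 \<le> (2 * max a 1) ^ 3" using assms by (intro power_mono) auto
  also have "\<dots> = 8 * max a 1 ^ 3" by (simp add: power_mult_distrib)
  also have "\<dots> \<le> 8 * (a ^ 3 + 1)" using assms by (auto simp: max_def)
  also have "a ^ 3 = a powr 3" using assms by simp
  finally show ?thesis .
qed

text \<open>Changing f to g on the exceptional negligible set alters neither integral and makes the
  inequality hold everywhere.\<close>

lemma has_integral_le_AE:
  fixes f g :: "real \<Rightarrow> real"
  assumes f: "(f has_integral a) S" and g: "(g has_integral b) S" and le: "AE t in lebesgue. t \<in> S \<longrightarrow> f t \<le> g t"
  shows "a \<le> b"
proof -
  obtain N where N: "negligible N" "\<And>t. t \<notin> N \<Longrightarrow> t \<in> S \<longrightarrow> f t \<le> g t"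
    using AE_lebesgue_negligible[OF le] by blast
  have "((\<lambda>t. if t \<in> N then g t else f t) has_integral a) S"
    by (rule has_integral_spike[OF N(1) _ f]) auto
  from has_integral_le[OF this g] N(2) show ?thesis by auto
qed

lemma continuous_on_interval_IcoI:
  fixes f :: "real \<Rightarrow> real"
  assumes "\<And>b. b < T \<Longrightarrow> continuous_on {0..b} f"
  shows "continuous_on {0..<T} f"
  unfolding continuous_on_def
proof
  fix t assume t: "t \<in> {0..<T}"
  then obtain b where b: "t < b" "b < T" using dense[of t T] by auto
  have "at t within {0..<T} = at t within {0..b}"
    by (rule at_within_nhd[of t "{..<b}"]) (use t b in auto)
  then show "(f \<longlongrightarrow> f t) (at t within {0..<T})"
    using assms[OF b(2)] t b by (auto simp: continuous_on_def)
qed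

theorem theorem2:
  fixes T \<alpha> p :: real
    and u0 :: "real ^ 'n \<Rightarrow> real ^ 'n"
    and u v :: "real \<Rightarrow> real ^ 'n \<Rightarrow> real ^ 'n"
    and C :: "real \<Rightarrow> real"
  assumes "CARD('n) \<ge> 2" and "T > 0"
    and "torus_Lp 2 u0"
    and "euler_weak_solution T u0 u" and "euler_weak_solution T u0 v"
    and "0 < \<alpha>" and "\<alpha> < 1" and "\<alpha> > 1 / 3" and "p \<ge> 3"
    and "Lq_besov 3 T \<alpha> p u" and "Lq_besov 3 T \<alpha> p v"
    and "\<forall>t\<in>{0..<T}. C t \<ge> 0" and "set_integrable lebesgue {0..<T} C"
    and "\<forall>\<zeta> \<tau> (\<phi> :: real ^ 'n \<Rightarrow> real). \<tau> \<in> {0..<T} \<longrightarrow> torus_smooth \<phi> \<longrightarrow> (\<forall>x. \<phi> x \<ge> 0) \<longrightarrow>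
      (LINT x:torus_cell|lebesgue.
         - (\<zeta> \<bullet> v \<tau> x) * (\<Sum>j\<in>UNIV. \<zeta> $ j * partial_x j \<phi> x) + C \<tau> * (norm \<zeta>)\<^sup>2 * \<phi> x) \<ge> 0"
  shows "\<forall>t\<in>{0..<T}. AE x in lebesgue. u t x = v t x"
proof -
  let ?S = "{0..<T}" and ?N = "real CARD('n)"
  have u: "continuous_torus_L2 T u" "euler_momentum T u" "euler_incompressible T u" "AE x in lebesgue. u 0 x = u0 x"
    and v: "continuous_torus_L2 T v" "euler_momentum T v" "euler_incompressible T v" "AE x in lebesgue. v 0 x = u0 x"
    using assms(4,5) by (auto simp: euler_weak_solution_def)
  obtain U V where U: "represents T u U" and V: "represents T v V"
    using ex_represents[OF u(1)] ex_represents[OF v(1)] by blast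
  note Ur = represents_component[OF U] and Vr = represents_component[OF V]
  note pU = L2_path_component[OF u(1) U] and pV = L2_path_component[OF v(1) V]
  note iU = L2_path_integrable[OF pU] and iV = L2_path_integrable[OF pV]
  define w where "w t x = U t x - V t x" for t x
  define W where "W t = (\<integral>x. (norm (w t x))\<^sup>2 \<partial>\<T>)" for t
  define F where "F n t = (\<Sum>i\<in>UNIV. kform (vp_kernel n) (\<lambda>x. w t x $ i) (\<lambda>x. w t x $ i))" for n t
  define Q where "Q n t = (\<Sum>i\<in>UNIV. \<Sum>j\<in>UNIV. kform (partial_x j (vp_kernel n))
     (\<lambda>x. U t x $ i * U t x $ j - V t x $ i * V t x $ j) (\<lambda>x. w t x $ i))" for n t
  define \<mu> where "\<mu> n = (\<Sum>j\<in>(UNIV :: 'n set). \<integral>z. \<bar>partial_x j (vp_kernel n) z\<bar> * norm (z :: real ^ 'n) powr (3 * \<alpha>) \<partial>\<T>)" for n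
  define \<kappa> where "\<kappa> n = (\<integral>z. vp_kernel n z * norm (z :: real ^ 'n) powr (2 * \<alpha>) \<partial>\<T>)" for n
  \<comment> \<open>From 1/3 < \<alpha> < 1 the order 3\<alpha> lies in (1, 3), the range of the
    gradient moments, and 2\<alpha> in (0, 2), that of the plain moments.\<close>
  have \<mu>: "\<mu> \<longlonglongrightarrow> 0"
    unfolding \<mu>_def[abs_def] by (rule tendsto_null_sum) (rule vp_kernel_gradient_moment, use assms in auto)
  have \<kappa>: "\<kappa> \<longlonglongrightarrow> 0"
    unfolding \<kappa>_def[abs_def] by (rule vp_kernel_moment) (use assms in auto)
  define vol where "vol = measure (\<T> :: (real ^ 'n) measure) UNIV + 1"
  have vol: "0 < vol" by (simp add: vol_def add_nonneg_pos)
  define nu where "nu t = vec_besov_norm \<alpha> p (u t)" for t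
  define nv where "nv t = vec_besov_norm \<alpha> p (v t)" for t
  \<comment> \<open>One bound for the cubic increments of u, v and w: 64 is 8 from the difference w
    = u - v times 8 from \<open>cube_add_one_le\<close>, and 2 collects the two summands 1. Powers
    of order three keep it integrable in time.\<close>
  define M where "M t = 64 * vol * (nu t powr 3 + nv t powr 3 + 2)" for t

  \<comment> \<open>The energy of the difference and its continuity in time\<close>
  have wint: "integrable \<T> (\<lambda>x. w t x $ i * w t x $ i)"
    and W_sum: "W t = (\<Sum>i\<in>UNIV. \<integral>x. (w t x $ i)\<^sup>2 \<partial>\<T>)"
    and W_eq: "W t = (\<Sum>i\<in>UNIV. (\<integral>x. U t x $ i * U t x $ i * 1 \<partial>\<T>)
        - 2 * (\<integral>x. U t x $ i * V t x $ i * 1 \<partial>\<T>) + (\<integral>x. V t x $ i * V t x $ i * 1 \<partial>\<T>))"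
    if t: "t \<in> ?S" for t i
  proof -
    have int: "integrable \<T> (\<lambda>x. U t x $ i * U t x $ i)" "integrable \<T> (\<lambda>x. U t x $ i * V t x $ i)"
       "integrable \<T> (\<lambda>x. V t x $ i * V t x $ i)" for i
      using iU(2)[OF pU t] iU(2)[OF pV t] iV(2)[OF pV t] by auto
    have eq: "w t x $ i * w t x $ i = U t x $ i * U t x $ i - 2 * (U t x $ i * V t x $ i) + V t x $ i * V t x $ i" for x i
      by (simp add: w_def algebra_simps)
    show wi: "integrable \<T> (\<lambda>x. w t x $ i * w t x $ i)" for i
      unfolding eq using int by simp
    have nsq: "(norm (w t x))\<^sup>2 = (\<Sum>i\<in>UNIV. w t x $ i * w t x $ i)" for x
      unfolding power2_norm_eq_inner by (simp add: inner_vec_def)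
    have W1: "W t = (\<Sum>i\<in>UNIV. \<integral>x. w t x $ i * w t x $ i \<partial>\<T>)"
      unfolding W_def nsq by (rule Bochner_Integration.integral_sum) (rule wi)
    then show "W t = (\<Sum>i\<in>UNIV. \<integral>x. (w t x $ i)\<^sup>2 \<partial>\<T>)" by (simp add: power2_eq_square)
    show "W t = (\<Sum>i\<in>UNIV. (\<integral>x. U t x $ i * U t x $ i * 1 \<partial>\<T>)
        - 2 * (\<integral>x. U t x $ i * V t x $ i * 1 \<partial>\<T>) + (\<integral>x. V t x $ i * V t x $ i * 1 \<partial>\<T>))"
      unfolding W1 eq using int by simp
  qed
  have W0: "0 \<le> W t" for t unfolding W_def by (intro integral_nonneg_AE) auto
  have contW: "continuous_on ?S W"
  proof -
    have "continuous_on ?S (\<lambda>t. \<Sum>i\<in>UNIV. (\<integral>x. U t x $ i * U t x $ i * 1 \<partial>\<T>)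
        - 2 * (\<integral>x. U t x $ i * V t x $ i * 1 \<partial>\<T>) + (\<integral>x. V t x $ i * V t x $ i * 1 \<partial>\<T>))"
      by (intro continuous_intros L2_path_trig_continuous(2) pU pV trig_poly_const)
    then show ?thesis by (rule continuous_on_eq) (simp only: W_eq)
  qed

  \<comment> \<open>Evolution of the mollified energies from coinciding initial data\<close>
  have evol: "((\<lambda>r. 2 * Q n r) has_integral F n t) {0..t}" if t: "t \<in> ?S" for n t
  proof -
    have "F n 0 = 0"
    proof -
      have "AE x in lebesgue. w 0 x = 0"
        using u(4) v(4) Ur(3)[of 0] Vr(3)[of 0] \<open>T > 0\<close> by (auto simp: w_def elim: eventually_elim2)
      then have "AE x in \<T>. w 0 x $ i = 0" for i
        by (intro AE_torus_measure) (auto elim: eventually_mono)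
      then show ?thesis unfolding F_def by (simp add: kform_zero_AE)
    qed
    then show ?thesis
      using kform_evolution[OF u(1) U u(2,3) v(1) V v(2,3) trig_poly_vp_kernel[of n] vp_kernel_even, of t] t
      by (simp add: F_def Q_def w_def)
  qed

  \<comment> \<open>Increment bounds and flux estimate at almost every time\<close>
  have ae_besov: "AE t in lebesgue. t \<in> ?S \<longrightarrow> vec_besov \<alpha> p (u t) \<and> vec_besov \<alpha> p (v t)"
    using assms(10,11) unfolding Lq_besov_def by (auto elim: eventually_elim2)
  have besov_bounds: "torus_L3 (\<lambda>x. U t x $ i)" "torus_L3 (\<lambda>x. V t x $ i)"
      "increment_bound 3 (3 * \<alpha>) (M t) (\<lambda>x. U t x $ i)" "increment_bound 3 (3 * \<alpha>) (M t) (\<lambda>x. V t x $ i)"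
      "increment_bound 3 (3 * \<alpha>) (M t) (\<lambda>x. w t x $ i)"
      "increment_bound 2 (2 * \<alpha>) (4 * (vol * (nu t + 1)\<^sup>2 + vol * (nv t + 1)\<^sup>2)) (\<lambda>x. w t x $ i)"
      "0 \<le> nu t" "0 \<le> nv t"
    if t: "t \<in> ?S" and b: "vec_besov \<alpha> p (u t)" "vec_besov \<alpha> p (v t)" for t i
  proof -
    note iu = vec_besov_increments[OF b(1) assms(9) _ _ Ur(1,4,3)[OF t], folded vol_def nu_def]
      and iv = vec_besov_increments[OF b(2) assms(9) _ _ Vr(1,4,3)[OF t], folded vol_def nv_def]
    show "torus_L3 (\<lambda>x. U t x $ i)" "torus_L3 (\<lambda>x. V t x $ i)"
      using iu(1)[of 3] iv(1)[of 3] by auto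
    show n0: "0 \<le> nu t" "0 \<le> nv t"
      unfolding nu_def nv_def using vec_besov_norm_component(3) b by blast+
    have c: "(nu t + 1) ^ 3 \<le> 8 * (nu t powr 3 + 1)" "(nv t + 1) ^ 3 \<le> 8 * (nv t powr 3 + 1)"
      by (intro cube_add_one_le n0)+
    have "vol * (nu t + 1) ^ 3 \<le> vol * (8 * (nu t powr 3 + 1))" "vol * (nv t + 1) ^ 3 \<le> vol * (8 * (nv t powr 3 + 1))"
      using c vol by (simp_all add: mult_left_mono del: distrib_left_numeral)
    moreover have "0 \<le> vol * (nu t + 1) ^ 3" "0 \<le> vol * (nv t + 1) ^ 3" using vol n0 by auto
    ultimately have le: "8 * (vol * (nu t + 1) ^ 3 + vol * (nv t + 1) ^ 3) \<le> M t"
       "vol * (nu t + 1) ^ 3 \<le> M t" "vol * (nv t + 1) ^ 3 \<le> M t"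
      unfolding M_def distrib_left distrib_right mult.assoc by (simp_all add: mult_ac) 
    show "increment_bound 3 (3 * \<alpha>) (M t) (\<lambda>x. U t x $ i)" "increment_bound 3 (3 * \<alpha>) (M t) (\<lambda>x. V t x $ i)"
      using increment_bound_mono[OF _ le(2)] increment_bound_mono[OF _ le(3)] iu(2)[of 3 i] iv(2)[of 3 i] by auto
    have "increment_bound 3 (3 * \<alpha>) (2 ^ 3 * (vol * (nu t + 1) ^ 3 + vol * (nv t + 1) ^ 3)) (\<lambda>x. U t x $ i - V t x $ i)"
      using iu(2)[of 3 i] iv(2)[of 3 i] vol n0 by (intro increment_bound_diff) auto
    from increment_bound_mono[OF this, of "M t"] le(1)
    show "increment_bound 3 (3 * \<alpha>) (M t) (\<lambda>x. w t x $ i)" by (simp add: w_def)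
    have "increment_bound 2 (2 * \<alpha>) (2 ^ 2 * (vol * (nu t + 1)\<^sup>2 + vol * (nv t + 1)\<^sup>2)) (\<lambda>x. U t x $ i - V t x $ i)"
      using iu(2)[of 2 i] iv(2)[of 2 i] vol by (intro increment_bound_diff) auto
    then show "increment_bound 2 (2 * \<alpha>) (4 * (vol * (nu t + 1)\<^sup>2 + vol * (nv t + 1)\<^sup>2)) (\<lambda>x. w t x $ i)"
      by (simp add: w_def)
  qed
  have M0: "0 \<le> M t" for t unfolding M_def using vol by simp

  have flux: "AE t in lebesgue. t \<in> ?S \<longrightarrow> 2 * Q n t \<le> 2 * (C t * W t) + 6 * ?N * \<mu> n * M t" for n
    using ae_besov
  proof (rule eventually_mono, intro impI)
    fix t assume "t \<in> ?S \<longrightarrow> vec_besov \<alpha> p (u t) \<and> vec_besov \<alpha> p (v t)" and "t \<in> ?S"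
    then have b: "vec_besov \<alpha> p (u t)" "vec_besov \<alpha> p (v t)" by auto
    note bd = besov_bounds[OF \<open>t \<in> ?S\<close> b]
    have div: "weakly_div_free (U t)" "weakly_div_free (V t)"
      using weakly_div_free_solution[OF u(1) U u(3) \<open>t \<in> ?S\<close>] weakly_div_free_solution[OF v(1) V v(3) \<open>t \<in> ?S\<close>] by auto
    have lip: "one_sided_Lipschitz (C t) (V t)"
      by (rule one_sided_LipschitzI[OF _ Vr(1,3)[OF \<open>t \<in> ?S\<close>]]) (use assms(14) \<open>t \<in> ?S\<close> in blast)
    have "Q n t \<le> C t * W t + 3 * M t * ?N * \<mu> n"
      unfolding Q_def W_def \<mu>_def
      by (rule euler_flux_bound[OF trig_poly_vp_kernel vp_kernel_nonneg integral_vp_kernel partial_x_vp_kernel_odd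
            w_def bd(1,2) div bd(3-5) M0 _ lip]) (use assms in auto)
    then have "2 * Q n t \<le> 2 * (C t * W t + 3 * M t * ?N * \<mu> n)" by (rule mult_left_mono) simp
    also have "\<dots> = 2 * (C t * W t) + 6 * ?N * \<mu> n * M t" by (simp add: algebra_simps)
    finally show "2 * Q n t \<le> 2 * (C t * W t) + 6 * ?N * \<mu> n * M t" .
  qed

  \<comment> \<open>Integration of the flux estimate in time\<close>
  have intM: "M integrable_on {0..t}" if t: "t \<in> ?S" for t
  proof -
    have "set_integrable lebesgue ?S (\<lambda>t. nu t powr 3)" "set_integrable lebesgue ?S (\<lambda>t. nv t powr 3)"
      using assms(10,11) unfolding Lq_besov_def nu_def nv_def by auto
    moreover have "{0..t} \<subseteq> ?S" using t by auto
    ultimately have "(\<lambda>t. nu t powr 3) integrable_on {0..t}" "(\<lambda>t. nv t powr 3) integrable_on {0..t}"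
      by (auto intro: set_lebesgue_integral_eq_integral(1) absolutely_integrable_on_subinterval)
    then show ?thesis
      unfolding M_def[abs_def] by (intro integrable_on_mult_right integrable_add) auto
  qed
  note intCW = integrable_coefficient_mult(2)[OF contW assms(13)]
  \<comment> \<open>The kernel parameter n enters the right-hand side only through
    \<open>\<mu> n\<close>; both integrals are constants in n.\<close>
  have F_le: "F n t \<le> 2 * integral {0..t} (\<lambda>r. C r * W r) + 6 * ?N * \<mu> n * integral {0..t} M" if t: "t \<in> ?S" for n t
  proof (rule has_integral_le_AE[OF evol[OF t]])
    show "((\<lambda>r. 2 * (C r * W r) + 6 * ?N * \<mu> n * M r) has_integral
        2 * integral {0..t} (\<lambda>r. C r * W r) + 6 * ?N * \<mu> n * integral {0..t} M) {0..t}"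
      using intCW[of 0 t] intM[OF t] t
      by (intro has_integral_add has_integral_mult_right integrable_integral) auto
    show "AE r in lebesgue. r \<in> {0..t} \<longrightarrow> 2 * Q n r \<le> 2 * (C r * W r) + 6 * ?N * \<mu> n * M r"
      using flux[of n] by eventually_elim (use t in auto)
  qed

  \<comment> \<open>The limit of vanishing mollification\<close>
  have "AE t in lebesgue. t \<in> ?S \<longrightarrow> W t \<le> 2 * integral {0..t} (\<lambda>r. C r * W r)"
    using ae_besov
  proof (rule eventually_mono, intro impI)
    fix t assume "t \<in> ?S \<longrightarrow> vec_besov \<alpha> p (u t) \<and> vec_besov \<alpha> p (v t)" and "t \<in> ?S"
    then have b: "vec_besov \<alpha> p (u t)" "vec_besov \<alpha> p (v t)" by auto
    note bd = besov_bounds[OF \<open>t \<in> ?S\<close> b]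
    \<comment> \<open>L depends on t, but the limit in n is taken at fixed t, so its finiteness is
      enough; by contrast M had to be integrated in time.\<close>
    define L where "L = 4 * (vol * (nu t + 1)\<^sup>2 + vol * (nv t + 1)\<^sup>2)"
    have L: "0 \<le> L" using vol by (simp add: L_def)
    have energy: "W t \<le> F n t + ?N * L * \<kappa> n" for n
    proof -
      have "(\<integral>x. (w t x $ i)\<^sup>2 \<partial>\<T>) - kform (vp_kernel n) (\<lambda>x. w t x $ i) (\<lambda>x. w t x $ i) \<le> L * \<kappa> n" for i
        unfolding \<kappa>_def
      proof (rule energy_increment_bound[OF trig_poly_vp_kernel vp_kernel_even integral_vp_kernel vp_kernel_nonneg])
        show "torus_L3 (\<lambda>x. w t x $ i)" using torus_L3_diff[OF bd(1,2)[of i]] by (simp add: w_def)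
        show "increment_bound 2 (2 * \<alpha>) L (\<lambda>x. w t x $ i)" unfolding L_def by (rule bd(6))
      qed (use L assms in auto)
      then have "(\<Sum>i\<in>UNIV. (\<integral>x. (w t x $ i)\<^sup>2 \<partial>\<T>) - kform (vp_kernel n) (\<lambda>x. w t x $ i) (\<lambda>x. w t x $ i))
          \<le> (\<Sum>i\<in>(UNIV :: 'n set). L * \<kappa> n)"
        by (intro sum_mono)
      then show ?thesis
        by (simp add: W_sum[OF \<open>t \<in> ?S\<close>] F_def sum_subtractf)
    qed
    have "W t \<le> (2 * integral {0..t} (\<lambda>r. C r * W r) + 6 * ?N * \<mu> n * integral {0..t} M) + ?N * L * \<kappa> n" for n
      using energy[of n] F_le[OF \<open>t \<in> ?S\<close>, of n] by linarith
    moreover have "(\<lambda>n. (2 * integral {0..t} (\<lambda>r. C r * W r) + 6 * ?N * \<mu> n * integral {0..t} M) + ?N * L * \<kappa> n)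
      \<longlonglongrightarrow> (2 * integral {0..t} (\<lambda>r. C r * W r) + 6 * ?N * 0 * integral {0..t} M) + ?N * L * 0"
      by (intro tendsto_intros \<mu> \<kappa>)
    ultimately have "W t \<le> (2 * integral {0..t} (\<lambda>r. C r * W r) + 6 * ?N * 0 * integral {0..t} M) + ?N * L * 0"
      by (intro LIMSEQ_le_const) auto
    then show "W t \<le> 2 * integral {0..t} (\<lambda>r. C r * W r)" by simp
  qed
  moreover have "continuous_on ?S (\<lambda>t. 2 * integral {0..t} (\<lambda>r. C r * W r))"
  proof (intro continuous_on_mult_left continuous_on_interval_IcoI)
    fix b assume "b < T"
    then show "continuous_on {0..b} (\<lambda>t. integral {0..t} (\<lambda>r. C r * W r))"
      by (intro indefinite_integral_continuous_1 intCW) auto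
  qed
  \<comment> \<open>The Besov bounds leave an exceptional null set of times. Both sides are
    continuous in t, so the inequality extends to every t, as Gronwall's lemma demands.\<close>
  ultimately have W_le: "W t \<le> 2 * integral {0..t} (\<lambda>r. C r * W r)" if "t \<in> ?S" for t
    using AE_le_continuous[OF contW] that by blast

  \<comment> \<open>From vanishing energy to equality almost everywhere\<close>
  show ?thesis
  proof
    fix t assume t: "t \<in> ?S"
    have "W t = 0"
      by (rule integral_gronwall_zero[OF contW W0 assms(13) _ W_le t]) (use assms(12) in auto)
    then have "(\<integral>x. (w t x $ i)\<^sup>2 \<partial>\<T>) = 0" for i
      unfolding W_sum[OF t] by (subst (asm) sum_nonneg_eq_0_iff) (auto intro: integral_nonneg_AE)
    then have "AE x in \<T>. (w t x $ i)\<^sup>2 = 0" for i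
      using wint[OF t] by (subst (asm) integral_nonneg_eq_0_iff_AE) (auto simp: power2_eq_square)
    then have "AE x in \<T>. \<forall>i. (w t x $ i)\<^sup>2 = 0" by (simp add: AE_all_countable)
    then have "AE x in \<T>. U t x = V t x"
      by eventually_elim (simp add: w_def vec_eq_iff)
    moreover have "torus_periodic (\<lambda>x. U t x = V t x)"
      using Ur(4)[OF t] Vr(4)[OF t] by (simp add: torus_periodic_def)
    ultimately have "AE x in lebesgue. U t x = V t x" by (intro AE_torus_periodic)
    with Ur(3)[OF t] Vr(3)[OF t] show "AE x in lebesgue. u t x = v t x"
      by eventually_elim simp
  qed
qed

end
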